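(* Let $X=\{X_n, n\ge 0\}$ be a centered stationary Gaussian sequence of random variables with unit variance, and set $\rho(k)=\mathbb{E}(X_0X_k)$ for $k\ge 0$ and $\rho(k)=\rho(-k)$ for $k<0$. Assume that $g\in L^2(\mathbb{R},\gamma)$ has Hermite rank $d=2$ and satisfies $A(g)\in \mathbb{D}^{2,6}(\mathbb{R},\gamma)$. Suppose that $\sum_{j\in\mathbb{Z}}|\rho(j)|^2<\infty$. For $n\ge 1$ let $F_n=\frac{1}{\sqrt n}\sum_{i=1}^n g(X_i)$ and $Y_n=F_n/\sqrt{\mathrm{Var}(F_n)}$. Let $Z$ be a $N(0,1)$ random variable. Then there is a constant $C$, not depending on $n$, such that for all $n\ge1$ $$d_{\rm W}(Y_n,Z)\le C n^{-\frac12}\Big(\sum_{|k|\le n}|\rho(k)|\Big)^{\frac12}+C n^{-\frac12}\Big(\sum_{|k|\le n}|\rho(k)|^{\frac32}\Big)^{2}.$$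
   Context: $\gamma$ is the standard Gaussian measure on $\mathbb{R}$. $H_q$ is the $q$-th Hermite polynomial: $H_0=1$ and $H_q(x)=(-1)^q e^{x^2/2}\frac{d^q}{dx^q}e^{-x^2/2}$ for $q\ge 1$. A function $g\in L^2(\mathbb{R},\gamma)$ has Hermite rank $d\ge1$ if its Hermite expansion (convergent in $L^2(\mathbb{R},\gamma)$) has the form $g=\sum_{q=d}^\infty c_qH_q$ with $c_d\ne 0$. For such $g$, $A(g)=\sum_{q=d}^\infty |c_q|H_q\in L^2(\mathbb{R},\gamma)$. For an integer $k\ge1$ and real $p\ge1$, $\mathbb{D}^{k,p}(\mathbb{R},\gamma)$ is the Sobolev space of functions that are $k$ times weakly differentiable and that, together with their derivatives up to order $k$, have finite moments of order $p$ with respect to $\gamma$. The Wasserstein distance is $d_{\rm W}(F,G)=\sup_{f\in\mathrm{Lip}(1)}|\mathbb{E}(f(F))-\mathbb{E}(f(G))|$, where $\mathrm{Lip}(1)$ is the set of functions $f:\mathbb{R}\to\mathbb{R}$ that are Lipschitz with Lipschitz constant at most $1$. $C$ denotes a generic constant independent of $n$ (it may depend on $g$ and on the covariance function $\rho$, and may differ from one occurrence to another). *)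

theory Defs
  imports "HOL-Probability.Probability"
begin

definition gauss :: "real measure"  ("\<gamma>") where
  "\<gamma> = density lborel (\<lambda>x. ennreal (std_normal_density x))"

text \<open>Elements of \<open>L\<^sup>p(\<real>, \<gamma>)\<close> are represented by Borel functions; the predicates below do not
  depend on the choice of the representative.\<close>

definition Lp_gauss :: "real \<Rightarrow> (real \<Rightarrow> real) set" where
  "Lp_gauss p = {f \<in> borel_measurable borel. integrable \<gamma> (\<lambda>x. \<bar>f x\<bar> powr p)}"

definition hermite :: "nat \<Rightarrow> real \<Rightarrow> real" where
  "hermite q x = (-1) ^ q * exp (x\<^sup>2 / 2) * (deriv ^^ q) (\<lambda>t. exp (- t\<^sup>2 / 2)) x"

definition has_hermite_expansion :: "(real \<Rightarrow> real) \<Rightarrow> (nat \<Rightarrow> real) \<Rightarrow> bool" where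
  "has_hermite_expansion g c \<longleftrightarrow> g \<in> Lp_gauss 2 \<and>
     (\<lambda>m. LINT x|\<gamma>. (g x - (\<Sum>q\<le>m. c q * hermite q x))\<^sup>2) \<longlonglongrightarrow> 0"

definition has_hermite_rank :: "(real \<Rightarrow> real) \<Rightarrow> nat \<Rightarrow> bool" where
  "has_hermite_rank g d \<longleftrightarrow> d \<ge> 1 \<and>
     (\<exists>c. has_hermite_expansion g c \<and> (\<forall>q<d. c q = 0) \<and> c d \<noteq> 0)"

text \<open>\<open>is_A g h\<close> says that \<open>h\<close> represents \<open>A(g)\<close>. Hermite coefficients are unique, so this
  determines \<open>h\<close> up to \<open>\<gamma>\<close>-null sets.\<close>

definition is_A :: "(real \<Rightarrow> real) \<Rightarrow> (real \<Rightarrow> real) \<Rightarrow> bool" where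
  "is_A g h \<longleftrightarrow> (\<exists>c. has_hermite_expansion g c \<and> has_hermite_expansion h (\<lambda>q. \<bar>c q\<bar>))"

definition test_function :: "(real \<Rightarrow> real) \<Rightarrow> bool" where
  "test_function \<phi> \<longleftrightarrow>
     (\<forall>j x. (deriv ^^ j) \<phi> differentiable (at x)) \<and> compact (closure {x. \<phi> x \<noteq> 0})"

definition locally_integrable :: "(real \<Rightarrow> real) \<Rightarrow> bool" where
  "locally_integrable f \<longleftrightarrow> (\<forall>a b. set_integrable lborel {a..b} f)"

definition has_weak_deriv :: "(real \<Rightarrow> real) \<Rightarrow> (real \<Rightarrow> real) \<Rightarrow> bool" where
  "has_weak_deriv f f' \<longleftrightarrow> locally_integrable f \<and> locally_integrable f' \<and>
     (\<forall>\<phi>. test_function \<phi> \<longrightarrow>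
        (LINT x|lborel. f x * deriv \<phi> x) = - (LINT x|lborel. f' x * \<phi> x))"

definition sobolev_gauss :: "nat \<Rightarrow> real \<Rightarrow> (real \<Rightarrow> real) set" where
  "sobolev_gauss k p = {f. \<exists>D. D 0 = f \<and>
     (\<forall>j<k. has_weak_deriv (D j) (D (Suc j))) \<and> (\<forall>j\<le>k. D j \<in> Lp_gauss p)}"

text \<open>A Gaussian random variable may be degenerate, i.e. almost surely constant.\<close>

definition gaussian_rv :: "'a measure \<Rightarrow> ('a \<Rightarrow> real) \<Rightarrow> bool" where
  "gaussian_rv M Y \<longleftrightarrow> Y \<in> borel_measurable M \<and>
     (\<exists>\<mu> \<sigma>. \<sigma> > 0 \<and> distributed M lborel Y (\<lambda>x. ennreal (normal_density \<mu> \<sigma> x))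
         \<or> (AE \<omega> in M. Y \<omega> = \<mu>))"

definition gaussian_sequence :: "'a measure \<Rightarrow> (nat \<Rightarrow> 'a \<Rightarrow> real) \<Rightarrow> bool" where
  "gaussian_sequence M X \<longleftrightarrow>
     (\<forall>I a. finite I \<longrightarrow> gaussian_rv M (\<lambda>\<omega>. \<Sum>i\<in>I. a i * X i \<omega>))"

definition stationary_sequence :: "'a measure \<Rightarrow> (nat \<Rightarrow> 'a \<Rightarrow> real) \<Rightarrow> bool" where
  "stationary_sequence M X \<longleftrightarrow>
     (\<forall>n. X n \<in> borel_measurable M) \<and>
     (\<forall>m. distr M (\<Pi>\<^sub>M n\<in>UNIV. borel) (\<lambda>\<omega> n. X (n + m) \<omega>) =
          distr M (\<Pi>\<^sub>M n\<in>UNIV. borel) (\<lambda>\<omega> n. X n \<omega>))"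

text \<open>The two random variables may live on different spaces; the supremum is taken in the
  extended reals.\<close>

definition wasserstein_dist ::
    "'a measure \<Rightarrow> ('a \<Rightarrow> real) \<Rightarrow> 'b measure \<Rightarrow> ('b \<Rightarrow> real) \<Rightarrow> ereal" where
  "wasserstein_dist M F N G =
     (SUP f \<in> {f :: real \<Rightarrow> real. 1-lipschitz_on UNIV f}.
        ereal \<bar>(LINT \<omega>|M. f (F \<omega>)) - (LINT \<omega>|N. f (G \<omega>))\<bar>)"

definition F_seq :: "(real \<Rightarrow> real) \<Rightarrow> (nat \<Rightarrow> 'a \<Rightarrow> real) \<Rightarrow> nat \<Rightarrow> 'a \<Rightarrow> real" where
  "F_seq g X n \<omega> = 1 / sqrt (real n) * (\<Sum>i = 1..n. g (X i \<omega>))"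

definition Y_seq ::
    "'a measure \<Rightarrow> (real \<Rightarrow> real) \<Rightarrow> (nat \<Rightarrow> 'a \<Rightarrow> real) \<Rightarrow> nat \<Rightarrow> 'a \<Rightarrow> real" where
  "Y_seq M g X n \<omega> = F_seq g X n \<omega> / sqrt (prob_space.variance M (F_seq g X n))"

end

theory Submission
  imports Defs "HOL-Real_Asymp.Real_Asymp"
begin

text \<open>Let \<open>Y = F\<^sub>n / sd(F\<^sub>n)\<close> for a Hermite polynomial sum \<open>g\<close>, let \<open>g\<^sub>2 = \<Sum> c\<^sub>q H\<^bsub>q-2\<^esub>\<close>, and let \<open>f\<close>
  solve Stein's equation for a smooth test function. Since \<open>g\<close> has rank 2, one can integrate by
  parts twice in each \<open>X\<^sub>i\<close>, which gives \<open>E(Y f(Y)) = E(f'(Y) U) + E(f''(Y) R)\<close>, where \<open>U\<close> is a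
  normalized sum of \<open>\<rho>(i-j)\<^sup>2 g\<^sub>2(X\<^sub>i) g''(X\<^sub>j)\<close> with mean 1 and \<open>R\<close> is a normalized sum of
  \<open>g\<^sub>2(X\<^sub>i) (\<Sum>\<^sub>j \<rho>(i-j) g'(X\<^sub>j))\<^sup>2\<close>. The variance of \<open>U\<close> yields the first term of the bound and the
  first absolute moment of \<open>R\<close> the second. Both need only moments of four factors; these are
  compared with their values at \<open>\<rho> = 1\<close>, where the absolute values of the coefficients enter and
  fourth moments of the derivatives of \<open>A(g)\<close> appear. For general \<open>g\<close> one truncates the Hermite
  expansion: positivity of mixed moments bounds the fourth moments of the partial sums.\<close>

section \<open>Hermite polynomials and Stein's equation\<close>

text \<open>Linear combinations of the \<open>X i\<close> may degenerate, so there need not be a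
  joint density to integrate against. Writing \<open>X j = resid i j + cov i j * X i\<close> with
  residuals independent of \<open>X i\<close> reduces every integration by parts to the
  one-dimensional normal law; derivatives along the row \<open>cov i\<close> then do the work of
  Malliavin derivatives. Since \<open>f''\<close> appears, Stein's equation needs a bounded second
  derivative, so it is solved for \<open>C^1\<close> test functions and Lipschitz ones are smoothed.
  Orders of magnitude: the unnormalized sum has variance at least \<open>2 * (c 2)^2 * n\<close>.
  The variance of \<open>U\<close> is of order \<open>T / n\<close> with \<open>T\<close> the sum of
  the \<open>|\<rho>|\<close>, because each covariance of two of its summands contains one
  correlation linking them. The first moment of \<open>R\<close> is of order
  \<open>S / sqrt n\<close>, where \<open>S\<close> bounds the triangle sums of
  \<open>|\<rho>(i-j) \<rho>(i-k) \<rho>(j-k)|\<close>. The inequality of the means replaces a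
  triangle by its three paths of length two with edge weights \<open>|\<rho>|^(3/2)\<close>; this is
  the source of the exponent 3/2 and of the square in the second term.\<close>

fun He :: "nat \<Rightarrow> real poly" where
  "He 0 = 1"
| "He (Suc q) = [:0, 1:] * He q - pderiv (He q)"

text \<open>The lowering rule, complementing the raising recursion of the definition. The factors
  \<open>real (q b)\<close> of the later moment recursion come from here.\<close>

lemma pderiv_He_Suc: "pderiv (He (Suc q)) = smult (real (Suc q)) (He q)"
proof (induction q)
  case 0
  show ?case by (simp add: pderiv_pCons one_pCons)
next
  case (Suc q)
  have "pderiv (He (Suc (Suc q))) =
      He (Suc q) + ([:0, 1:] * pderiv (He (Suc q)) - pderiv (pderiv (He (Suc q))))"
    by (subst He.simps(2)) (simp add: pderiv_diff pderiv_mult pderiv_pCons algebra_simps del: He.simps)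
  also have "\<dots> = He (Suc q) + smult (real (Suc q)) ([:0, 1:] * He q - pderiv (He q))"
    by (simp only: Suc.IH pderiv_smult mult_smult_right smult_diff_right)
  also have "\<dots> = smult 1 (He (Suc q)) + smult (real (Suc q)) (He (Suc q))"
    by simp
  also have "\<dots> = smult (real (Suc (Suc q))) (He (Suc q))"
    by (subst smult_add_left[symmetric]) (simp add: add.commute)
  finally show ?case .
qed

lemma pderiv_He: "pderiv (He q) = smult (real q) (He (q - 1))"
  by (cases q) (simp_all add: pderiv_He_Suc del: He.simps(2))

text \<open>Every derivative of \<open>exp (- t^2 / 2)\<close> is a polynomial times the same
  exponential; up to the sign \<open>(-1)^q\<close>, the recursion of \<open>He\<close> is the
  product rule for one further derivative.\<close>

lemma hermite_eq_poly: "hermite q x = poly (He q) x"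
proof -
  have *: "(deriv ^^ q) (\<lambda>t. exp (- t\<^sup>2 / 2)) = (\<lambda>t. (-1) ^ q * poly (He q) t * exp (- t\<^sup>2 / 2))"
  proof (induction q)
    case (Suc q)
    have "((\<lambda>t. (-1) ^ q * poly (He q) t * exp (- t\<^sup>2 / 2)) has_real_derivative
        (-1) ^ Suc q * poly (He (Suc q)) t * exp (- t\<^sup>2 / 2)) (at t)" for t
      by (auto intro!: derivative_eq_intros poly_DERIV simp: algebra_simps)
    then have "deriv (\<lambda>t. (-1) ^ q * poly (He q) t * exp (- t\<^sup>2 / 2)) t =
        (-1) ^ Suc q * poly (He (Suc q)) t * exp (- t\<^sup>2 / 2)" for t
      by (rule DERIV_imp_deriv)
    then show ?case by (simp only: Suc.IH funpow.simps o_apply)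
  qed simp
  show ?thesis
    unfolding hermite_def * by (simp add: exp_minus power_mult_distrib[symmetric] field_simps)
qed

lemma degree_lead_coeff_He: "degree (He q) = q \<and> lead_coeff (He q) = 1"
proof (induction q)
  case (Suc q)
  have 1: "degree ([:0, 1:] * He q) = Suc q" using Suc by (auto simp: degree_pCons_eq)
  have 2: "degree (pderiv (He q)) < Suc q" using Suc by (simp add: degree_pderiv)
  have "degree (He (Suc q)) = Suc q" using 1 2 by (simp add: degree_diff_less degree_add_eq_left diff_conv_add_uminus del: add_uminus_conv_diff)
  moreover have "coeff (He (Suc q)) (Suc q) = 1"
    using Suc 2 by (auto simp add: coeff_eq_0)
  ultimately show ?case by simp
qed simp

text \<open>\<open>He q\<close> is monic of degree \<open>q\<close>, so subtracting the leading
  multiple lowers the degree. It is used later to expand the cube of a partial sum.\<close>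

lemma poly_eq_He_sum: "\<exists>b. P = (\<Sum>q\<le>degree P. smult (b q) (He q))"
proof -
  have "degree P \<le> n \<Longrightarrow> \<exists>b. P = (\<Sum>q\<le>n. smult (b q) (He q))" for n
  proof (induction n arbitrary: P)
    case 0
    then obtain a where "P = [:a:]" by (metis degree_0_id le_zero_eq)
    then show ?case by (intro exI[of _ "\<lambda>_. a"]) simp
  next
    case (Suc n)
    define Q where "Q = P - smult (coeff P (Suc n)) (He (Suc n))"
    have "degree Q \<le> n"
    proof (intro degree_le allI impI)
      fix i assume "n < i"
      show "coeff Q i = 0"
      proof (cases "i = Suc n")
        case True
        then show ?thesis using degree_lead_coeff_He[of "Suc n"] by (auto simp: Q_def simp del: He.simps)
      next
        case False
        then have "i > Suc n" using \<open>n < i\<close> by simp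
        then show ?thesis using Suc.prems degree_lead_coeff_He[of "Suc n"]
          by (simp add: Q_def coeff_eq_0 del: He.simps)
      qed
    qed
    then obtain b where b: "Q = (\<Sum>q\<le>n. smult (b q) (He q))" using Suc.IH by blast
    have "P = (\<Sum>q\<le>Suc n. smult ((b(Suc n := coeff P (Suc n))) q) (He q))"
      using b by (simp add: Q_def algebra_simps del: He.simps)
    then show ?case by blast
  qed
  then show ?thesis by blast
qed

section \<open>Barrier estimates for Stein's equation\<close>

lemma stein_barrier_right:
  fixes u r :: "real \<Rightarrow> real"
  assumes D: "\<And>x. (u has_real_derivative x * u x + r x) (at x)"
    and r: "\<And>x. 0 \<le> x \<Longrightarrow> \<bar>r x\<bar> \<le> a * x + b"
    and lim: "((\<lambda>x. u x * exp (- x\<^sup>2 / 2)) \<longlongrightarrow> 0) at_top"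
    and "0 \<le> b" and x: "0 \<le> x"
  shows "\<bar>u x\<bar> \<le> a + 2 * b / (1 + x)"
proof -
  have *: "0 \<le> a + 2 * b / (1 + x) - s * u x" if s: "s = 1 \<or> s = -1" for s :: real
  proof -
    \<comment> \<open>The barrier \<open>b0 t = a + 2 * b / (1 + t)\<close> satisfies
      \<open>b0' \<le> t * b0 - (a * t + b)\<close>. Hence its weighted distance \<open>G\<close> to
      \<open>s * u\<close> is nonincreasing; as it tends to \<open>0\<close>, it is nonnegative. The
      factor \<open>2\<close> leaves the surplus \<open>b * (1 + t^2) / (1 + t)^2\<close> found
      below.\<close>
    define G where "G t = (a + 2 * b / (1 + t) - s * u t) * exp (- t\<^sup>2 / 2)" for t
    have dG: "(G has_real_derivative (- 2 * b / (1 + t)\<^sup>2 - s * (t * u t + r t)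
        - t * (a + 2 * b / (1 + t) - s * u t)) * exp (- t\<^sup>2 / 2)) (at t)" if "0 \<le> t" for t
    proof -
      have 1: "((\<lambda>t. 2 * b / (1 + t)) has_real_derivative - 2 * b / (1 + t)\<^sup>2) (at t)"
        using that by (auto intro!: derivative_eq_intros simp: power2_eq_square)
      show ?thesis
        unfolding G_def by (rule derivative_eq_intros 1 D refl | simp)+ (simp add: algebra_simps)
    qed
    have le: "(- 2 * b / (1 + t)\<^sup>2 - s * (t * u t + r t)
        - t * (a + 2 * b / (1 + t) - s * u t)) * exp (- t\<^sup>2 / 2) \<le> 0" if "0 \<le> t" for t
    proof -
      have "2 * b / (1 + t)\<^sup>2 + t * (2 * b / (1 + t)) - b = b * (1 + t\<^sup>2) / (1 + t)\<^sup>2"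
        using that by (simp add: divide_simps power2_eq_square) (simp add: algebra_simps)
      moreover have "\<dots> \<ge> 0" using \<open>0 \<le> b\<close> by simp
      ultimately have "2 * b / (1 + t)\<^sup>2 + t * (2 * b / (1 + t)) \<ge> b" by linarith
      moreover have "- s * r t \<le> a * t + b" using r[OF that] s by auto
      ultimately have "- 2 * b / (1 + t)\<^sup>2 - s * (t * u t + r t)
        - t * (a + 2 * b / (1 + t) - s * u t) \<le> 0" by (simp add: algebra_simps)
      then show ?thesis by (simp add: mult_nonpos_nonneg)
    qed
    have mono: "G y \<le> G x" if "x \<le> y" for y
      by (rule DERIV_nonpos_imp_nonincreasing[OF that]) (use dG le x in \<open>meson order_trans\<close>)
    have "((\<lambda>t::real. (a + 2 * b / (1 + t)) * exp (- t\<^sup>2 / 2)) \<longlongrightarrow> 0) at_top"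
      by real_asymp
    from tendsto_diff[OF this tendsto_mult[OF tendsto_const[of s] lim]]
    have "(G \<longlongrightarrow> 0) at_top" by (simp add: G_def[abs_def] algebra_simps)
    then have "0 \<le> G x"
      by (rule tendsto_upperbound) (auto intro!: eventually_at_top_linorderI[of x] mono)
    then show ?thesis by (simp add: G_def zero_le_mult_iff)
  qed
  show ?thesis using *[of 1] *[of "-1"] by auto
qed

lemma stein_barrier:
  fixes u r :: "real \<Rightarrow> real"
  assumes D: "\<And>x. (u has_real_derivative x * u x + r x) (at x)"
    and r: "\<And>x. \<bar>r x\<bar> \<le> a * \<bar>x\<bar> + b"
    and lim: "((\<lambda>x. u x * exp (- x\<^sup>2 / 2)) \<longlongrightarrow> 0) at_top"
      "((\<lambda>x. u x * exp (- x\<^sup>2 / 2)) \<longlongrightarrow> 0) at_bot"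
    and b: "0 \<le> b"
  shows "\<bar>u x\<bar> \<le> a + 2 * b / (1 + \<bar>x\<bar>)"
proof (cases "0 \<le> x")
  case True
  then show ?thesis using stein_barrier_right[OF D _ lim(1) b True, of a] r by (metis abs_of_nonneg)
next
  case False
  \<comment> \<open>Reflection: \<open>- u (- x)\<close> solves the same equation with
    \<open>r (- x)\<close>, so the left half line follows from the right one.\<close>
  have 1: "((\<lambda>x. - u (-x)) has_real_derivative x * (- u (-x)) + r (-x)) (at x)" for x
    by (auto intro!: derivative_eq_intros DERIV_chain'[of uminus "-1" x UNIV u] D[of "-x", simplified])
  have 2: "((\<lambda>x. - u (-x) * exp (- x\<^sup>2 / 2)) \<longlongrightarrow> 0) at_top"
    using tendsto_minus[OF lim(2)] by (simp add: filterlim_at_bot_mirror)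
  have 3: "\<bar>r (- x)\<bar> \<le> a * x + b" if "0 \<le> x" for x
    using r[of "- x"] that by simp
  have "\<bar>- u (- (-x))\<bar> \<le> a + 2 * b / (1 + (-x))"
    by (rule stein_barrier_right[OF 1 3 2 b]) (use False in simp_all)
  then show ?thesis using False by simp
qed

lemma std_normal_density_pos: "0 < std_normal_density x"
  by (simp add: normal_density_pos)

lemma std_normal_density_deriv: "(std_normal_density has_real_derivative - x * std_normal_density x) (at x)"
proof -
  define c where "c = 1 / sqrt (2 * pi)"
  have *: "std_normal_density = (\<lambda>x. c * exp (- x\<^sup>2 / 2))"
    by (simp add: fun_eq_iff std_normal_density_def c_def)
  show ?thesis unfolding * by (auto intro!: derivative_eq_intros)
qed

lemma lipschitz_abs_le:
  fixes h :: "real \<Rightarrow> real"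
  assumes "1-lipschitz_on UNIV h"
  shows "\<bar>h x - h y\<bar> \<le> \<bar>x - y\<bar>"
  using lipschitz_onD[OF assms, of x y] by (simp add: dist_real_def)

lemma lipschitz_integrable_normal:
  fixes h :: "real \<Rightarrow> real"
  assumes h: "1-lipschitz_on UNIV h"
  shows "integrable lborel (\<lambda>x. std_normal_density x * h x)"
proof (rule Bochner_Integration.integrable_bound)
  show "integrable lborel (\<lambda>x. std_normal_density x * \<bar>x\<bar> ^ 1 + std_normal_density x * \<bar>h 0\<bar>)"
    by (intro Bochner_Integration.integrable_add integrable_std_normal_moment_abs) simp
  have "h \<in> borel_measurable borel"
    using lipschitz_on_continuous_on[OF h] by (intro borel_measurable_continuous_onI)
  then show "(\<lambda>x. std_normal_density x * h x) \<in> borel_measurable lborel" by simp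
  show "AE x in lborel. norm (std_normal_density x * h x)
      \<le> norm (std_normal_density x * \<bar>x\<bar> ^ 1 + std_normal_density x * \<bar>h 0\<bar>)"
  proof (intro AE_I2)
    fix x :: real
    have "\<bar>h x\<bar> \<le> \<bar>x\<bar> + \<bar>h 0\<bar>" using lipschitz_abs_le[OF h, of x 0] by linarith
    then have "std_normal_density x * \<bar>h x\<bar> \<le> std_normal_density x * (\<bar>x\<bar> + \<bar>h 0\<bar>)"
      by (intro mult_left_mono) simp_all
    then show "norm (std_normal_density x * h x)
      \<le> norm (std_normal_density x * \<bar>x\<bar> ^ 1 + std_normal_density x * \<bar>h 0\<bar>)"
      by (simp add: abs_mult distrib_left)
  qed
qed

text \<open>The mean of \<open>|h 0 - h|\<close> is at most the first absolute moment
  \<open>sqrt (2 / pi)\<close> of the normal law, which is rounded up to \<open>1\<close>.\<close>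

lemma lipschitz_normal_mean:
  fixes h :: "real \<Rightarrow> real"
  assumes h: "1-lipschitz_on UNIV h"
  shows "\<bar>h x - (LINT y|lborel. std_normal_density y * h y)\<bar> \<le> \<bar>x\<bar> + 1"
proof -
  have i: "integrable lborel (\<lambda>y. std_normal_density y * (h 0 - h y))"
    using lipschitz_integrable_normal[OF h] by (simp add: right_diff_distrib)
  have "h 0 - (LINT y|lborel. std_normal_density y * h y) = (LINT y|lborel. std_normal_density y * (h 0 - h y))"
    using lipschitz_integrable_normal[OF h] by (simp add: right_diff_distrib)
  also have "\<bar>\<dots>\<bar> \<le> (LINT y|lborel. \<bar>std_normal_density y * (h 0 - h y)\<bar>)"
    using integral_norm_bound[of lborel "\<lambda>y. std_normal_density y * (h 0 - h y)"] by simp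
  also have "\<dots> \<le> (LINT y|lborel. std_normal_density y * \<bar>y\<bar> ^ (2 * 0 + 1))"
    using integrable_abs[OF i] lipschitz_abs_le[OF h, of 0] integrable_std_normal_moment_abs[of 1]
    by (intro integral_mono) (auto simp: abs_mult intro!: mult_left_mono)
  also have "\<dots> = sqrt (2 / pi)" by (subst integral_std_normal_moment_abs_odd) simp
  also have "\<dots> \<le> 1" using pi_ge_two by (simp add: divide_simps)
  finally show ?thesis using lipschitz_abs_le[OF h, of x 0] by linarith
qed

lemma C1_imp_lipschitz:
  fixes h h' :: "real \<Rightarrow> real"
  assumes "\<And>x. (h has_real_derivative h' x) (at x)" "\<And>x. \<bar>h' x\<bar> \<le> 1"
  shows "1-lipschitz_on UNIV h"
proof (rule lipschitz_onI)
  show "dist (h x) (h y) \<le> 1 * dist x y" for x y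
    using field_differentiable_bound[of UNIV h h' 1 x y] assms by (simp add: dist_real_def abs_minus_commute)
qed simp

text \<open>The bound \<open>|h x - m| \<le> |x| + 1\<close> feeds the barrier for \<open>f\<close>
  with \<open>a = b = 1\<close>, hence \<open>|f| \<le> 3\<close>. The derivative solves an equation
  of the same kind with right side \<open>f + h'\<close>, bounded by \<open>4\<close>; now
  \<open>a = 0\<close>, and the decay \<open>8 / (1 + |x|)\<close> controls \<open>x * f' x\<close>
  as well. This gives \<open>|f'| \<le> 8\<close> and \<open>|f''| \<le> 8 + 3 + 1\<close>.\<close>

lemma stein_solution:
  fixes h h' :: "real \<Rightarrow> real"
  assumes h: "\<And>x. (h has_real_derivative h' x) (at x)"
    and h'_cont: "continuous_on UNIV h'" and h': "\<And>x. \<bar>h' x\<bar> \<le> 1"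
  obtains f f' f'' :: "real \<Rightarrow> real" where
    "\<And>x. (f has_real_derivative f' x) (at x)" "\<And>x. (f' has_real_derivative f'' x) (at x)"
    "continuous_on UNIV f''" "\<And>x. \<bar>f' x\<bar> \<le> 8" "\<And>x. \<bar>f'' x\<bar> \<le> 12"
    "\<And>x. f' x - x * f x = h x - (LINT y|lborel. std_normal_density y * h y)"
proof -
  define \<phi> :: "real \<Rightarrow> real" where "\<phi> = std_normal_density"
  define m where "m = (LINT y|lborel. \<phi> y * h y)"
  have lip: "1-lipschitz_on UNIV h" by (rule C1_imp_lipschitz[OF h h'])
  define k where "k y = \<phi> y * (h y - m)" for y
  have h_cont: "continuous_on UNIV h"
    using h by (auto intro!: continuous_at_imp_continuous_on DERIV_isCont)
  have hm: "\<bar>h x - m\<bar> \<le> \<bar>x\<bar> + 1" for x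
    using lipschitz_normal_mean[OF lip] by (simp add: m_def \<phi>_def)
  have \<phi>_cont: "continuous_on S \<phi>" for S
    unfolding \<phi>_def normal_density_def by (intro continuous_intros) auto
  have k_cont: "continuous_on S k" for S
    unfolding k_def using h_cont by (intro continuous_intros \<phi>_cont) (blast intro: continuous_on_subset)
  have k_int: "integrable lborel k"
    unfolding k_def \<phi>_def right_diff_distrib using lipschitz_integrable_normal[OF lip] by simp
  have k0: "(LINT y|lborel. k y) = 0"
    unfolding k_def right_diff_distrib using lipschitz_integrable_normal[OF lip]
    by (simp add: m_def \<phi>_def)
  \<comment> \<open>The integrated equation: \<open>I\<close> has derivative \<open>k\<close> and
    vanishes at both ends, because \<open>k\<close> has total integral \<open>0\<close>. These two
    limits are the growth conditions of the barrier lemma for \<open>f = I / \<phi>\<close>.\<close>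
  define I where "I x = (LINT y|lborel. indicator {..x} y * k y)" for x
  have I_int: "integrable lborel (\<lambda>y. indicator {..x} y * k y)" for x
    using integrable_mult_indicator[OF _ k_int, of "{..x}"] by simp
  have I_top: "(I \<longlongrightarrow> 0) at_top"
  proof -
    have "((\<lambda>x. LINT y|lborel. indicator {..x} y * k y) \<longlongrightarrow> (LINT y|lborel. k y)) at_top"
    proof (rule integral_dominated_convergence_at_top[where w="\<lambda>y. \<bar>k y\<bar>"])
      show "AE x in lborel. ((\<lambda>i. indicator {..i} x * k x) \<longlongrightarrow> k x) at_top"
      proof (intro AE_I2 tendsto_eventually)
        fix x show "\<forall>\<^sub>F i in at_top. indicator {..i} x * k x = k x"
          using eventually_ge_at_top[of x] by eventually_elim simp
      qed
      show "\<forall>\<^sub>F i in at_top. AE x in lborel. norm (indicator {..i} x * k x) \<le> \<bar>k x\<bar>"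
        by (intro always_eventually allI AE_I2) (auto simp: indicator_def)
    qed (use k_int I_int in \<open>auto intro: borel_measurable_integrable\<close>)
    then show ?thesis using k0 by (simp add: I_def[abs_def])
  qed
  have I_bot: "(I \<longlongrightarrow> 0) at_bot"
  proof -
    have "((\<lambda>x. LINT y|lborel. indicator {..-x} y * k y) \<longlongrightarrow> (LINT y|lborel. 0 * k y)) at_top"
    proof (rule integral_dominated_convergence_at_top[where w="\<lambda>y. \<bar>k y\<bar>"
          and s="\<lambda>x y. indicator {..-x} y * k y" and f="\<lambda>y. 0 * k y" and M=lborel])
      show "AE x in lborel. ((\<lambda>i. indicator {..-i} x * k x) \<longlongrightarrow> 0 * k x) at_top"
      proof (intro AE_I2 tendsto_eventually)
        fix x show "\<forall>\<^sub>F i in at_top. indicator {..-i} x * k x = 0 * k x"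
          using eventually_gt_at_top[of "-x"] by eventually_elim simp
      qed
      show "\<forall>\<^sub>F i in at_top. AE x in lborel. norm (indicator {..-i} x * k x) \<le> \<bar>k x\<bar>"
        by (intro always_eventually allI AE_I2) (auto simp: indicator_def)
    qed (use k_int I_int in \<open>auto intro: borel_measurable_integrable\<close>)
    then show ?thesis by (simp add: I_def[abs_def] filterlim_at_bot_mirror)
  qed
  have I_deriv: "(I has_real_derivative k x) (at x)" for x
  proof -
    \<comment> \<open>A base point to the left of \<open>x\<close> turns the integral over a half
      line into a constant plus an integral over a compact interval.\<close>
    define c where "c = x - 1"
    have I_eq: "I t = I c + integral {c..t} k" if "c \<le> t" for t
    proof -
      have "I t = (LINT y|lborel. indicator {..c} y * k y + indicator {c<..t} y * k y)"
        unfolding I_def using that by (intro Bochner_Integration.integral_cong) (auto simp: indicator_def)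
      also have "\<dots> = I c + (LINT y:{c<..t}|lborel. k y)"
        unfolding I_def set_lebesgue_integral_def
        using I_int integrable_mult_indicator[OF _ k_int, of "{c<..t}"]
        by (subst Bochner_Integration.integral_add) auto
      also have "(LINT y:{c<..t}|lborel. k y) = (LINT y:{c..t}|lborel. k y)"
        unfolding set_lebesgue_integral_def
        using k_int AE_lborel_singleton[of c]
        by (intro integral_cong_AE) (auto simp: indicator_def elim!: eventually_mono)
      also have "\<dots> = integral {c..t} k"
        by (rule set_borel_integral_eq_integral)
          (use integrable_mult_indicator[OF _ k_int, of "{c..t}"] in \<open>simp add: set_integrable_def\<close>)
      finally show ?thesis .
    qed
    have "((\<lambda>t. integral {c..t} k) has_real_derivative k x) (at x within {c..x+1})"
      by (rule integral_has_real_derivative) (auto intro: k_cont simp: c_def)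
    moreover have "x \<in> interior {c..x+1}" by (simp add: c_def)
    ultimately have "((\<lambda>t. integral {c..t} k) has_real_derivative k x) (at x)"
      by (metis at_within_interior)
    then have "((\<lambda>t. I c + integral {c..t} k) has_real_derivative k x) (at x)"
      by (auto intro!: derivative_eq_intros)
    moreover have "\<forall>\<^sub>F t in nhds x. I c + integral {c..t} k = I t"
      unfolding eventually_nhds by (intro exI[of _ "{c<..}"] conjI ballI I_eq[symmetric]) (simp_all add: c_def)
    ultimately show ?thesis by (rule DERIV_cong_ev[OF refl _ refl, THEN iffD1, rotated])
  qed
  define f where "f x = I x / \<phi> x" for x
  have \<phi>_pos: "0 < \<phi> x" for x unfolding \<phi>_def by (rule std_normal_density_pos)
  have \<phi>_deriv: "(\<phi> has_real_derivative - x * \<phi> x) (at x)" for x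
    unfolding \<phi>_def by (rule std_normal_density_deriv)
  have f_deriv: "(f has_real_derivative x * f x + (h x - m)) (at x)" for x
  proof -
    have "((\<lambda>x. I x / \<phi> x) has_real_derivative
        (k x * \<phi> x - I x * (- x * \<phi> x)) / (\<phi> x * \<phi> x)) (at x)"
      using \<phi>_pos[of x] by (intro DERIV_divide I_deriv \<phi>_deriv) simp
    moreover have "(k x * \<phi> x - I x * (- x * \<phi> x)) / (\<phi> x * \<phi> x) = x * f x + (h x - m)"
      using \<phi>_pos[of x] by (simp add: k_def f_def divide_simps) (simp add: algebra_simps)
    ultimately show ?thesis by (simp add: f_def[abs_def])
  qed
  have exp_\<phi>: "exp (- x\<^sup>2 / 2) = sqrt (2 * pi) * \<phi> x" for x
    unfolding \<phi>_def std_normal_density_def by simp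
  have f_exp: "f x * exp (- x\<^sup>2 / 2) = sqrt (2 * pi) * I x" for x
    using \<phi>_pos[of x] unfolding exp_\<phi> f_def by simp
  have f_bound0: "\<bar>f x\<bar> \<le> 1 + 2 * 1 / (1 + \<bar>x\<bar>)" for x
  proof (rule stein_barrier[OF f_deriv])
    show "((\<lambda>x. f x * exp (- x\<^sup>2 / 2)) \<longlongrightarrow> 0) at_top" "((\<lambda>x. f x * exp (- x\<^sup>2 / 2)) \<longlongrightarrow> 0) at_bot"
      unfolding f_exp using tendsto_mult_right_zero[OF I_top] tendsto_mult_right_zero[OF I_bot] by auto
  qed (use hm in auto)
  have f_bound: "\<bar>f x\<bar> \<le> 3" for x
  proof -
    have "2 * 1 / (1 + \<bar>x\<bar>) \<le> 2" by (simp add: divide_simps)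
    then show ?thesis using f_bound0[of x] by linarith
  qed
  \<comment> \<open>\<open>w\<close> is \<open>f'\<close>, written through the equation so that it
    can be differentiated once more.\<close>
  define w where "w x = x * f x + (h x - m)" for x
  have w_deriv: "(w has_real_derivative x * w x + (f x + h' x)) (at x)" for x
    unfolding w_def by (auto intro!: derivative_eq_intros f_deriv h simp: algebra_simps)
  have w_lin: "\<bar>w x\<bar> \<le> 4 * \<bar>x\<bar> + 1" for x
  proof -
    have "\<bar>x * f x\<bar> \<le> \<bar>x\<bar> * 3" unfolding abs_mult by (intro mult_left_mono f_bound) simp
    then show ?thesis using hm[of x] unfolding w_def by linarith
  qed
  have w_bound0: "\<bar>w x\<bar> \<le> 0 + 2 * 4 / (1 + \<bar>x\<bar>)" for x
  proof (rule stein_barrier[OF w_deriv])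
    show "\<bar>f x + h' x\<bar> \<le> 0 * \<bar>x\<bar> + 4" for x using f_bound[of x] h'[of x] by linarith
    have le: "norm (w x * exp (- x\<^sup>2 / 2)) \<le> norm ((4 * \<bar>x\<bar> + 1) * exp (- x\<^sup>2 / 2))" for x
      using w_lin[of x] by (simp add: abs_mult)
    show "((\<lambda>x. w x * exp (- x\<^sup>2 / 2)) \<longlongrightarrow> 0) at_top"
    proof (rule Lim_null_comparison)
      show "((\<lambda>x::real. (4 * \<bar>x\<bar> + 1) * exp (- x\<^sup>2 / 2)) \<longlongrightarrow> 0) at_top" by real_asymp
    qed (use le in \<open>auto intro!: always_eventually simp: abs_mult\<close>)
    show "((\<lambda>x. w x * exp (- x\<^sup>2 / 2)) \<longlongrightarrow> 0) at_bot"
    proof (rule Lim_null_comparison)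
      show "((\<lambda>x::real. (4 * \<bar>x\<bar> + 1) * exp (- x\<^sup>2 / 2)) \<longlongrightarrow> 0) at_bot" by real_asymp
    qed (use le in \<open>auto intro!: always_eventually simp: abs_mult\<close>)
  qed simp
  have w_bound: "\<bar>w x\<bar> \<le> 8" "\<bar>x * w x\<bar> \<le> 8" for x
  proof -
    have 1: "\<bar>w x\<bar> + \<bar>x * w x\<bar> \<le> 8" using w_bound0[of x] by (simp add: field_simps abs_mult)
    then show "\<bar>w x\<bar> \<le> 8" "\<bar>x * w x\<bar> \<le> 8" by linarith+
  qed
  have f_cont: "continuous_on UNIV f" and w_cont: "continuous_on UNIV w"
    using f_deriv w_deriv by (auto intro!: continuous_at_imp_continuous_on DERIV_isCont)
  show thesis
  proof (rule that[of f w "\<lambda>x. x * w x + (f x + h' x)"])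
    show "(f has_real_derivative w x) (at x)" for x using f_deriv by (simp add: w_def)
    show "continuous_on UNIV (\<lambda>x. x * w x + (f x + h' x))"
      by (intro continuous_intros f_cont w_cont h'_cont)
    show "\<bar>x * w x + (f x + h' x)\<bar> \<le> 12" for x
      using w_bound(2)[of x] f_bound[of x] h'[of x] by linarith
    show "w x - x * f x = h x - (LINT y|lborel. std_normal_density y * h y)" for x
      by (simp add: w_def m_def \<phi>_def)
  qed (use w_deriv w_bound in auto)
qed

section \<open>Characteristic functions and directional derivatives\<close>

lemma integrable_mult_bounded:
  fixes f g :: "'a \<Rightarrow> 'b :: {real_normed_algebra, banach, second_countable_topology}"
  assumes "integrable M f" "g \<in> borel_measurable M" "\<And>x. norm (g x) \<le> B"
  shows "integrable M (\<lambda>x. f x * g x)"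
proof (rule Bochner_Integration.integrable_bound)
  show "integrable M (\<lambda>x. B * norm (f x))" using assms(1) by simp
  show "(\<lambda>x. f x * g x) \<in> borel_measurable M" using assms by simp
  have "0 \<le> B" using assms(3) norm_ge_zero order_trans by blast
  then show "AE x in M. norm (f x * g x) \<le> norm (B * norm (f x))"
    by (intro AE_I2 order_trans[OF norm_mult_ineq])
      (use assms(3) in \<open>auto simp: mult.commute[of B] intro!: mult_left_mono\<close>)
qed

context prob_space
begin

lemma integrable_mult_square:
  fixes A B :: "'a \<Rightarrow> real"
  assumes "A \<in> borel_measurable M" "integrable M (\<lambda>\<omega>. (A \<omega>)\<^sup>2)"
    and "B \<in> borel_measurable M" "integrable M (\<lambda>\<omega>. (B \<omega>)\<^sup>2)"
  shows "integrable M (\<lambda>\<omega>. A \<omega> * B \<omega>)"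
proof (rule Bochner_Integration.integrable_bound)
  show "integrable M (\<lambda>\<omega>. (A \<omega>)\<^sup>2 + (B \<omega>)\<^sup>2)" using assms by simp
  show "AE \<omega> in M. norm (A \<omega> * B \<omega>) \<le> norm ((A \<omega>)\<^sup>2 + (B \<omega>)\<^sup>2)"
  proof (rule AE_I2)
    fix \<omega>
    have "2 * \<bar>A \<omega> * B \<omega>\<bar> \<le> (A \<omega>)\<^sup>2 + (B \<omega>)\<^sup>2"
      using sum_squares_bound[of "\<bar>A \<omega>\<bar>" "\<bar>B \<omega>\<bar>"] by (simp add: abs_mult)
    then show "norm (A \<omega> * B \<omega>) \<le> norm ((A \<omega>)\<^sup>2 + (B \<omega>)\<^sup>2)" by simp
  qed
qed (use assms in simp)

lemma abs_expectation_le_sqrt: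
  assumes "integrable M Z" "integrable M (\<lambda>\<omega>. (Z \<omega>)\<^sup>2)"
  shows "expectation (\<lambda>\<omega>. \<bar>Z \<omega>\<bar>) \<le> sqrt (expectation (\<lambda>\<omega>. (Z \<omega>)\<^sup>2))"
proof -
  \<comment> \<open>Cauchy-Schwarz as the nonnegativity of a variance.\<close>
  have "0 \<le> variance (\<lambda>\<omega>. \<bar>Z \<omega>\<bar>)" by (rule variance_positive)
  also have "variance (\<lambda>\<omega>. \<bar>Z \<omega>\<bar>) = expectation (\<lambda>\<omega>. \<bar>Z \<omega>\<bar>\<^sup>2) - (expectation (\<lambda>\<omega>. \<bar>Z \<omega>\<bar>))\<^sup>2"
    using assms by (intro variance_eq) auto
  finally show ?thesis by (intro real_le_rsqrt) simp
qed

lemma integrable_cis: "U \<in> borel_measurable M \<Longrightarrow> integrable M (\<lambda>\<omega>. cis (U \<omega>))"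
  unfolding cis_conv_exp by (rule integrable_const_bound[where B=1]) auto

text \<open>\<open>G\<close> has mean \<open>0\<close> (the case \<open>t = 0\<close>), so
  \<open>1 + G / b\<close> is a probability density. Reweighting with it does not change the
  characteristic function of \<open>U\<close>, hence by Levy's uniqueness theorem not its law
  either. In this way a signed weight is handled by uniqueness for probability measures.\<close>

lemma real_weight_char_zero:
  fixes G U :: "'a \<Rightarrow> real"
  assumes [measurable]: "G \<in> borel_measurable M" "U \<in> borel_measurable M"
    and G: "\<And>\<omega>. \<bar>G \<omega>\<bar> \<le> B"
    and zero: "\<And>t. (LINT \<omega>|M. complex_of_real (G \<omega>) * cis (t * U \<omega>)) = 0"
    and A: "A \<in> sets borel"
  shows "(LINT \<omega>|M. G \<omega> * indicator A (U \<omega>)) = 0"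
proof -
  have intG: "integrable M G" by (rule integrable_const_bound[of _ B]) (use G in auto)
  have EG: "expectation G = 0"
    using zero[of 0] by (simp add: integral_complex_of_real)
  define b where "b = B + 1"
  have b: "b > 0" "\<bar>G \<omega>\<bar> \<le> b" for \<omega> using G[of \<omega>] unfolding b_def by linarith+
  define W where "W \<omega> = 1 + G \<omega> / b" for \<omega>
  have W0: "0 \<le> W \<omega>" for \<omega>
    using b(1) b(2)[of \<omega>] by (simp add: W_def field_simps abs_le_iff)
  have [measurable]: "W \<in> borel_measurable M" unfolding W_def by simp
  have intW: "integrable M W" unfolding W_def using intG by simp
  have EW: "expectation W = 1" unfolding W_def using intG EG by (simp add: prob_space)
  define D where "D = density M (\<lambda>\<omega>. ennreal (W \<omega>))"
  have "prob_space D"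
    unfolding D_def
    by (rule prob_spaceI)
      (use intW W0 EW in \<open>simp add: emeasure_density nn_integral_eq_integral cong: nn_integral_cong\<close>)
  then interpret D: prob_space D .
  have [measurable_cong]: "sets D = sets M" by (simp add: D_def)
  have U_D[measurable]: "U \<in> borel_measurable D" by simp
  have "distr D borel U = distr M borel U"
  proof (rule Levy_uniqueness)
    show "char (distr D borel U) = char (distr M borel U)"
    proof
      fix t
      have "char (distr D borel U) t = (CLINT \<omega>|D. cis (t * U \<omega>))"
        by (simp add: char_def integral_distr cis_conv_exp)
      also have "\<dots> = (CLINT \<omega>|M. W \<omega> *\<^sub>R cis (t * U \<omega>))"
        unfolding D_def by (rule integral_density) (use W0 in \<open>auto simp: cis_conv_exp\<close>)
      also have "\<dots> = (CLINT \<omega>|M. cis (t * U \<omega>) + (of_real (G \<omega>) * cis (t * U \<omega>)) / b)"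
        unfolding W_def by (intro Bochner_Integration.integral_cong)
          (simp_all add: scaleR_conv_of_real algebra_simps)
      also have "\<dots> = (CLINT \<omega>|M. cis (t * U \<omega>)) + (CLINT \<omega>|M. of_real (G \<omega>) * cis (t * U \<omega>)) / b"
      proof -
        have 1: "integrable M (\<lambda>\<omega>. cis (t * U \<omega>))" by (rule integrable_cis) simp
        have 2: "integrable M (\<lambda>\<omega>. complex_of_real (G \<omega>) * cis (t * U \<omega>))"
          by (rule integrable_mult_bounded[where B=1])
            (use intG in \<open>auto simp: cis_conv_exp\<close>)
        from 1 2 show ?thesis by simp
      qed
      also have "\<dots> = char (distr M borel U) t"
        by (subst zero) (simp add: char_def integral_distr cis_conv_exp)
      finally show "char (distr D borel U) t = char (distr M borel U) t" .
    qed
  qed (auto intro!: D.real_distribution_distr real_distribution_distr)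
  moreover have "(LINT x|distr D borel U. indicator A x) = (LINT \<omega>|D. indicator A (U \<omega>) :: real)"
    "(LINT x|distr M borel U. indicator A x) = (LINT \<omega>|M. indicator A (U \<omega>) :: real)"
    using A by (intro integral_distr; measurable)+
  moreover have "(LINT \<omega>|D. indicator A (U \<omega>)) = (LINT \<omega>|M. W \<omega> *\<^sub>R (indicator A (U \<omega>) :: real))"
    unfolding D_def using A W0 by (intro integral_density) auto
  ultimately have "(LINT \<omega>|M. W \<omega> *\<^sub>R indicator A (U \<omega>)) = (LINT \<omega>|M. indicator A (U \<omega>) :: real)"
    by simp
  moreover have "(LINT \<omega>|M. W \<omega> *\<^sub>R indicator A (U \<omega>))
      = (LINT \<omega>|M. indicator A (U \<omega>)) + (LINT \<omega>|M. G \<omega> * indicator A (U \<omega>)) / b"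
  proof -
    have 1: "integrable M (\<lambda>\<omega>. indicator A (U \<omega>) :: real)"
      using A by (intro integrable_const_bound[where B=1]) auto
    have 2: "integrable M (\<lambda>\<omega>. G \<omega> * indicator A (U \<omega>))"
      by (rule integrable_mult_bounded[where B=1]) (use intG A in \<open>auto simp: indicator_def\<close>)
    have "(LINT \<omega>|M. W \<omega> *\<^sub>R indicator A (U \<omega>)) =
        (LINT \<omega>|M. indicator A (U \<omega>) + (G \<omega> * indicator A (U \<omega>)) / b)"
      unfolding W_def by (intro Bochner_Integration.integral_cong) (simp_all add: algebra_simps)
    with 1 2 show ?thesis by simp
  qed
  ultimately show ?thesis using b(1) by simp
qed

lemma complex_weight_char_zero:
  fixes G :: "'a \<Rightarrow> complex" and U :: "'a \<Rightarrow> real"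
  assumes [measurable]: "G \<in> borel_measurable M" "U \<in> borel_measurable M"
    and G: "\<And>\<omega>. norm (G \<omega>) \<le> B"
    and zero: "\<And>t. (LINT \<omega>|M. G \<omega> * cis (t * U \<omega>)) = 0"
    and A: "A \<in> sets borel"
  shows "(LINT \<omega>|M. G \<omega> * indicator A (U \<omega>)) = 0"
proof -
  have intG: "integrable M G" by (rule integrable_const_bound[of _ B]) (use G in auto)
  have int: "integrable M (\<lambda>\<omega>. G \<omega> * cis (t * U \<omega>))" for t
    by (rule integrable_mult_bounded[where B=1]) (use intG in \<open>auto simp: cis_conv_exp\<close>)
  have int2: "integrable M (\<lambda>\<omega>. cnj (G \<omega>) * cis (t * U \<omega>))" for t
    by (rule integrable_mult_bounded[where B=1]) (use intG in \<open>auto simp: cis_conv_exp\<close>)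
  \<comment> \<open>Conjugation at the frequency \<open>- t\<close> shows that \<open>cnj G\<close>
    satisfies the hypothesis too; half sum and half difference give the real and the imaginary
    part.\<close>
  have cnj0: "(LINT \<omega>|M. cnj (G \<omega>) * cis (t * U \<omega>)) = 0" for t
  proof -
    have "(LINT \<omega>|M. cnj (G \<omega>) * cis (t * U \<omega>)) = (LINT \<omega>|M. cnj (G \<omega> * cis (- t * U \<omega>)))"
      by (simp add: cis_cnj)
    also have "\<dots> = cnj (LINT \<omega>|M. G \<omega> * cis (- t * U \<omega>))"
      by (rule Bochner_Integration.integral_cnj)
    finally show ?thesis using zero[of "-t"] by simp
  qed
  have Re0: "(LINT \<omega>|M. complex_of_real (Re (G \<omega>)) * cis (t * U \<omega>)) = 0" for t
  proof -
    have "(LINT \<omega>|M. complex_of_real (Re (G \<omega>)) * cis (t * U \<omega>)) =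
        (LINT \<omega>|M. (G \<omega> * cis (t * U \<omega>) + cnj (G \<omega>) * cis (t * U \<omega>)) / 2)"
      by (intro Bochner_Integration.integral_cong)
        (simp_all add: distrib_right[symmetric] complex_add_cnj)
    also have "\<dots> = 0" using int int2 zero cnj0 by simp
    finally show ?thesis .
  qed
  have Im0: "(LINT \<omega>|M. complex_of_real (Im (G \<omega>)) * cis (t * U \<omega>)) = 0" for t
  proof -
    have "(LINT \<omega>|M. complex_of_real (Im (G \<omega>)) * cis (t * U \<omega>)) =
        (LINT \<omega>|M. (G \<omega> * cis (t * U \<omega>) - cnj (G \<omega>) * cis (t * U \<omega>)) / (2 * \<i>))"
      by (intro Bochner_Integration.integral_cong)
        (simp_all add: left_diff_distrib[symmetric] complex_diff_cnj complex_eq_iff)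
    also have "\<dots> = 0" using int int2 zero cnj0 by simp
    finally show ?thesis .
  qed
  have le: "\<bar>Re (G \<omega>)\<bar> \<le> B" "\<bar>Im (G \<omega>)\<bar> \<le> B" for \<omega>
    using G[of \<omega>] abs_Re_le_cmod[of "G \<omega>"] abs_Im_le_cmod[of "G \<omega>"] by linarith+
  have "(LINT \<omega>|M. Re (G \<omega>) * indicator A (U \<omega>)) = 0"
    by (rule real_weight_char_zero[OF _ _ le(1) Re0 A]) simp_all
  moreover have "(LINT \<omega>|M. Im (G \<omega>) * indicator A (U \<omega>)) = 0"
    by (rule real_weight_char_zero[OF _ _ le(2) Im0 A]) simp_all
  moreover have "integrable M (\<lambda>\<omega>. G \<omega> * indicator A (U \<omega>))"
    by (rule integrable_mult_bounded[where B=1]) (use intG A in \<open>auto simp: indicator_def\<close>)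
  moreover have "Re (G \<omega> * indicator A (U \<omega>)) = Re (G \<omega>) * indicator A (U \<omega>)"
    "Im (G \<omega> * indicator A (U \<omega>)) = Im (G \<omega>) * indicator A (U \<omega>)" for \<omega>
    by (auto simp: indicator_def)
  ultimately show ?thesis
    by (simp add: complex_eq_iff flip: integral_Re integral_Im)
qed

text \<open>Uniqueness of multivariate characteristic functions, reduced to one variable at a time:
  while the variable \<open>j\<close> is treated, the characters of the remaining ones are absorbed
  into the weight. This is why weights have to be complex.\<close>

lemma weight_char_zero_finite:
  fixes G :: "'a \<Rightarrow> complex" and U :: "'i \<Rightarrow> 'a \<Rightarrow> real"
  assumes "finite I"
    and "G \<in> borel_measurable M" and U[measurable]: "\<And>i. U i \<in> borel_measurable M"
    and "\<And>\<omega>. norm (G \<omega>) \<le> B"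
    and "\<And>t. (LINT \<omega>|M. G \<omega> * cis (\<Sum>i\<in>I. t i * U i \<omega>)) = 0"
    and A: "\<And>i. A i \<in> sets borel"
  shows "(LINT \<omega>|M. G \<omega> * (\<Prod>i\<in>I. indicator (A i) (U i \<omega>))) = 0"
  using assms(1,2,4,5)
proof (induction I arbitrary: G)
  case (insert j I)
  note [measurable] = insert.prems(1) A[of j]
  define G' where "G' \<omega> = G \<omega> * indicator (A j) (U j \<omega>)" for \<omega>
  have [measurable]: "G' \<in> borel_measurable M" unfolding G'_def by measurable
  have "(LINT \<omega>|M. G' \<omega> * (\<Prod>i\<in>I. indicator (A i) (U i \<omega>))) = 0"
  proof (rule insert.IH)
    show "norm (G' \<omega>) \<le> B" for \<omega>
      using insert.prems(2)[of \<omega>] order_trans[OF norm_ge_zero insert.prems(2)[of \<omega>]]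
      by (auto simp: G'_def indicator_def)
    fix t :: "'i \<Rightarrow> real"
    define V where "V \<omega> = (\<Sum>i\<in>I. t i * U i \<omega>)" for \<omega>
    have [measurable]: "V \<in> borel_measurable M" unfolding V_def by measurable
    have "(LINT \<omega>|M. (G \<omega> * cis (V \<omega>)) * indicator (A j) (U j \<omega>)) = 0"
    proof (rule complex_weight_char_zero)
      show "(LINT \<omega>|M. G \<omega> * cis (V \<omega>) * cis (s * U j \<omega>)) = 0" for s
      proof -
        have "(\<Sum>i\<in>I. (t(j := s)) i * U i \<omega>) = V \<omega>" for \<omega>
          unfolding V_def using insert.hyps by (intro sum.cong) auto
        then show ?thesis
          using insert.prems(3)[of "t(j := s)"] insert.hyps
          by (simp add: mult.assoc cis_mult add.commute del: fun_upd_apply) (simp add: add.commute)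
      qed
      show "(\<lambda>\<omega>. G \<omega> * cis (V \<omega>)) \<in> borel_measurable M" unfolding cis_conv_exp by measurable
      show "norm (G \<omega> * cis (V \<omega>)) \<le> B" for \<omega> using insert.prems(2) by (simp add: norm_mult)
    qed simp_all
    then show "(LINT \<omega>|M. G' \<omega> * cis (\<Sum>i\<in>I. t i * U i \<omega>)) = 0"
      by (simp add: G'_def V_def mult_ac)
  qed simp
  then show ?case using insert.hyps by (simp add: G'_def mult.assoc)
qed simp

end

section \<open>Functions of polynomial growth on sequence space\<close>

abbreviation RN :: "(nat \<Rightarrow> real) measure" where "RN \<equiv> Pi\<^sub>M UNIV (\<lambda>_. borel)"

lemma measurable_RN_component: "(\<lambda>x. x i) \<in> borel_measurable RN"
  by (intro measurable_component_singleton) simp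

lemma measurable_RN_I:
  "(\<And>i. (\<lambda>\<omega>. f \<omega> i) \<in> borel_measurable M) \<Longrightarrow> f \<in> measurable M RN"
  by (rule measurable_PiM_single') simp_all

lemma DERIV_continuous_on_UNIV:
  fixes f f' :: "real \<Rightarrow> real"
  shows "(\<And>x. (f has_real_derivative f' x) (at x)) \<Longrightarrow> continuous_on UNIV f"
  by (meson DERIV_isCont continuous_at_imp_continuous_on)

text \<open>The class is closed under sums, products, powers and composition with functions of
  linear growth, and it is integrable along any sequence of standard normal variables. Thus
  integrability of the expressions built from polynomials and Stein solutions is a matter of closure
  rules.\<close>

definition poly_growth :: "((nat \<Rightarrow> real) \<Rightarrow> real) \<Rightarrow> bool" where
  "poly_growth \<Phi> \<longleftrightarrow> \<Phi> \<in> borel_measurable RN \<and>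
     (\<exists>N C k. \<forall>x. \<bar>\<Phi> x\<bar> \<le> C * (1 + (\<Sum>j\<le>N. \<bar>x j\<bar>)) ^ k)"

lemma poly_growthE:
  assumes "poly_growth \<Phi>" and "poly_growth \<Psi>"
  obtains N C k where "C \<ge> 0" "\<And>x. \<bar>\<Phi> x\<bar> \<le> C * (1 + (\<Sum>j\<le>N::nat. \<bar>x j\<bar>)) ^ k"
    "\<And>x. \<bar>\<Psi> x\<bar> \<le> C * (1 + (\<Sum>j\<le>N. \<bar>x j\<bar>)) ^ k"
proof -
  from assms(1) have "\<exists>N C k. \<forall>x. \<bar>\<Phi> x\<bar> \<le> C * (1 + (\<Sum>j\<le>N. \<bar>x j\<bar>)) ^ k"
    unfolding poly_growth_def by (rule conjunct2)
  then obtain N1 C1 k1 where 1: "\<forall>x. \<bar>\<Phi> x\<bar> \<le> C1 * (1 + (\<Sum>j\<le>N1. \<bar>x j\<bar>)) ^ k1" by (elim exE)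
  from assms(2) have "\<exists>N C k. \<forall>x. \<bar>\<Psi> x\<bar> \<le> C * (1 + (\<Sum>j\<le>N. \<bar>x j\<bar>)) ^ k"
    unfolding poly_growth_def by (rule conjunct2)
  then obtain N2 C2 k2 where 2: "\<forall>x. \<bar>\<Psi> x\<bar> \<le> C2 * (1 + (\<Sum>j\<le>N2. \<bar>x j\<bar>)) ^ k2" by (elim exE)
  have mono: "C' * (1 + (\<Sum>j\<le>N'. \<bar>x j\<bar>)) ^ k' \<le> (\<bar>C1\<bar> + \<bar>C2\<bar>) * (1 + (\<Sum>j\<le>max N1 N2. \<bar>x j\<bar>)) ^ (max k1 k2)"
    if "C' \<le> \<bar>C1\<bar> + \<bar>C2\<bar>" "N' \<le> max N1 N2" "k' \<le> max k1 k2" for C' N' k' and x :: "nat \<Rightarrow> real"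
  proof (rule mult_mono)
    have s: "(\<Sum>j\<le>N'. \<bar>x j\<bar>) \<le> (\<Sum>j\<le>max N1 N2. \<bar>x j\<bar>)" using that by (intro sum_mono2) auto
    have "(1 + (\<Sum>j\<le>N'. \<bar>x j\<bar>)) ^ k' \<le> (1 + (\<Sum>j\<le>max N1 N2. \<bar>x j\<bar>)) ^ k'"
      using s by (intro power_mono) (simp_all add: sum_nonneg)
    also have "\<dots> \<le> (1 + (\<Sum>j\<le>max N1 N2. \<bar>x j\<bar>)) ^ (max k1 k2)"
      using that by (intro power_increasing) (simp_all add: sum_nonneg)
    finally show "(1 + (\<Sum>j\<le>N'. \<bar>x j\<bar>)) ^ k' \<le> (1 + (\<Sum>j\<le>max N1 N2. \<bar>x j\<bar>)) ^ (max k1 k2)" .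
  qed (use that in \<open>simp_all add: sum_nonneg\<close>)
  show thesis
  proof (rule that[of "\<bar>C1\<bar> + \<bar>C2\<bar>" "max N1 N2" "max k1 k2"])
    show "\<bar>\<Phi> x\<bar> \<le> (\<bar>C1\<bar> + \<bar>C2\<bar>) * (1 + (\<Sum>j\<le>max N1 N2. \<bar>x j\<bar>)) ^ (max k1 k2)" for x
      by (rule order_trans[OF 1[rule_format] mono]) simp_all
    show "\<bar>\<Psi> x\<bar> \<le> (\<bar>C1\<bar> + \<bar>C2\<bar>) * (1 + (\<Sum>j\<le>max N1 N2. \<bar>x j\<bar>)) ^ (max k1 k2)" for x
      by (rule order_trans[OF 2[rule_format] mono]) simp_all
  qed simp
qed

lemma poly_growth_measurable: "poly_growth \<Phi> \<Longrightarrow> \<Phi> \<in> borel_measurable RN"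
  unfolding poly_growth_def by (rule conjunct1)

lemma poly_growth_const: "poly_growth (\<lambda>_. c)"
  unfolding poly_growth_def by (rule conjI[OF _ exI[of _ 0, OF exI[of _ "\<bar>c\<bar>", OF exI[of _ 0]]]]) auto

lemma poly_growth_component: "poly_growth (\<lambda>x. x j)"
  unfolding poly_growth_def
proof (rule conjI[OF _ exI[of _ j, OF exI[of _ 1, OF exI[of _ 1, OF allI]]]])
  fix x :: "nat \<Rightarrow> real"
  have "\<bar>x j\<bar> \<le> (\<Sum>i\<le>j. \<bar>x i\<bar>)" by (rule member_le_sum) auto
  then show "\<bar>x j\<bar> \<le> 1 * (1 + (\<Sum>i\<le>j. \<bar>x i\<bar>)) ^ 1" by simp
qed (rule measurable_RN_component)

lemma poly_growth_add:
  assumes "poly_growth \<Phi>" "poly_growth \<Psi>"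
  shows "poly_growth (\<lambda>x. \<Phi> x + \<Psi> x)"
proof -
  obtain N C k where b: "C \<ge> 0" "\<And>x. \<bar>\<Phi> x\<bar> \<le> C * (1 + (\<Sum>j\<le>N::nat. \<bar>x j\<bar>)) ^ k"
    "\<And>x. \<bar>\<Psi> x\<bar> \<le> C * (1 + (\<Sum>j\<le>N. \<bar>x j\<bar>)) ^ k" by (rule poly_growthE[OF assms]; rule that)
  show ?thesis unfolding poly_growth_def
  proof (rule conjI[OF _ exI[of _ N, OF exI[of _ "2 * C", OF exI[of _ k, OF allI]]]])
    show "\<bar>\<Phi> x + \<Psi> x\<bar> \<le> 2 * C * (1 + (\<Sum>j\<le>N. \<bar>x j\<bar>)) ^ k" for x
      using b(2,3)[of x] abs_triangle_ineq[of "\<Phi> x" "\<Psi> x"] by linarith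
  qed (use assms in \<open>auto dest!: poly_growth_measurable\<close>)
qed

lemma poly_growth_mult:
  assumes "poly_growth \<Phi>" "poly_growth \<Psi>"
  shows "poly_growth (\<lambda>x. \<Phi> x * \<Psi> x)"
proof -
  obtain N C k where b: "C \<ge> 0" "\<And>x. \<bar>\<Phi> x\<bar> \<le> C * (1 + (\<Sum>j\<le>N::nat. \<bar>x j\<bar>)) ^ k"
    "\<And>x. \<bar>\<Psi> x\<bar> \<le> C * (1 + (\<Sum>j\<le>N. \<bar>x j\<bar>)) ^ k" by (rule poly_growthE[OF assms]; rule that)
  show ?thesis unfolding poly_growth_def
  proof (rule conjI[OF _ exI[of _ N, OF exI[of _ "C * C", OF exI[of _ "k + k", OF allI]]]])
    fix x
    have "\<bar>\<Phi> x * \<Psi> x\<bar> \<le> (C * (1 + (\<Sum>j\<le>N. \<bar>x j\<bar>)) ^ k) * (C * (1 + (\<Sum>j\<le>N. \<bar>x j\<bar>)) ^ k)"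
      unfolding abs_mult using b by (intro mult_mono) (auto intro: order_trans[OF abs_ge_zero])
    then show "\<bar>\<Phi> x * \<Psi> x\<bar> \<le> C * C * (1 + (\<Sum>j\<le>N. \<bar>x j\<bar>)) ^ (k + k)"
      by (simp add: power_add mult_ac)
  qed (use assms in \<open>auto dest!: poly_growth_measurable\<close>)
qed

lemma poly_growth_sum: "(\<And>i. i \<in> I \<Longrightarrow> poly_growth (\<Phi> i)) \<Longrightarrow> poly_growth (\<lambda>x. \<Sum>i\<in>I. \<Phi> i x)"
  by (induction I rule: infinite_finite_induct) (auto intro: poly_growth_const poly_growth_add)

lemma poly_growth_prod: "(\<And>i. i \<in> I \<Longrightarrow> poly_growth (\<Phi> i)) \<Longrightarrow> poly_growth (\<lambda>x. \<Prod>i\<in>I. \<Phi> i x)"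
  by (induction I rule: infinite_finite_induct) (auto intro: poly_growth_const poly_growth_mult)

lemma poly_growth_poly: "poly_growth \<Phi> \<Longrightarrow> poly_growth (\<lambda>x. poly P (\<Phi> x))"
  by (induction P) (auto intro!: poly_growth_const poly_growth_add poly_growth_mult)

lemma poly_growth_power: "poly_growth \<Phi> \<Longrightarrow> poly_growth (\<lambda>x. \<Phi> x ^ k)"
  by (induction k) (auto intro!: poly_growth_const poly_growth_mult)

text \<open>Linear growth covers a Stein solution, whose derivative is bounded, and its bounded
  derivatives alike.\<close>

lemma poly_growth_compose:
  fixes f :: "real \<Rightarrow> real"
  assumes "poly_growth \<Phi>" and f: "f \<in> borel_measurable borel" "\<And>y. \<bar>f y\<bar> \<le> B * (1 + \<bar>y\<bar>)"
  shows "poly_growth (\<lambda>x. f (\<Phi> x))"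
proof -
  obtain N C k where b: "C \<ge> 0" "\<And>x. \<bar>\<Phi> x\<bar> \<le> C * (1 + (\<Sum>j\<le>N::nat. \<bar>x j\<bar>)) ^ k"
    by (rule poly_growthE[OF assms(1) assms(1)]; rule that)
  have B: "0 \<le> B" using f(2)[of 0] by simp
  show ?thesis unfolding poly_growth_def
  proof (rule conjI[OF _ exI[of _ N, OF exI[of _ "B * (1 + C)", OF exI[of _ k, OF allI]]]])
    fix x :: "nat \<Rightarrow> real"
    have 1: "1 \<le> (1 + (\<Sum>j\<le>N. \<bar>x j\<bar>)) ^ k" by (rule one_le_power) (simp add: sum_nonneg)
    have "\<bar>f (\<Phi> x)\<bar> \<le> B * (1 + C * (1 + (\<Sum>j\<le>N. \<bar>x j\<bar>)) ^ k)"
      using f(2)[of "\<Phi> x"] b(2)[of x] B by (meson add_left_mono mult_left_mono order_trans)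
    also have "\<dots> \<le> B * ((1 + C) * (1 + (\<Sum>j\<le>N. \<bar>x j\<bar>)) ^ k)"
      using B 1 by (intro mult_left_mono) (simp_all add: distrib_right)
    finally show "\<bar>f (\<Phi> x)\<bar> \<le> B * (1 + C) * (1 + (\<Sum>j\<le>N. \<bar>x j\<bar>)) ^ k" by (simp add: mult.assoc)
  qed (use assms in \<open>auto dest!: poly_growth_measurable\<close>)
qed

lemmas poly_growth_intros = poly_growth_const poly_growth_component poly_growth_add poly_growth_mult
  poly_growth_sum poly_growth_prod poly_growth_poly poly_growth_power

text \<open>The direction of differentiation is the row of the covariance matrix belonging to the
  variable with respect to which one integrates by parts.\<close>

definition dir_deriv :: "(nat \<Rightarrow> real) \<Rightarrow> ((nat \<Rightarrow> real) \<Rightarrow> real) \<Rightarrow> ((nat \<Rightarrow> real) \<Rightarrow> real) \<Rightarrow> bool" where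
  "dir_deriv v \<Phi> \<Phi>' \<longleftrightarrow> poly_growth \<Phi> \<and> poly_growth \<Phi>' \<and>
     (\<forall>x s. ((\<lambda>s. \<Phi> (\<lambda>j. x j + s * v j)) has_real_derivative \<Phi>' (\<lambda>j. x j + s * v j)) (at s)) \<and>
     (\<forall>x. continuous_on UNIV (\<lambda>s. \<Phi>' (\<lambda>j. x j + s * v j)))"

lemma dir_derivI:
  assumes "poly_growth \<Phi>" "poly_growth \<Phi>'"
    and "\<And>x s. ((\<lambda>s. \<Phi> (\<lambda>j. x j + s * v j)) has_real_derivative \<Phi>' (\<lambda>j. x j + s * v j)) (at s)"
    and "\<And>x. continuous_on UNIV (\<lambda>s. \<Phi>' (\<lambda>j. x j + s * v j))"
  shows "dir_deriv v \<Phi> \<Phi>'"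
  using assms by (simp add: dir_deriv_def)

lemma dir_derivD:
  assumes "dir_deriv v \<Phi> \<Phi>'"
  shows "poly_growth \<Phi>" "poly_growth \<Phi>'"
    and "((\<lambda>s. \<Phi> (\<lambda>j. x j + s * v j)) has_real_derivative \<Phi>' (\<lambda>j. x j + s * v j)) (at s)"
    and "continuous_on UNIV (\<lambda>s. \<Phi>' (\<lambda>j. x j + s * v j))"
    and "continuous_on UNIV (\<lambda>s. \<Phi> (\<lambda>j. x j + s * v j))"
proof -
  show 1: "((\<lambda>s. \<Phi> (\<lambda>j. x j + s * v j)) has_real_derivative \<Phi>' (\<lambda>j. x j + s * v j)) (at s)" for s
    using assms unfolding dir_deriv_def by blast
  show "continuous_on UNIV (\<lambda>s. \<Phi> (\<lambda>j. x j + s * v j))" by (rule DERIV_continuous_on_UNIV[OF 1])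
qed (use assms in \<open>simp_all add: dir_deriv_def\<close>)

lemma dir_deriv_const: "dir_deriv v (\<lambda>_. c) (\<lambda>_. 0)"
  by (rule dir_derivI) (simp_all add: poly_growth_const)

lemma dir_deriv_add:
  assumes "dir_deriv v \<Phi> \<Phi>'" "dir_deriv v \<Psi> \<Psi>'"
  shows "dir_deriv v (\<lambda>x. \<Phi> x + \<Psi> x) (\<lambda>x. \<Phi>' x + \<Psi>' x)"
  by (intro dir_derivI poly_growth_add DERIV_add continuous_on_add dir_derivD[OF assms(1)] dir_derivD[OF assms(2)])

lemma dir_deriv_mult:
  assumes "dir_deriv v \<Phi> \<Phi>'" "dir_deriv v \<Psi> \<Psi>'"
  shows "dir_deriv v (\<lambda>x. \<Phi> x * \<Psi> x) (\<lambda>x. \<Phi>' x * \<Psi> x + \<Phi> x * \<Psi>' x)"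
proof (rule dir_derivI)
  show "((\<lambda>s. \<Phi> (\<lambda>j. x j + s * v j) * \<Psi> (\<lambda>j. x j + s * v j)) has_real_derivative
      \<Phi>' (\<lambda>j. x j + s * v j) * \<Psi> (\<lambda>j. x j + s * v j) + \<Phi> (\<lambda>j. x j + s * v j) * \<Psi>' (\<lambda>j. x j + s * v j)) (at s)" for x s
    by (rule DERIV_cong[OF DERIV_mult[OF dir_derivD(3)[OF assms(1)] dir_derivD(3)[OF assms(2)]]]) simp
qed (intro poly_growth_add poly_growth_mult continuous_on_add continuous_on_mult
    dir_derivD[OF assms(1)] dir_derivD[OF assms(2)])+

lemma dir_deriv_sum:
  "(\<And>i. i \<in> I \<Longrightarrow> dir_deriv v (\<Phi> i) (\<Phi>' i)) \<Longrightarrow> dir_deriv v (\<lambda>x. \<Sum>i\<in>I. \<Phi> i x) (\<lambda>x. \<Sum>i\<in>I. \<Phi>' i x)"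
  by (induction I rule: infinite_finite_induct) (auto intro: dir_deriv_const dir_deriv_add)

lemma dir_deriv_prod:
  assumes "finite I" "\<And>i. i \<in> I \<Longrightarrow> dir_deriv v (\<Phi> i) (\<Phi>' i)"
  shows "dir_deriv v (\<lambda>x. \<Prod>i\<in>I. \<Phi> i x) (\<lambda>x. \<Sum>i\<in>I. \<Phi>' i x * (\<Prod>k\<in>I - {i}. \<Phi> k x))"
  using assms
proof (induction I)
  case (insert a I)
  have "(\<lambda>x. \<Sum>i\<in>insert a I. \<Phi>' i x * (\<Prod>k\<in>insert a I - {i}. \<Phi> k x)) =
     (\<lambda>x. \<Phi>' a x * (\<Prod>k\<in>I. \<Phi> k x) + \<Phi> a x * (\<Sum>i\<in>I. \<Phi>' i x * (\<Prod>k\<in>I - {i}. \<Phi> k x)))"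
  proof
    fix x
    have "(\<Prod>k\<in>insert a I - {i}. \<Phi> k x) = \<Phi> a x * (\<Prod>k\<in>I - {i}. \<Phi> k x)" if "i \<in> I" for i
    proof -
      have "insert a I - {i} = insert a (I - {i})" "a \<notin> I - {i}" using insert.hyps that by auto
      then show ?thesis using insert.hyps by simp
    qed
    then have "(\<Sum>i\<in>I. \<Phi>' i x * (\<Prod>k\<in>insert a I - {i}. \<Phi> k x)) = \<Phi> a x * (\<Sum>i\<in>I. \<Phi>' i x * (\<Prod>k\<in>I - {i}. \<Phi> k x))"
      by (simp add: sum_distrib_left mult_ac cong: sum.cong)
    moreover have "insert a I - {a} = I" using insert.hyps by auto
    ultimately show "(\<Sum>i\<in>insert a I. \<Phi>' i x * (\<Prod>k\<in>insert a I - {i}. \<Phi> k x)) =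
     \<Phi>' a x * (\<Prod>k\<in>I. \<Phi> k x) + \<Phi> a x * (\<Sum>i\<in>I. \<Phi>' i x * (\<Prod>k\<in>I - {i}. \<Phi> k x))"
      using insert.hyps by simp
  qed
  then show ?case using insert by (simp add: dir_deriv_mult)
qed (simp add: dir_deriv_const)

lemma dir_deriv_poly_component:
  "dir_deriv v (\<lambda>x. poly P (x j)) (\<lambda>x. v j * poly (pderiv P) (x j))"
proof (rule dir_derivI)
  show "((\<lambda>s. poly P (x j + s * v j)) has_real_derivative v j * poly (pderiv P) (x j + s * v j)) (at s)" for x s
    by (rule DERIV_cong[OF DERIV_chain2[OF poly_DERIV]]) (auto intro!: derivative_eq_intros)
qed (auto intro!: poly_growth_intros continuous_intros)

lemma dir_deriv_compose:
  assumes \<Phi>: "dir_deriv v \<Phi> \<Phi>'"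
    and f: "\<And>y. (f has_real_derivative f' y) (at y)" "continuous_on UNIV f'"
    and B: "\<And>y. \<bar>f y\<bar> \<le> B * (1 + \<bar>y\<bar>)" "\<And>y. \<bar>f' y\<bar> \<le> B' * (1 + \<bar>y\<bar>)"
  shows "dir_deriv v (\<lambda>x. f (\<Phi> x)) (\<lambda>x. f' (\<Phi> x) * \<Phi>' x)"
proof (rule dir_derivI)
  have c: "continuous_on UNIV f" by (rule DERIV_continuous_on_UNIV[OF f(1)])
  note pg = dir_derivD(1,2)[OF \<Phi>]
  show "poly_growth (\<lambda>x. f (\<Phi> x))"
    by (intro poly_growth_compose[OF pg(1) _ B(1)] borel_measurable_continuous_onI c)
  show "poly_growth (\<lambda>x. f' (\<Phi> x) * \<Phi>' x)"
    by (intro poly_growth_mult pg poly_growth_compose[OF pg(1) _ B(2)] borel_measurable_continuous_onI f(2))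
  show "((\<lambda>s. f (\<Phi> (\<lambda>j. x j + s * v j))) has_real_derivative
      f' (\<Phi> (\<lambda>j. x j + s * v j)) * \<Phi>' (\<lambda>j. x j + s * v j)) (at s)" for x s
    by (rule DERIV_chain2[OF f(1) dir_derivD(3)[OF \<Phi>]])
  show "continuous_on UNIV (\<lambda>s. f' (\<Phi> (\<lambda>j. x j + s * v j)) * \<Phi>' (\<lambda>j. x j + s * v j))" for x
    by (intro continuous_on_mult dir_derivD(4)[OF \<Phi>] continuous_on_compose2[OF f(2) dir_derivD(5)[OF \<Phi>]]) simp
qed

section \<open>Integration by parts for the standard normal density\<close>

lemma abs_power_le_exp: "(1 + \<bar>x::real\<bar>) ^ k \<le> fact k * exp (1 + \<bar>x\<bar>)"
proof -
  have "(\<Sum>n\<in>{k}. (1 + \<bar>x\<bar>) ^ n /\<^sub>R fact n) \<le> exp (1 + \<bar>x\<bar>)"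
    unfolding exp_def by (rule sum_le_suminf) (auto simp: summable_exp)
  then show ?thesis by (simp add: divide_simps mult.commute)
qed

lemma tendsto_growth_normal_density:
  fixes \<psi> :: "real \<Rightarrow> real"
  assumes b: "\<And>x. \<bar>\<psi> x\<bar> \<le> C * (1 + \<bar>x\<bar>) ^ k" and F: "F = at_top \<or> F = at_bot"
  shows "((\<lambda>x. std_normal_density x * \<psi> x) \<longlongrightarrow> 0) F"
proof (rule Lim_null_comparison)
  have C: "0 \<le> C" using b[of 0] by simp
  define D where "D = C * fact k / sqrt (2 * pi)"
  have "((\<lambda>x::real. exp (- x\<^sup>2 / 2) * exp (1 + \<bar>x\<bar>)) \<longlongrightarrow> 0) at_top"
    "((\<lambda>x::real. exp (- x\<^sup>2 / 2) * exp (1 + \<bar>x\<bar>)) \<longlongrightarrow> 0) at_bot"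
    by real_asymp+
  then have "((\<lambda>x::real. exp (- x\<^sup>2 / 2) * exp (1 + \<bar>x\<bar>)) \<longlongrightarrow> 0) F" using F by auto
  then show "((\<lambda>x::real. D * (exp (- x\<^sup>2 / 2) * exp (1 + \<bar>x\<bar>))) \<longlongrightarrow> 0) F"
    by (rule tendsto_mult_right_zero)
  show "\<forall>\<^sub>F x in F. norm (std_normal_density x * \<psi> x) \<le> D * (exp (- x\<^sup>2 / 2) * exp (1 + \<bar>x\<bar>))"
  proof (intro always_eventually allI)
    fix x
    have "\<bar>\<psi> x\<bar> \<le> C * (fact k * exp (1 + \<bar>x\<bar>))"
      by (intro order_trans[OF b] mult_left_mono abs_power_le_exp C)
    then have "std_normal_density x * \<bar>\<psi> x\<bar> \<le> std_normal_density x * (C * (fact k * exp (1 + \<bar>x\<bar>)))"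
      by (rule mult_left_mono) simp
    then show "norm (std_normal_density x * \<psi> x) \<le> D * (exp (- x\<^sup>2 / 2) * exp (1 + \<bar>x\<bar>))"
      by (simp add: abs_mult std_normal_density_def D_def mult_ac)
  qed
qed

lemma integrable_growth_normal_density:
  fixes \<psi> :: "real \<Rightarrow> real"
  assumes [measurable]: "\<psi> \<in> borel_measurable borel" and b: "\<And>x. \<bar>\<psi> x\<bar> \<le> C * (1 + \<bar>x\<bar>) ^ k"
  shows "integrable lborel (\<lambda>x. std_normal_density x * \<psi> x)"
proof (rule Bochner_Integration.integrable_bound)
  have C: "0 \<le> C" using b[of 0] by simp
  show "integrable lborel (\<lambda>x. C * (2 ^ k * (std_normal_density x * 1 + std_normal_density x * \<bar>x\<bar> ^ k)))"
    by (rule integrable_mult_right, rule integrable_mult_right, rule Bochner_Integration.integrable_add)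
      (simp, rule integrable_std_normal_moment_abs)
  show "(\<lambda>x. std_normal_density x * \<psi> x) \<in> borel_measurable lborel"
    using assms(1) by simp
  show "AE x in lborel. norm (std_normal_density x * \<psi> x) \<le>
      norm (C * (2 ^ k * (std_normal_density x * 1 + std_normal_density x * \<bar>x\<bar> ^ k)))"
  proof (intro AE_I2)
    fix x :: real
    have "(1 + \<bar>x\<bar>) ^ k \<le> 2 ^ k * (1 + \<bar>x\<bar> ^ k)"
    proof (cases "\<bar>x\<bar> \<le> 1")
      case True
      then have "(1 + \<bar>x\<bar>) ^ k \<le> 2 ^ k" by (intro power_mono) auto
      moreover have "0 \<le> 2 ^ k * \<bar>x\<bar> ^ k" by simp
      ultimately show ?thesis unfolding distrib_left by linarith
    next
      case False
      then have "(1 + \<bar>x\<bar>) ^ k \<le> (2 * \<bar>x\<bar>) ^ k" by (intro power_mono) auto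
      moreover have "(0::real) \<le> 2 ^ k" by simp
      ultimately show ?thesis unfolding power_mult_distrib distrib_left by linarith
    qed
    then have "\<bar>\<psi> x\<bar> \<le> C * (2 ^ k * (1 + \<bar>x\<bar> ^ k))"
      by (intro order_trans[OF b] mult_left_mono C)
    then have "std_normal_density x * \<bar>\<psi> x\<bar> \<le> std_normal_density x * (C * (2 ^ k * (1 + \<bar>x\<bar> ^ k)))"
      by (rule mult_left_mono) simp
    also have "\<dots> = C * (2 ^ k * (std_normal_density x * 1 + std_normal_density x * \<bar>x\<bar> ^ k))"
      by (simp only: algebra_simps)
    also have "\<dots> \<le> norm \<dots>" unfolding real_norm_def by (rule abs_ge_self)
    finally show "norm (std_normal_density x * \<psi> x) \<le>
      norm (C * (2 ^ k * (std_normal_density x * 1 + std_normal_density x * \<bar>x\<bar> ^ k)))"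
      by (simp only: real_norm_def abs_mult abs_of_nonneg[OF normal_density_nonneg])
  qed
qed

text \<open>The derivative of the density is \<open>- x\<close> times the density. So the two sides
  differ by the integral over the line of the derivative of density times \<open>\<psi>\<close>, and
  polynomial growth makes the boundary values vanish.\<close>

lemma normal_integration_by_parts:
  fixes \<psi> \<psi>' :: "real \<Rightarrow> real"
  assumes D: "\<And>x. (\<psi> has_real_derivative \<psi>' x) (at x)" and c: "continuous_on UNIV \<psi>'"
    and b: "\<And>x. \<bar>\<psi> x\<bar> \<le> C * (1 + \<bar>x\<bar>) ^ k" "\<And>x. \<bar>\<psi>' x\<bar> \<le> C' * (1 + \<bar>x\<bar>) ^ k'"
  shows "(LINT x|lborel. std_normal_density x * (x * \<psi> x)) = (LINT x|lborel. std_normal_density x * \<psi>' x)"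
proof -
  have c\<psi>: "continuous_on UNIV \<psi>" using D by (rule DERIV_continuous_on_UNIV)
  have [measurable]: "\<psi> \<in> borel_measurable borel" "\<psi>' \<in> borel_measurable borel"
    using c c\<psi> by (auto intro: borel_measurable_continuous_onI)
  have C: "0 \<le> C" using b(1)[of 0] by simp
  have b2: "\<bar>x * \<psi> x\<bar> \<le> C * (1 + \<bar>x\<bar>) ^ Suc k" for x
  proof -
    have "\<bar>x\<bar> * \<bar>\<psi> x\<bar> \<le> (1 + \<bar>x\<bar>) * (C * (1 + \<bar>x\<bar>) ^ k)"
      using b(1)[of x] C by (intro mult_mono) auto
    then show ?thesis by (simp add: abs_mult mult_ac)
  qed
  have i1: "integrable lborel (\<lambda>x. std_normal_density x * (x * \<psi> x))"
    by (rule integrable_growth_normal_density[OF _ b2]) simp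
  have i2: "integrable lborel (\<lambda>x. std_normal_density x * \<psi>' x)"
    by (rule integrable_growth_normal_density[OF _ b(2)]) simp
  have cs: "isCont std_normal_density x" for x
    by (rule DERIV_isCont[OF std_normal_density_deriv])
  have "(LBINT x=-\<infinity>..\<infinity>. std_normal_density x * \<psi>' x - std_normal_density x * (x * \<psi> x)) = 0 - 0"
  proof (rule interval_integral_FTC_integrable[where F="\<lambda>x. std_normal_density x * \<psi> x"])
    show "((\<lambda>x. std_normal_density x * \<psi> x) has_vector_derivative
        std_normal_density x * \<psi>' x - std_normal_density x * (x * \<psi> x)) (at x)" for x
      unfolding has_real_derivative_iff_has_vector_derivative[symmetric]
      by (rule DERIV_cong[OF DERIV_mult[OF std_normal_density_deriv D]]) (simp add: algebra_simps)
    show "isCont (\<lambda>x. std_normal_density x * \<psi>' x - std_normal_density x * (x * \<psi> x)) x" for x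
      using c c\<psi> by (intro continuous_intros cs) (auto simp: continuous_on_eq_continuous_at)
    show "set_integrable lborel (einterval (-\<infinity>) \<infinity>)
        (\<lambda>x. std_normal_density x * \<psi>' x - std_normal_density x * (x * \<psi> x))"
      using i1 i2 by (simp add: set_integrable_def)
    show "(((\<lambda>x. std_normal_density x * \<psi> x) \<circ> real_of_ereal) \<longlongrightarrow> 0) (at_right (-\<infinity>))"
      "(((\<lambda>x. std_normal_density x * \<psi> x) \<circ> real_of_ereal) \<longlongrightarrow> 0) (at_left \<infinity>)"
      using tendsto_growth_normal_density[OF b(1)] by (simp_all add: ereal_tendsto_simps)
  qed simp
  then show ?thesis
    using i1 i2 by (simp add: interval_lebesgue_integral_def set_lebesgue_integral_def)
qed

section \<open>Hermite coefficients of weak derivatives\<close>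

definition flat :: "nat \<Rightarrow> real \<Rightarrow> real" where
  "flat k x = (if 0 < x then exp (- 1 / x) / x ^ k else 0)"

lemma flat_tendsto_right: "((\<lambda>h. flat k h) \<longlongrightarrow> 0) (at_right 0)"
proof -
  have "((\<lambda>x. x ^ k / exp x) \<longlongrightarrow> (0::real)) at_top" by (rule tendsto_power_div_exp_0)
  from filterlim_compose[OF this filterlim_inverse_at_top_right]
  have "((\<lambda>h::real. inverse h ^ k / exp (inverse h)) \<longlongrightarrow> 0) (at_right 0)" .
  then show ?thesis
  proof (rule Lim_transform_eventually)
    show "\<forall>\<^sub>F h in at_right 0. inverse h ^ k / exp (inverse h) = flat k h"
      using eventually_at_right_less[of "0::real"]
      by eventually_elim (simp add: flat_def exp_minus field_simps)
  qed
qed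

text \<open>The powers in the denominator make the family closed under differentiation, which is the
  reason for the index \<open>k\<close>. At \<open>0\<close> both one-sided difference quotients
  tend to \<open>0\<close>.\<close>

lemma flat_deriv: "(flat k has_real_derivative flat (k + 2) x - real k * flat (k + 1) x) (at x)"
proof (cases "x = 0")
  case True
  have r: "((\<lambda>h. flat k h / h) \<longlongrightarrow> 0) (at_right 0)"
  proof (rule Lim_transform_eventually[OF flat_tendsto_right[of "Suc k"]])
    show "\<forall>\<^sub>F h in at_right 0. flat (Suc k) h = flat k h / h"
      by (intro always_eventually allI) (simp add: flat_def)
  qed
  have l: "((\<lambda>h. flat k h / h) \<longlongrightarrow> 0) (at_left 0)"
  proof (rule Lim_transform_eventually[OF tendsto_const])
    show "\<forall>\<^sub>F h in at_left 0. 0 = flat k h / h"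
      by (auto simp: eventually_at_filter flat_def)
  qed
  have "((\<lambda>h. flat k h / h) \<longlongrightarrow> 0) (at 0)" using l r by (simp add: filterlim_split_at)
  then show ?thesis using True by (simp add: DERIV_def flat_def)
next
  case False
  then consider "0 < x" | "x < 0" by linarith
  then show ?thesis
  proof cases
    case 1
    have d: "((\<lambda>x. exp (- 1 / x) / x ^ k) has_real_derivative flat (k + 2) x - real k * flat (k + 1) x) (at x)"
    proof (cases k)
      case 0
      show ?thesis using 1 unfolding 0
        by (auto intro!: derivative_eq_intros simp: flat_def power2_eq_square)
    next
      case (Suc n)
      show ?thesis using 1 unfolding Suc
        by (auto intro!: derivative_eq_intros simp: flat_def field_simps power2_eq_square) (cases n; simp)
    qed
    show ?thesis
      by (rule has_field_derivative_transform_within_open[OF d, of "{0<..}"]) (use 1 in \<open>auto simp: flat_def\<close>)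
  next
    case 2
    have "(flat k has_real_derivative 0) (at x)"
      by (rule has_field_derivative_transform_within_open[OF DERIV_const[of 0], of "{..<0}"]) (use 2 in \<open>auto simp: flat_def\<close>)
    then show ?thesis using 2 by (simp add: flat_def)
  qed
qed

lemma flat_nonneg: "0 \<le> flat k x"
  by (simp add: flat_def)

lemma flat_0_le: "flat 0 x \<le> 1"
  by (simp add: flat_def)

lemma flat_2_le: "flat 2 x \<le> 2"
proof (cases "0 < x")
  case True
  define y where "y = 1 / x"
  \<comment> \<open>One term of the exponential series, \<open>y^2 / 2 \<le> exp y\<close>, at
    \<open>y = 1 / x\<close>.\<close>
  have "(\<Sum>n\<in>{2}. y ^ n /\<^sub>R fact n) \<le> exp y"
    unfolding exp_def y_def using True by (intro sum_le_suminf) (auto simp: summable_exp)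
  then have "(1 / x)\<^sup>2 \<le> 2 * exp (1 / x)" unfolding y_def[symmetric] by (simp add: field_simps)
  then have "exp (- (1 / x)) * (1 / x)\<^sup>2 \<le> exp (- (1 / x)) * (2 * exp (1 / x))" by (intro mult_left_mono) auto
  also have "\<dots> = 2" by (simp add: exp_minus)
  finally show ?thesis using True by (simp add: flat_def power_divide)
qed (simp add: flat_def)

text \<open>A syntactic class closed under differentiation; that yields smoothness in the form
  \<open>test_function\<close> demands, differentiability of all iterates of \<open>deriv\<close>.
  Its generators are what a Hermite polynomial times the normal density times a cutoff is made
  of.\<close>

inductive smooth_fn :: "(real \<Rightarrow> real) \<Rightarrow> bool" where
  "smooth_fn (\<lambda>_. c)"
| "smooth_fn (\<lambda>x. x)"
| "smooth_fn std_normal_density"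
| "smooth_fn (\<lambda>x. flat k (a * x + b))"
| "smooth_fn f \<Longrightarrow> smooth_fn g \<Longrightarrow> smooth_fn (\<lambda>x. f x + g x)"
| "smooth_fn f \<Longrightarrow> smooth_fn g \<Longrightarrow> smooth_fn (\<lambda>x. f x * g x)"

lemma smooth_fn_poly: "smooth_fn (poly P)"
proof (induction P)
  case 0
  show ?case using smooth_fn.intros(1)[of 0] by (simp add: poly_0[abs_def])
next
  case (pCons a P)
  have "smooth_fn (\<lambda>x. a + x * poly P x)" by (intro smooth_fn.intros pCons)
  then show ?case by (simp add: poly_pCons[abs_def])
qed

lemma smooth_fn_deriv: "smooth_fn f \<Longrightarrow> \<exists>f'. smooth_fn f' \<and> (\<forall>x. (f has_real_derivative f' x) (at x))"
proof (induction rule: smooth_fn.induct)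
  case (1 c)
  then show ?case by (intro exI[of _ "\<lambda>_. 0"]) (auto intro: smooth_fn.intros)
next
  case 2
  then show ?case by (intro exI[of _ "\<lambda>_. 1"]) (auto intro: smooth_fn.intros)
next
  case 3
  have "smooth_fn (\<lambda>x. (-1) * x * std_normal_density x)" by (intro smooth_fn.intros)
  then show ?case using std_normal_density_deriv by (intro exI[of _ "\<lambda>x. (-1) * x * std_normal_density x"]) simp
next
  case (4 k a b)
  have s: "smooth_fn (\<lambda>x. (flat (k + 2) (a * x + b) + (- real k) * flat (k + 1) (a * x + b)) * a)"
    by (intro smooth_fn.intros)
  have "((\<lambda>x. flat k (a * x + b)) has_real_derivative
      (flat (k + 2) (a * x + b) + (- real k) * flat (k + 1) (a * x + b)) * a) (at x)" for x
    by (rule DERIV_cong[OF DERIV_chain2[OF flat_deriv]]) (auto intro!: derivative_eq_intros)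
  with s show ?case by blast
next
  case (5 f g)
  then obtain f' g' where *: "smooth_fn f'" "smooth_fn g'"
    "\<And>x. (f has_real_derivative f' x) (at x)" "\<And>x. (g has_real_derivative g' x) (at x)" by blast
  have "((\<lambda>x. f x + g x) has_real_derivative f' x + g' x) (at x)" for x by (intro DERIV_add *)
  with smooth_fn.intros(5)[OF *(1,2)] show ?case by blast
next
  case (6 f g)
  then obtain f' g' where *: "smooth_fn f'" "smooth_fn g'"
    "\<And>x. (f has_real_derivative f' x) (at x)" "\<And>x. (g has_real_derivative g' x) (at x)" by blast
  have "((\<lambda>x. f x * g x) has_real_derivative f' x * g x + f x * g' x) (at x)" for x
    by (rule DERIV_cong[OF DERIV_mult[OF *(3,4)]]) simp
  moreover have "smooth_fn (\<lambda>x. f' x * g x + f x * g' x)" by (intro smooth_fn.intros * 6)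
  ultimately show ?case by blast
qed

lemma smooth_fn_deriv_iter: "smooth_fn f \<Longrightarrow> smooth_fn ((deriv ^^ j) f)"
proof (induction j)
  case (Suc j)
  then obtain f' where f': "smooth_fn f'" "\<And>x. ((deriv ^^ j) f has_real_derivative f' x) (at x)"
    using smooth_fn_deriv by blast
  have "deriv ((deriv ^^ j) f) = f'" using f'(2) by (intro ext DERIV_imp_deriv)
  then show ?case using f'(1) by simp
qed simp

lemma smooth_fn_test_function:
  assumes "smooth_fn \<phi>" and R: "\<And>x. R \<le> \<bar>x\<bar> \<Longrightarrow> \<phi> x = 0"
  shows "test_function \<phi>"
  unfolding test_function_def
proof (intro conjI allI)
  fix j x
  show "(deriv ^^ j) \<phi> differentiable (at x)"
    using smooth_fn_deriv[OF smooth_fn_deriv_iter[OF assms(1)]] real_differentiable_def by blast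
  have "{x. \<phi> x \<noteq> 0} \<subseteq> {-R..R}" using R by (force simp: abs_le_iff)
  then have "bounded {x. \<phi> x \<noteq> 0}" using bounded_closed_interval bounded_subset by blast
  then show "compact (closure {x. \<phi> x \<noteq> 0})" by (simp add: compact_closure)
qed

section \<open>Integrals with respect to the Gaussian measure\<close>

lemma integral_gauss:
  fixes f :: "real \<Rightarrow> real"
  assumes "f \<in> borel_measurable borel"
  shows "(LINT x|\<gamma>. f x) = (LINT x|lborel. std_normal_density x * f x)"
    and "integrable \<gamma> f \<longleftrightarrow> integrable lborel (\<lambda>x. std_normal_density x * f x)"
  unfolding gauss_def using assms by (simp_all add: integral_density integrable_density)

lemma sets_gauss [measurable_cong, simp]: "sets \<gamma> = sets borel"
  by (simp add: gauss_def)

lemma borel_measurable_poly [measurable]: "poly (P :: real poly) \<in> borel_measurable borel"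
  by (rule borel_measurable_continuous_onI) (rule continuous_on_poly, rule continuous_on_id)

lemma integrable_gauss_poly: "integrable \<gamma> (poly P)"
proof -
  have "integrable lborel (\<lambda>x. std_normal_density x * poly P x)"
  proof (induction P)
    case (pCons a P)
    have *: "std_normal_density x * poly (pCons a P) x = (\<Sum>i\<le>degree (pCons a P). coeff (pCons a P) i * (std_normal_density x * x ^ i))" for x
      by (simp add: poly_altdef sum_distrib_left mult_ac del: coeff_pCons_Suc)
    show ?case unfolding *
      by (intro Bochner_Integration.integrable_sum integrable_mult_right integrable_std_normal_moment)
  qed simp
  then show ?thesis by (subst integral_gauss) simp_all
qed

lemma integrable_gauss_poly_mult: "integrable \<gamma> (\<lambda>x. poly P x * poly Q x)"
  using integrable_gauss_poly[of "P * Q"] by (simp add: poly_mult[abs_def])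

lemma integrable_gauss_const: "integrable \<gamma> (\<lambda>_. c :: real)"
  using integrable_gauss_poly[of "[:c:]"] by (simp add: poly_pCons[abs_def])

lemma Lp_gauss_even:
  assumes "f \<in> Lp_gauss (numeral p)"
  shows "f \<in> borel_measurable borel" "integrable \<gamma> (\<lambda>x. \<bar>f x\<bar> ^ numeral p)"
  using assms by (simp_all add: Lp_gauss_def powr_numeral)

lemma Lp_gauss_6_imp:
  assumes "f \<in> Lp_gauss 6"
  shows "f \<in> Lp_gauss 2" "integrable \<gamma> (\<lambda>x. (f x) ^ 4)"
proof -
  note [measurable] = Lp_gauss_even(1)[OF assms]
  have one: "integrable \<gamma> (\<lambda>_. 1 :: real)" by (rule integrable_gauss_const)
  have i: "integrable \<gamma> (\<lambda>x. 1 + \<bar>f x\<bar> ^ 6)"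
    using one Lp_gauss_even(2)[OF assms] by (rule Bochner_Integration.integrable_add)
  have le: "\<bar>y\<bar> ^ k \<le> 1 + \<bar>y\<bar> ^ 6" if "k \<le> 6" for y :: real and k
  proof (cases "\<bar>y\<bar> \<le> 1")
    case True
    then have "\<bar>y\<bar> ^ k \<le> 1" by (simp add: power_le_one)
    moreover have "0 \<le> \<bar>y\<bar> ^ 6" by simp
    ultimately show ?thesis by linarith
  next
    case False
    then have "\<bar>y\<bar> ^ k \<le> \<bar>y\<bar> ^ 6" using that by (intro power_increasing) auto
    then show ?thesis by simp
  qed
  have "integrable \<gamma> (\<lambda>x. \<bar>f x\<bar> ^ 2)"
    by (rule Bochner_Integration.integrable_bound[OF i]) (use le[of 2] in \<open>auto intro!: AE_I2\<close>)
  then show "f \<in> Lp_gauss 2" by (simp add: Lp_gauss_def)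
  show "integrable \<gamma> (\<lambda>x. (f x) ^ 4)"
    by (rule Bochner_Integration.integrable_bound[OF i]) (use le[of 4] in \<open>auto intro!: AE_I2 simp: power_abs\<close>)
qed

lemma prob_space_gauss: "prob_space \<gamma>"
  unfolding gauss_def by (rule prob_space_normal_density) simp

lemma Lp_gauss_2D:
  assumes "f \<in> Lp_gauss 2"
  shows "f \<in> borel_measurable borel" "integrable \<gamma> (\<lambda>x. (f x)\<^sup>2)"
  using Lp_gauss_even[OF assms] by simp_all

lemma integrable_gauss_mult_poly:
  assumes "f \<in> Lp_gauss 2"
  shows "integrable \<gamma> (\<lambda>x. f x * poly P x)"
proof (rule prob_space.integrable_mult_square[OF prob_space_gauss _ Lp_gauss_2D(2)[OF assms]])
  show "integrable \<gamma> (\<lambda>x. (poly P x)\<^sup>2)"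
    using integrable_gauss_poly_mult[of P P] by (simp add: power2_eq_square)
qed (use Lp_gauss_2D(1)[OF assms] in simp_all)

text \<open>The derivative of \<open>He q\<close> times the normal density is
  \<open>- He (Suc q)\<close> times that density. So the weak derivative is tested with this
  product, cut off by \<open>\<eta> n\<close>, and dominated convergence removes the cutoff. Applied
  twice, this computes the coefficients of the derivatives of \<open>A(g)\<close>.\<close>

lemma weak_deriv_hermite_coeff:
  assumes w: "has_weak_deriv f f'" and f: "f \<in> Lp_gauss 2" and f': "f' \<in> Lp_gauss 2"
  shows "(LINT x|\<gamma>. f' x * poly (He q) x) = (LINT x|\<gamma>. f x * poly (He (Suc q)) x)"
proof -
  note [measurable] = Lp_gauss_2D(1)[OF f] Lp_gauss_2D(1)[OF f']
  define r where "r n = 1 / real (Suc n)" for n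
  \<comment> \<open>\<open>\<eta> n\<close> vanishes for \<open>|x| \<ge> n + 1\<close>; the factor
    \<open>exp 2\<close> normalizes its limit to \<open>1\<close>, as
    \<open>flat 0 1 = exp (- 1)\<close>.\<close>
  define \<eta> where "\<eta> n x = exp 2 * (flat 0 (- r n * x + 1) * flat 0 (r n * x + 1))" for n x
  define \<eta>' where "\<eta>' n x = exp 2 * (- r n * flat 2 (- r n * x + 1) * flat 0 (r n * x + 1)
      + flat 0 (- r n * x + 1) * (r n * flat 2 (r n * x + 1)))" for n x
  define \<phi> where "\<phi> n x = poly (He q) x * std_normal_density x * \<eta> n x" for n x
  have r: "0 < r n" "r n \<le> 1" for n by (simp_all add: r_def)
  have r0: "r \<longlonglongrightarrow> 0" unfolding r_def using LIMSEQ_inverse_real_of_nat by (simp add: inverse_eq_divide)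
  have D\<eta>: "(\<eta> n has_real_derivative \<eta>' n x) (at x)" for n x
    unfolding \<eta>_def[abs_def] \<eta>'_def
    by (rule DERIV_cong[OF DERIV_cmult[OF DERIV_mult[OF DERIV_chain2[OF flat_deriv] DERIV_chain2[OF flat_deriv]]]])
      (auto intro!: derivative_eq_intros simp: numeral_2_eq_2)
  have D\<phi>: "deriv (\<phi> n) x = std_normal_density x * (- poly (He (Suc q)) x * \<eta> n x + poly (He q) x * \<eta>' n x)" for n x
    unfolding \<phi>_def[abs_def]
    by (rule DERIV_imp_deriv, rule DERIV_cong[OF DERIV_mult[OF DERIV_mult[OF poly_DERIV std_normal_density_deriv] D\<eta>]])
      (simp add: algebra_simps)
  have \<eta>_le: "\<bar>\<eta> n x\<bar> \<le> exp 2" for n x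
  proof -
    have "flat 0 (- r n * x + 1) * flat 0 (r n * x + 1) \<le> 1 * 1"
      by (intro mult_mono flat_0_le flat_nonneg) auto
    then have "exp 2 * (flat 0 (- r n * x + 1) * flat 0 (r n * x + 1)) \<le> exp 2 * 1" by (intro mult_left_mono) auto
    moreover have "0 \<le> \<eta> n x" unfolding \<eta>_def by (intro mult_nonneg_nonneg flat_nonneg) auto
    ultimately show ?thesis by (simp add: \<eta>_def)
  qed
  \<comment> \<open>Stretching the cutoff by \<open>n + 1\<close> makes its derivative of order
    \<open>r n\<close>, so the term with \<open>\<eta>'\<close> disappears in the limit.\<close>
  have \<eta>'_le: "\<bar>\<eta>' n x\<bar> \<le> 4 * exp 2 * r n" for n x
  proof -
    have 1: "\<bar>r n * (flat 2 u * flat 0 v)\<bar> \<le> r n * 2" for u v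
    proof -
      have "flat 2 u * flat 0 v \<le> 2 * 1" by (intro mult_mono flat_0_le flat_2_le flat_nonneg) auto
      moreover have "0 \<le> flat 2 u * flat 0 v" by (intro mult_nonneg_nonneg flat_nonneg)
      ultimately show ?thesis using r(1)[of n] by (simp add: abs_mult)
    qed
    have "\<eta>' n x = exp 2 * (r n * (flat 2 (r n * x + 1) * flat 0 (- r n * x + 1)) - r n * (flat 2 (- r n * x + 1) * flat 0 (r n * x + 1)))"
      by (simp add: \<eta>'_def algebra_simps)
    also have "\<bar>\<dots>\<bar> \<le> exp 2 * (r n * 2 + r n * 2)"
      unfolding abs_mult abs_exp_cancel
      by (intro mult_left_mono order_trans[OF abs_triangle_ineq4] add_mono 1[unfolded abs_mult]) (use 1 in \<open>auto simp: abs_mult\<close>)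
    finally show ?thesis by simp
  qed
  have \<eta>_lim: "(\<lambda>n. \<eta> n x) \<longlonglongrightarrow> 1" for x
  proof -
    have c: "isCont (flat 0) 1" by (rule DERIV_isCont[OF flat_deriv])
    have "(\<lambda>n. - r n * x + 1) \<longlonglongrightarrow> - 0 * x + 1" "(\<lambda>n. r n * x + 1) \<longlonglongrightarrow> 0 * x + 1"
      by (intro tendsto_intros r0)+
    then have "(\<lambda>n. - r n * x + 1) \<longlonglongrightarrow> 1" "(\<lambda>n. r n * x + 1) \<longlonglongrightarrow> 1" by simp_all
    then have "(\<lambda>n. \<eta> n x) \<longlonglongrightarrow> exp 2 * (flat 0 1 * flat 0 1)"
      unfolding \<eta>_def by (intro tendsto_intros isCont_tendsto_compose[OF c])
    moreover have "exp 2 * (flat 0 1 * flat 0 1) = 1" by (simp add: flat_def exp_add[symmetric])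
    ultimately show ?thesis by simp
  qed
  have \<eta>'_lim: "(\<lambda>n. \<eta>' n x) \<longlonglongrightarrow> 0" for x
  proof (rule Lim_null_comparison)
    show "(\<lambda>n. 4 * exp 2 * r n) \<longlonglongrightarrow> 0" using tendsto_mult_right_zero[OF r0] .
  qed (use \<eta>'_le in auto)
  have test: "test_function (\<phi> n)" for n
  proof (rule smooth_fn_test_function)
    show "smooth_fn (\<phi> n)"
      unfolding \<phi>_def[abs_def] \<eta>_def[abs_def] by (intro smooth_fn.intros smooth_fn_poly)
    fix x assume "real (Suc n) \<le> \<bar>x\<bar>"
    then have "1 \<le> r n * \<bar>x\<bar>" by (simp add: r_def field_simps)
    then have "- r n * x + 1 \<le> 0 \<or> r n * x + 1 \<le> 0" by (cases "0 \<le> x") auto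
    then show "\<phi> n x = 0" by (auto simp: \<phi>_def \<eta>_def flat_def)
  qed
  have [measurable]: "\<eta> n \<in> borel_measurable borel" "\<eta>' n \<in> borel_measurable borel" for n
  proof -
    show "\<eta> n \<in> borel_measurable borel"
      by (intro borel_measurable_continuous_onI DERIV_continuous_on_UNIV[OF D\<eta>])
    have "continuous_on UNIV (flat k)" for k by (rule DERIV_continuous_on_UNIV[OF flat_deriv])
    then have "flat k \<in> borel_measurable borel" for k by (rule borel_measurable_continuous_onI)
    note [measurable] = this
    show "\<eta>' n \<in> borel_measurable borel" unfolding \<eta>'_def[abs_def] by measurable
  qed
  have i1: "integrable \<gamma> (\<lambda>x. f x * poly (He (Suc q)) x)" and i2: "integrable \<gamma> (\<lambda>x. f x * poly (He q) x)"
    and i3: "integrable \<gamma> (\<lambda>x. f' x * poly (He q) x)"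
    by (intro integrable_gauss_mult_poly f f')+
  have "(\<lambda>n. LINT x|\<gamma>. f x * (- poly (He (Suc q)) x * \<eta> n x + poly (He q) x * \<eta>' n x))
      \<longlonglongrightarrow> (LINT x|\<gamma>. f x * (- poly (He (Suc q)) x * 1 + poly (He q) x * 0))"
  proof (rule integral_dominated_convergence)
    show "integrable \<gamma> (\<lambda>x. exp 2 * \<bar>f x * poly (He (Suc q)) x\<bar> + 4 * exp 2 * \<bar>f x * poly (He q) x\<bar>)"
      using i1 i2 by (intro Bochner_Integration.integrable_add integrable_mult_right integrable_abs)
    show "AE x in \<gamma>. (\<lambda>n. f x * (- poly (He (Suc q)) x * \<eta> n x + poly (He q) x * \<eta>' n x))
        \<longlonglongrightarrow> f x * (- poly (He (Suc q)) x * 1 + poly (He q) x * 0)"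
      by (intro AE_I2 tendsto_intros \<eta>_lim \<eta>'_lim)
    show "AE x in \<gamma>. norm (f x * (- poly (He (Suc q)) x * \<eta> n x + poly (He q) x * \<eta>' n x))
        \<le> exp 2 * \<bar>f x * poly (He (Suc q)) x\<bar> + 4 * exp 2 * \<bar>f x * poly (He q) x\<bar>" for n
    proof (rule AE_I2)
      fix x
      have "4 * exp 2 * r n \<le> 4 * exp 2 * 1" using r by (intro mult_left_mono) auto
      then have b: "\<bar>\<eta>' n x\<bar> \<le> 4 * exp 2" using \<eta>'_le[of n x] by linarith
      have "norm (f x * (- poly (He (Suc q)) x * \<eta> n x + poly (He q) x * \<eta>' n x))
        = \<bar>- (\<eta> n x * (f x * poly (He (Suc q)) x)) + \<eta>' n x * (f x * poly (He q) x)\<bar>"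
        by (simp add: algebra_simps del: He.simps)
      also have "\<dots> \<le> \<bar>\<eta> n x\<bar> * \<bar>f x * poly (He (Suc q)) x\<bar> + \<bar>\<eta>' n x\<bar> * \<bar>f x * poly (He q) x\<bar>"
        using abs_triangle_ineq[of "- (\<eta> n x * (f x * poly (He (Suc q)) x))" "\<eta>' n x * (f x * poly (He q) x)"]
        by (simp only: abs_mult abs_minus_cancel)
      also have "\<dots> \<le> exp 2 * \<bar>f x * poly (He (Suc q)) x\<bar> + 4 * exp 2 * \<bar>f x * poly (He q) x\<bar>"
        by (intro add_mono mult_right_mono \<eta>_le b) auto
      finally show "norm (f x * (- poly (He (Suc q)) x * \<eta> n x + poly (He q) x * \<eta>' n x))
        \<le> exp 2 * \<bar>f x * poly (He (Suc q)) x\<bar> + 4 * exp 2 * \<bar>f x * poly (He q) x\<bar>" .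
    qed
  qed (measurable)
  then have L: "(\<lambda>n. LINT x|\<gamma>. f x * (- poly (He (Suc q)) x * \<eta> n x + poly (He q) x * \<eta>' n x))
      \<longlonglongrightarrow> - (LINT x|\<gamma>. f x * poly (He (Suc q)) x)" by (simp del: He.simps)
  have "(\<lambda>n. LINT x|\<gamma>. f' x * poly (He q) x * \<eta> n x) \<longlonglongrightarrow> (LINT x|\<gamma>. f' x * poly (He q) x * 1)"
  proof (rule integral_dominated_convergence)
    show "integrable \<gamma> (\<lambda>x. \<bar>f' x * poly (He q) x\<bar> * exp 2)" using i3 by (intro integrable_mult_left integrable_abs)
    show "AE x in \<gamma>. (\<lambda>n. f' x * poly (He q) x * \<eta> n x) \<longlonglongrightarrow> f' x * poly (He q) x * 1"
      by (intro AE_I2 tendsto_intros \<eta>_lim)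
    show "AE x in \<gamma>. norm (f' x * poly (He q) x * \<eta> n x) \<le> \<bar>f' x * poly (He q) x\<bar> * exp 2" for n
      using \<eta>_le by (intro AE_I2) (simp add: abs_mult mult_left_mono)
  qed (measurable)
  then have Rr: "(\<lambda>n. - (LINT x|\<gamma>. f' x * poly (He q) x * \<eta> n x)) \<longlonglongrightarrow> - (LINT x|\<gamma>. f' x * poly (He q) x)"
    by (intro tendsto_minus) simp
  have "(LINT x|\<gamma>. f x * (- poly (He (Suc q)) x * \<eta> n x + poly (He q) x * \<eta>' n x))
      = - (LINT x|\<gamma>. f' x * poly (He q) x * \<eta> n x)" for n
  proof -
    have "(LINT x|lborel. f x * deriv (\<phi> n) x) = - (LINT x|lborel. f' x * \<phi> n x)"
      using w test unfolding has_weak_deriv_def by blast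
    then show ?thesis
      by (subst (1 2) integral_gauss) (auto simp: D\<phi> \<phi>_def mult_ac simp del: He.simps)
  qed
  with L have "(\<lambda>n. - (LINT x|\<gamma>. f' x * poly (He q) x * \<eta> n x)) \<longlonglongrightarrow> - (LINT x|\<gamma>. f x * poly (He (Suc q)) x)"
    by simp
  from LIMSEQ_unique[OF this Rr] show ?thesis by simp
qed

section \<open>Orthogonality and uniqueness of Hermite coefficients\<close>

lemma gauss_poly_integration_by_parts:
  "(LINT x|\<gamma>. poly (He (Suc p)) x * poly P x) = (LINT x|\<gamma>. poly (He p) x * poly (pderiv P) x)"
proof -
  have bound: "\<exists>C k. \<forall>x. \<bar>poly Q x\<bar> \<le> C * (1 + \<bar>x\<bar>) ^ k" for Q :: "real poly"
  proof -
    have "\<bar>poly Q x\<bar> \<le> (\<Sum>i\<le>degree Q. \<bar>coeff Q i\<bar>) * (1 + \<bar>x\<bar>) ^ degree Q" for x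
    proof -
      have "\<bar>poly Q x\<bar> \<le> (\<Sum>i\<le>degree Q. \<bar>coeff Q i * x ^ i\<bar>)"
        unfolding poly_altdef by (rule sum_abs)
      also have "\<dots> \<le> (\<Sum>i\<le>degree Q. \<bar>coeff Q i\<bar> * (1 + \<bar>x\<bar>) ^ degree Q)"
      proof (rule sum_mono)
        fix i assume "i \<in> {..degree Q}"
        have "\<bar>x\<bar> ^ i \<le> (1 + \<bar>x\<bar>) ^ i" by (intro power_mono) auto
        also have "\<dots> \<le> (1 + \<bar>x\<bar>) ^ degree Q" using \<open>i \<in> {..degree Q}\<close> by (intro power_increasing) auto
        finally show "\<bar>coeff Q i * x ^ i\<bar> \<le> \<bar>coeff Q i\<bar> * (1 + \<bar>x\<bar>) ^ degree Q"
          unfolding abs_mult power_abs by (rule mult_left_mono) simp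
      qed
      finally show ?thesis by (simp add: sum_distrib_right)
    qed
    then show ?thesis by blast
  qed
  \<comment> \<open>In \<open>He (Suc p) = x * He p - pderiv (He p)\<close> the first term,
    integrated by parts against \<open>P\<close>, produces the derivative of
    \<open>He p * P\<close>; the part with \<open>pderiv (He p)\<close> then cancels the second
    term.\<close>
  define \<psi> where "\<psi> = He p * P"
  obtain C k C' k' where b: "\<And>x. \<bar>poly \<psi> x\<bar> \<le> C * (1 + \<bar>x\<bar>) ^ k" "\<And>x. \<bar>poly (pderiv \<psi>) x\<bar> \<le> C' * (1 + \<bar>x\<bar>) ^ k'"
    using bound[of \<psi>] bound[of "pderiv \<psi>"] by blast
  have "(LINT x|lborel. std_normal_density x * (x * poly \<psi> x)) = (LINT x|lborel. std_normal_density x * poly (pderiv \<psi>) x)"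
    by (rule normal_integration_by_parts[OF poly_DERIV _ b]) (intro continuous_intros)
  then have e: "(LINT x|\<gamma>. x * poly \<psi> x) = (LINT x|\<gamma>. poly (pderiv \<psi>) x)"
    by (subst (1 2) integral_gauss) simp_all
  have i: "integrable \<gamma> (\<lambda>x. x * poly \<psi> x)" "integrable \<gamma> (\<lambda>x. poly (pderiv (He p)) x * poly P x)"
    "integrable \<gamma> (\<lambda>x. poly (He p) x * poly (pderiv P) x)"
    using integrable_gauss_poly_mult[of "[:0, 1:]" \<psi>] by (simp_all add: integrable_gauss_poly_mult)
  have "(LINT x|\<gamma>. poly (He (Suc p)) x * poly P x) = (LINT x|\<gamma>. x * poly \<psi> x - poly (pderiv (He p)) x * poly P x)"
    by (intro Bochner_Integration.integral_cong) (simp_all add: \<psi>_def algebra_simps)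
  also have "\<dots> = (LINT x|\<gamma>. poly (pderiv \<psi>) x) - (LINT x|\<gamma>. poly (pderiv (He p)) x * poly P x)"
    using i e by simp
  also have "(LINT x|\<gamma>. poly (pderiv \<psi>) x) = (LINT x|\<gamma>. poly (pderiv (He p)) x * poly P x + poly (He p) x * poly (pderiv P) x)"
    by (intro Bochner_Integration.integral_cong) (simp_all add: \<psi>_def pderiv_mult algebra_simps)
  also have "\<dots> = (LINT x|\<gamma>. poly (pderiv (He p)) x * poly P x) + (LINT x|\<gamma>. poly (He p) x * poly (pderiv P) x)"
    using i by simp
  finally show ?thesis by simp
qed

lemma integral_gauss_1: "(LINT x|\<gamma>. 1) = (1::real)"
  by (subst integral_gauss) simp_all

text \<open>Each integration by parts lowers both degrees by one and yields a factor
  \<open>q\<close>; unequal degrees run into the derivative of a constant.\<close>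

lemma hermite_orthogonal: "(LINT x|\<gamma>. poly (He p) x * poly (He q) x) = (if p = q then fact p else 0)"
proof (induction p arbitrary: q)
  case 0
  show ?case
  proof (cases q)
    case 0
    then show ?thesis using integral_gauss_1 by simp
  next
    case (Suc q')
    have "(LINT x|\<gamma>. poly (He q) x * poly 1 x) = 0"
      unfolding Suc by (subst gauss_poly_integration_by_parts) simp
    then show ?thesis using Suc by (simp add: mult.commute del: He.simps(2))
  qed
next
  case (Suc p)
  have "(LINT x|\<gamma>. poly (He (Suc p)) x * poly (He q) x) = real q * (LINT x|\<gamma>. poly (He p) x * poly (He (q - 1)) x)"
    by (subst gauss_poly_integration_by_parts) (simp add: pderiv_He mult_ac)
  then show ?case using Suc by (cases q) (simp_all del: He.simps(2))
qed

text \<open>Pairing with \<open>He q\<close> is continuous in mean square and takes the value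
  \<open>fact q * c q\<close> on every partial sum with \<open>m \<ge> q\<close>. It identifies the
  coefficient sequences that \<open>has_hermite_rank\<close> and \<open>is_A\<close> provide
  separately.\<close>

lemma hermite_expansion_coeff:
  assumes "has_hermite_expansion g c"
  shows "(LINT x|\<gamma>. g x * poly (He q) x) = fact q * c q"
proof -
  have g: "g \<in> Lp_gauss 2" and lim: "(\<lambda>m. LINT x|\<gamma>. (g x - (\<Sum>r\<le>m. c r * poly (He r) x))\<^sup>2) \<longlonglongrightarrow> 0"
    using assms by (simp_all add: has_hermite_expansion_def hermite_eq_poly)
  note [measurable] = Lp_gauss_2D(1)[OF g]
  define P where "P m = (\<Sum>r\<le>m. smult (c r) (He r))" for m
  have P: "poly (P m) x = (\<Sum>r\<le>m. c r * poly (He r) x)" for m x by (simp add: P_def poly_sum)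
  define a where "a m = (LINT x|\<gamma>. (g x - poly (P m) x)\<^sup>2)" for m
  have a: "a \<longlonglongrightarrow> 0" using lim by (simp add: a_def[abs_def] P)
  define D where "D = \<bar>(LINT x|\<gamma>. g x * poly (He q) x) - fact q * c q\<bar>"
  have ig2: "integrable \<gamma> (\<lambda>x. (g x - poly (P m) x)\<^sup>2)" for m
  proof -
    have "integrable \<gamma> (\<lambda>x. (g x)\<^sup>2 - 2 * (g x * poly (P m) x) + poly (P m) x * poly (P m) x)"
      using Lp_gauss_2D(2)[OF g] integrable_gauss_mult_poly[OF g] integrable_gauss_poly_mult[of "P m" "P m"] by simp
    moreover have "(g x - poly (P m) x)\<^sup>2 = (g x)\<^sup>2 - 2 * (g x * poly (P m) x) + poly (P m) x * poly (P m) x" for x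
      by (simp add: power2_eq_square algebra_simps)
    ultimately show ?thesis by (simp only:)
  qed
  \<comment> \<open>Cauchy-Schwarz in the form \<open>2 u v \<le> t v^2 + u^2 / t\<close> with
    \<open>t\<close> kept free: \<open>m\<close> tends to infinity before \<open>t\<close> is
    chosen.\<close>
  have DD: "2 * D \<le> t * fact q + a m / t" if t: "t > 0" and m: "q \<le> m" for t m
  proof -
    have PP: "(LINT x|\<gamma>. poly (P m) x * poly (He q) x) = fact q * c q"
    proof -
      have "(LINT x|\<gamma>. poly (P m) x * poly (He q) x) = (\<Sum>r\<le>m. c r * (LINT x|\<gamma>. poly (He r) x * poly (He q) x))"
        using integrable_gauss_poly_mult[of "He r" "He q" for r] by (simp add: P sum_distrib_right mult.assoc)
      also have "\<dots> = (\<Sum>r\<le>m. if r = q then c q * fact q else 0)"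
        by (intro sum.cong) (auto simp: hermite_orthogonal)
      finally show ?thesis using m by simp
    qed
    have i: "integrable \<gamma> (\<lambda>x. (g x - poly (P m) x) * poly (He q) x)"
      using integrable_gauss_mult_poly[OF g, of "He q"] integrable_gauss_poly_mult[of "P m" "He q"]
      by (simp add: left_diff_distrib)
    have "D = \<bar>LINT x|\<gamma>. (g x - poly (P m) x) * poly (He q) x\<bar>"
      unfolding D_def using integrable_gauss_mult_poly[OF g, of "He q"] integrable_gauss_poly_mult[of "P m" "He q"] PP
      by (simp add: left_diff_distrib)
    also have "\<dots> \<le> (LINT x|\<gamma>. \<bar>(g x - poly (P m) x) * poly (He q) x\<bar>)"
      using integral_norm_bound[of \<gamma> "\<lambda>x. (g x - poly (P m) x) * poly (He q) x"] unfolding real_norm_def .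
    finally have "2 * D \<le> 2 * (LINT x|\<gamma>. \<bar>(g x - poly (P m) x) * poly (He q) x\<bar>)" by simp
    also have "\<dots> = (LINT x|\<gamma>. 2 * \<bar>(g x - poly (P m) x) * poly (He q) x\<bar>)" by simp
    also have "\<dots> \<le> (LINT x|\<gamma>. t * (poly (He q) x * poly (He q) x) + (g x - poly (P m) x)\<^sup>2 / t)"
    proof (rule integral_mono)
      show "integrable \<gamma> (\<lambda>x. 2 * \<bar>(g x - poly (P m) x) * poly (He q) x\<bar>)" using i by (intro integrable_mult_right integrable_abs)
      show "integrable \<gamma> (\<lambda>x. t * (poly (He q) x * poly (He q) x) + (g x - poly (P m) x)\<^sup>2 / t)"
        using ig2 integrable_gauss_poly_mult[of "He q" "He q"] by simp
      fix x
      define u v where "u = \<bar>g x - poly (P m) x\<bar>" and "v = \<bar>poly (He q) x\<bar>"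
      have "0 \<le> (t * v - u)\<^sup>2 / t" using t by simp
      also have "\<dots> = t * (v * v) + u\<^sup>2 / t - 2 * (u * v)" using t by (simp add: power2_diff divide_simps) (simp add: power2_eq_square algebra_simps)
      finally show "2 * \<bar>(g x - poly (P m) x) * poly (He q) x\<bar> \<le> t * (poly (He q) x * poly (He q) x) + (g x - poly (P m) x)\<^sup>2 / t"
        by (simp add: u_def v_def abs_mult)
    qed
    also have "\<dots> = t * fact q + a m / t"
      using ig2 integrable_gauss_poly_mult[of "He q" "He q"] hermite_orthogonal[of q q] by (simp add: a_def)
    finally show ?thesis .
  qed
  have "2 * D \<le> t * fact q" if t: "t > 0" for t
  proof -
    have "(\<lambda>m. t * fact q + a m / t) \<longlonglongrightarrow> t * fact q + 0 / t" by (intro tendsto_intros a) (use t in simp)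
    then have "2 * D \<le> t * fact q + 0 / t" by (rule LIMSEQ_le_const) (use DD[OF t] in blast)
    then show ?thesis by simp
  qed
  \<comment> \<open>For \<open>t = D / fact q\<close> the inequality reads
    \<open>2 * D \<le> D\<close>, impossible for \<open>D > 0\<close>.\<close>
  from this[of "D / fact q"] have "\<not> D > 0" by auto
  then show ?thesis by (simp add: D_def)
qed

section \<open>Integration by parts for Gaussian processes\<close>

locale gaussian_process = prob_space M for M :: "'a measure" +
  fixes X :: "nat \<Rightarrow> 'a \<Rightarrow> real"
  assumes gaussian: "gaussian_sequence M X"
    and mean_X: "\<And>n. expectation (X n) = 0"
    and var_X: "\<And>n. variance (X n) = 1"
begin

definition cov :: "nat \<Rightarrow> nat \<Rightarrow> real" where
  "cov i j = expectation (\<lambda>\<omega>. X i \<omega> * X j \<omega>)"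

definition lin_comb :: "('a \<Rightarrow> real) \<Rightarrow> bool" where
  "lin_comb L \<longleftrightarrow> (\<exists>I a. finite I \<and> L = (\<lambda>\<omega>. \<Sum>i\<in>I. a i * X i \<omega>))"

text \<open>\<open>gaussian_rv\<close> admits constants; unit variance excludes them for a single
  \<open>X n\<close>, whereas linear combinations may still degenerate.\<close>

lemma distributed_X: "distributed M lborel (X n) std_normal_density"
proof -
  have "gaussian_rv M (\<lambda>\<omega>. \<Sum>i\<in>{n}. 1 * X i \<omega>)"
    using gaussian unfolding gaussian_sequence_def by (elim allE[of _ "{n}"] allE[of _ "\<lambda>_. 1"]) simp
  then have "gaussian_rv M (X n)" by simp
  then obtain \<mu> \<sigma> where
    "(\<sigma> > 0 \<and> distributed M lborel (X n) (\<lambda>x. ennreal (normal_density \<mu> \<sigma> x))) \<or> (AE \<omega> in M. X n \<omega> = \<mu>)"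
    and [measurable]: "X n \<in> borel_measurable M"
    unfolding gaussian_rv_def by blast
  then show ?thesis
  proof (elim disjE conjE)
    assume \<sigma>: "\<sigma> > 0" and d: "distributed M lborel (X n) (\<lambda>x. ennreal (normal_density \<mu> \<sigma> x))"
    have "\<mu> = 0" using normal_distributed_expectation[OF \<sigma> d] mean_X by simp
    moreover have "\<sigma>\<^sup>2 = 1" using normal_distributed_variance[OF \<sigma> d] var_X by simp
    then have "\<sigma> = 1" using \<sigma> by (simp add: power2_eq_1_iff)
    ultimately show ?thesis using d by simp
  next
    assume ae: "AE \<omega> in M. X n \<omega> = \<mu>"
    have "expectation (X n) = expectation (\<lambda>_. \<mu>)"
      using ae by (intro integral_cong_AE) auto
    then have "\<mu> = 0" using mean_X by (simp add: prob_space)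
    then have "variance (X n) = expectation (\<lambda>_. 0)"
      using ae mean_X by (intro integral_cong_AE) auto
    then show ?thesis using var_X by simp
  qed
qed

lemma measurable_X[measurable]: "X n \<in> borel_measurable M"
  using distributed_measurable[OF distributed_X] by simp

lemma distr_X: "distr M borel (X n) = std_normal_distribution"
proof -
  have "distr M lborel (X n) = distr M borel (X n)" by (rule distr_cong) auto
  then show ?thesis using distributed_distr_eq_density[OF distributed_X, of n] by simp
qed

lemma integrable_X_power_abs: "integrable M (\<lambda>\<omega>. \<bar>X n \<omega>\<bar> ^ k)"
  using distributed_integrable[OF distributed_X, of "\<lambda>x. \<bar>x\<bar> ^ k"] integrable_std_normal_moment_abs[of k] by simp

lemma integrable_X: "integrable M (X n)"
  using integrable_X_power_abs[of n 1] by (simp add: integrable_abs_iff)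

lemma integrable_X_sq: "integrable M (\<lambda>\<omega>. (X n \<omega>)\<^sup>2)"
  using integrable_X_power_abs[of n 2] by simp

lemma integrable_growth:
  assumes \<Phi>: "poly_growth \<Phi>"
  shows "integrable M (\<lambda>\<omega>. \<Phi> (\<lambda>j. X j \<omega>))"
proof -
  obtain C N k where C: "C \<ge> 0" and b: "\<And>x. \<bar>\<Phi> x\<bar> \<le> C * (1 + (\<Sum>j\<le>N::nat. \<bar>x j\<bar>)) ^ k"
    by (rule poly_growthE[OF \<Phi> \<Phi>]; rule that)
  have bound: "(1 + (\<Sum>j\<le>N. \<bar>x j\<bar>)) ^ k \<le> real (N + 2) ^ k * (1 + (\<Sum>j\<le>N. \<bar>x j\<bar> ^ k))"
    for x :: "nat \<Rightarrow> real"
  proof -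
    \<comment> \<open>Comparison with the maximum \<open>b\<close> of \<open>1\<close> and the
      \<open>|x j|\<close>: a sum of \<open>N + 2\<close> terms is at most
      \<open>(N + 2) * b\<close>, and \<open>b ^ k\<close> is one of the terms on the right-hand
      side.\<close>
    define b where "b = Max (insert 1 ((\<lambda>j. \<bar>x j\<bar>) ` {..N}))"
    have b1: "1 \<le> b" "\<And>j. j \<le> N \<Longrightarrow> \<bar>x j\<bar> \<le> b" unfolding b_def by (rule Max_ge; simp)+
    have "(\<Sum>j\<le>N. \<bar>x j\<bar>) \<le> (\<Sum>j\<le>N. b)" using b1 by (intro sum_mono) auto
    then have "1 + (\<Sum>j\<le>N. \<bar>x j\<bar>) \<le> real (N + 2) * b" using b1(1) by (simp add: algebra_simps)
    then have "(1 + (\<Sum>j\<le>N. \<bar>x j\<bar>)) ^ k \<le> (real (N + 2) * b) ^ k"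
      by (rule power_mono) (simp add: sum_nonneg)
    also have "\<dots> = real (N + 2) ^ k * b ^ k" by (rule power_mult_distrib)
    also have "\<dots> \<le> real (N + 2) ^ k * (1 + (\<Sum>j\<le>N. \<bar>x j\<bar> ^ k))"
    proof (rule mult_left_mono)
      have "b \<in> insert 1 ((\<lambda>j. \<bar>x j\<bar>) ` {..N})" unfolding b_def by (rule Max_in) auto
      then consider "b = 1" | j where "j \<le> N" "b = \<bar>x j\<bar>" by auto
      then show "b ^ k \<le> 1 + (\<Sum>j\<le>N. \<bar>x j\<bar> ^ k)"
      proof cases
        case 1
        then show ?thesis by (simp add: sum_nonneg)
      next
        case (2 j)
        have "\<bar>x j\<bar> ^ k \<le> (\<Sum>j\<le>N. \<bar>x j\<bar> ^ k)" by (rule member_le_sum) (use 2 in auto)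
        then show ?thesis using 2 by simp
      qed
    qed simp
    finally show ?thesis .
  qed
  show ?thesis
  proof (rule Bochner_Integration.integrable_bound)
    show "integrable M (\<lambda>\<omega>. C * (real (N + 2) ^ k * (1 + (\<Sum>j\<le>N. \<bar>X j \<omega>\<bar> ^ k))))"
      by (intro integrable_mult_right Bochner_Integration.integrable_add Bochner_Integration.integrable_sum
          integrable_X_power_abs) simp
    have "(\<lambda>\<omega> j. X j \<omega>) \<in> measurable M RN" by (rule measurable_RN_I) simp
    then show "(\<lambda>\<omega>. \<Phi> (\<lambda>j. X j \<omega>)) \<in> borel_measurable M"
      using poly_growth_measurable[OF \<Phi>] by (rule measurable_compose)
    show "AE \<omega> in M. norm (\<Phi> (\<lambda>j. X j \<omega>)) \<le> norm (C * (real (N + 2) ^ k * (1 + (\<Sum>j\<le>N. \<bar>X j \<omega>\<bar> ^ k))))"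
    proof (rule AE_I2)
      fix \<omega>
      have "\<bar>\<Phi> (\<lambda>j. X j \<omega>)\<bar> \<le> C * (real (N + 2) ^ k * (1 + (\<Sum>j\<le>N. \<bar>X j \<omega>\<bar> ^ k)))"
        by (rule order_trans[OF b mult_left_mono[OF bound C]])
      then show "norm (\<Phi> (\<lambda>j. X j \<omega>)) \<le> norm (C * (real (N + 2) ^ k * (1 + (\<Sum>j\<le>N. \<bar>X j \<omega>\<bar> ^ k))))"
        unfolding real_norm_def by linarith
    qed
  qed
qed

lemma lin_comb_X: "lin_comb (X n)"
  unfolding lin_comb_def by (intro exI[of _ "{n}"] exI[of _ "\<lambda>_. 1"]) simp

lemma lin_comb_scale: "lin_comb L \<Longrightarrow> lin_comb (\<lambda>\<omega>. c * L \<omega>)"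
proof -
  assume "lin_comb L"
  then obtain I a where "finite I" "L = (\<lambda>\<omega>. \<Sum>i\<in>I. a i * X i \<omega>)" unfolding lin_comb_def by blast
  then show ?thesis unfolding lin_comb_def
    by (intro exI[of _ I] exI[of _ "\<lambda>i. c * a i"]) (simp add: sum_distrib_left mult.assoc)
qed

lemma lin_comb_add:
  assumes "lin_comb L" "lin_comb L'"
  shows "lin_comb (\<lambda>\<omega>. L \<omega> + L' \<omega>)"
proof -
  obtain I a where 1: "finite I" "L = (\<lambda>\<omega>. \<Sum>i\<in>I. a i * X i \<omega>)"
    using assms(1) unfolding lin_comb_def by blast
  obtain J b where 2: "finite J" "L' = (\<lambda>\<omega>. \<Sum>i\<in>J. b i * X i \<omega>)"
    using assms(2) unfolding lin_comb_def by blast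
  have "L \<omega> + L' \<omega> = (\<Sum>i\<in>I \<union> J. ((if i \<in> I then a i else 0) + (if i \<in> J then b i else 0)) * X i \<omega>)" for \<omega>
  proof -
    have "L \<omega> = (\<Sum>i\<in>I \<union> J. (if i \<in> I then a i else 0) * X i \<omega>)"
      unfolding 1(2) using 1 2 by (intro sum.mono_neutral_cong_left) auto
    moreover have "L' \<omega> = (\<Sum>i\<in>I \<union> J. (if i \<in> J then b i else 0) * X i \<omega>)"
      unfolding 2(2) using 1 2 by (intro sum.mono_neutral_cong_left) auto
    ultimately show ?thesis by (simp add: distrib_right sum.distrib)
  qed
  then show ?thesis unfolding lin_comb_def using 1 2
    by (intro exI[of _ "I \<union> J"] exI[of _ "\<lambda>i. (if i \<in> I then a i else 0) + (if i \<in> J then b i else 0)"]) auto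
qed

lemma lin_comb_sum:
  "finite I \<Longrightarrow> (\<And>i. i \<in> I \<Longrightarrow> lin_comb (L i)) \<Longrightarrow> lin_comb (\<lambda>\<omega>. \<Sum>i\<in>I. L i \<omega>)"
proof (induction I rule: finite_induct)
  case empty
  show ?case unfolding lin_comb_def by (intro exI[of _ "{}"]) simp
qed (auto intro: lin_comb_add)

text \<open>A linear combination is centered normal or almost surely \<open>0\<close>, and both
  cases obey the same formula. Joint laws are thereby governed by variances alone.\<close>

lemma
  assumes L: "lin_comb L"
  shows lin_comb_integrable: "integrable M L" "integrable M (\<lambda>\<omega>. (L \<omega>)\<^sup>2)"
    and lin_comb_char: "(LINT \<omega>|M. cis (L \<omega>)) = exp (- expectation (\<lambda>\<omega>. (L \<omega>)\<^sup>2) / 2)"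
proof -
  obtain I a where I: "finite I" and La: "L = (\<lambda>\<omega>. \<Sum>i\<in>I. a i * X i \<omega>)"
    using L unfolding lin_comb_def by blast
  have [measurable]: "L \<in> borel_measurable M" unfolding La by measurable
  have g: "poly_growth (\<lambda>x. \<Sum>i\<in>I. a i * x i)" by (intro poly_growth_intros)
  show "integrable M L" unfolding La using integrable_growth[OF g] .
  show "integrable M (\<lambda>\<omega>. (L \<omega>)\<^sup>2)" unfolding La using integrable_growth[OF poly_growth_power[OF g]] .
  have mean: "expectation L = 0" unfolding La by (simp add: integrable_X mean_X)
  have "gaussian_rv M L" using gaussian I unfolding gaussian_sequence_def La by blast
  then obtain \<mu> \<sigma> where
    "(\<sigma> > 0 \<and> distributed M lborel L (\<lambda>x. ennreal (normal_density \<mu> \<sigma> x))) \<or> (AE \<omega> in M. L \<omega> = \<mu>)"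
    unfolding gaussian_rv_def by blast
  then show "(LINT \<omega>|M. cis (L \<omega>)) = exp (- expectation (\<lambda>\<omega>. (L \<omega>)\<^sup>2) / 2)"
  proof (elim disjE conjE)
    assume \<sigma>: "\<sigma> > 0" and d: "distributed M lborel L (\<lambda>x. ennreal (normal_density \<mu> \<sigma> x))"
    have \<mu>: "\<mu> = 0" using normal_distributed_expectation[OF \<sigma> d] mean by simp
    have v: "\<sigma>\<^sup>2 = expectation (\<lambda>\<omega>. (L \<omega>)\<^sup>2)" using normal_distributed_variance[OF \<sigma> d] mean by simp
    have s: "distributed M lborel (\<lambda>\<omega>. (L \<omega> - 0) / \<sigma>) std_normal_density"
      using normal_standard_normal_convert[OF \<sigma>, of L 0] d \<mu> by simp
    have "distr M lborel (\<lambda>\<omega>. L \<omega> / \<sigma>) = distr M borel (\<lambda>\<omega>. L \<omega> / \<sigma>)" by (rule distr_cong) auto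
    then have ds: "distr M borel (\<lambda>\<omega>. L \<omega> / \<sigma>) = std_normal_distribution"
      using distributed_distr_eq_density[OF s] by simp
    have "(LINT \<omega>|M. cis (L \<omega>)) = (LINT \<omega>|M. cis (\<sigma> * (L \<omega> / \<sigma>)))" using \<sigma> by simp
    also have "\<dots> = char (distr M borel (\<lambda>\<omega>. L \<omega> / \<sigma>)) \<sigma>"
      unfolding char_def by (subst integral_distr) (auto simp: cis_conv_exp)
    also have "\<dots> = exp (- \<sigma>\<^sup>2 / 2)" unfolding ds char_std_normal_distribution by simp
    finally show ?thesis using v by simp
  next
    assume ae: "AE \<omega> in M. L \<omega> = \<mu>"
    have "expectation L = expectation (\<lambda>_. \<mu>)" using ae by (intro integral_cong_AE) auto
    then have \<mu>: "\<mu> = 0" using mean by (simp add: prob_space)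
    have "expectation (\<lambda>\<omega>. (L \<omega>)\<^sup>2) = expectation (\<lambda>_. 0)" using ae \<mu> by (intro integral_cong_AE) auto
    moreover have "(LINT \<omega>|M. cis (L \<omega>)) = (LINT \<omega>|M. cis 0)"
      using ae \<mu> by (intro integral_cong_AE) (auto simp: cis_conv_exp)
    ultimately show ?thesis by (simp add: prob_space)
  qed
qed

lemma integrable_X_mult: "integrable M (\<lambda>\<omega>. X i \<omega> * X j \<omega>)"
  by (rule integrable_growth[of "\<lambda>x. x i * x j"]) (intro poly_growth_intros)

lemma cov_self: "cov i i = 1"
  using var_X[of i] mean_X[of i] by (simp add: cov_def power2_eq_square)

lemma cov_commute: "cov i j = cov j i"
  by (simp add: cov_def mult.commute)

lemma abs_cov_le_1: "\<bar>cov i j\<bar> \<le> 1"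
proof -
  have "\<bar>X i \<omega> * X j \<omega>\<bar> \<le> (X i \<omega> * X i \<omega> + X j \<omega> * X j \<omega>) / 2" for \<omega>
    using sum_squares_bound[of "\<bar>X i \<omega>\<bar>" "\<bar>X j \<omega>\<bar>"] by (simp add: abs_mult power2_eq_square)
  then have "expectation (\<lambda>\<omega>. \<bar>X i \<omega> * X j \<omega>\<bar>) \<le> expectation (\<lambda>\<omega>. (X i \<omega> * X i \<omega> + X j \<omega> * X j \<omega>) / 2)"
    using integrable_X_mult[of i i] integrable_X_mult[of j j]
    by (intro integral_mono) (auto intro!: integrable_abs integrable_X_mult)
  also have "\<dots> = 1"
    using integrable_X_mult[of i i] integrable_X_mult[of j j] cov_self[of i] cov_self[of j]
    by (simp add: cov_def)
  finally show ?thesis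
    unfolding cov_def using integral_norm_bound[of M "\<lambda>\<omega>. X i \<omega> * X j \<omega>"]
    unfolding real_norm_def by linarith
qed

text \<open>The residuals \<open>X j - cov i j X i\<close> are jointly independent of \<open>X i\<close>. Tested against
  characters this is a computation with variances of linear combinations; it is transported to
  indicators one coordinate at a time.\<close>

definition resid :: "nat \<Rightarrow> 'a \<Rightarrow> nat \<Rightarrow> real" where
  "resid i \<omega> j = X j \<omega> - cov i j * X i \<omega>"

lemma measurable_resid_component[measurable]: "(\<lambda>\<omega>. resid i \<omega> j) \<in> borel_measurable M"
  unfolding resid_def by measurable

lemma measurable_resid: "resid i \<in> measurable M RN"
  by (rule measurable_RN_I) simp

lemma lin_comb_resid: "lin_comb (\<lambda>\<omega>. resid i \<omega> j)"
  using lin_comb_add[OF lin_comb_X[of j] lin_comb_scale[OF lin_comb_X[of i], of "- cov i j"]]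
  by (simp add: resid_def)

text \<open>\<open>X i\<close> is uncorrelated with its residuals because
  \<open>cov i i = 1\<close>. So variances add and the characteristic function factorizes.\<close>

lemma char_X_resid:
  assumes "finite J"
  shows "(LINT \<omega>|M. cis (s * X i \<omega> + (\<Sum>j\<in>J. t j * resid i \<omega> j)))
    = complex_of_real (exp (- s\<^sup>2 / 2)) * (LINT \<omega>|M. cis (\<Sum>j\<in>J. t j * resid i \<omega> j))"
proof -
  define T where "T \<omega> = (\<Sum>j\<in>J. t j * resid i \<omega> j)" for \<omega>
  have T: "lin_comb T"
    unfolding T_def by (intro lin_comb_sum assms lin_comb_scale lin_comb_resid)
  have XR: "integrable M (\<lambda>\<omega>. X i \<omega> * resid i \<omega> j)" "expectation (\<lambda>\<omega>. X i \<omega> * resid i \<omega> j) = 0" for j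
  proof -
    have "X i \<omega> * resid i \<omega> j = X i \<omega> * X j \<omega> - cov i j * (X i \<omega> * X i \<omega>)" for \<omega>
      by (simp add: resid_def algebra_simps)
    then show "integrable M (\<lambda>\<omega>. X i \<omega> * resid i \<omega> j)" "expectation (\<lambda>\<omega>. X i \<omega> * resid i \<omega> j) = 0"
      using integrable_X_mult[of i j] integrable_X_mult[of i i] cov_self[of i] by (simp_all add: cov_def)
  qed
  have XT_eq: "X i \<omega> * T \<omega> = (\<Sum>j\<in>J. t j * (X i \<omega> * resid i \<omega> j))" for \<omega>
    unfolding T_def sum_distrib_left by (intro sum.cong) auto
  have XT: "integrable M (\<lambda>\<omega>. X i \<omega> * T \<omega>)" "expectation (\<lambda>\<omega>. X i \<omega> * T \<omega>) = 0"
    unfolding XT_eq using XR by simp_all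
  have "(s * X i \<omega> + T \<omega>)\<^sup>2 = s\<^sup>2 * (X i \<omega>)\<^sup>2 + 2 * s * (X i \<omega> * T \<omega>) + (T \<omega>)\<^sup>2" for \<omega>
    by (simp add: power2_eq_square algebra_simps)
  then have "expectation (\<lambda>\<omega>. (s * X i \<omega> + T \<omega>)\<^sup>2) = s\<^sup>2 + expectation (\<lambda>\<omega>. (T \<omega>)\<^sup>2)"
    using XT integrable_X_sq[of i] lin_comb_integrable(2)[OF T] cov_self[of i]
    by (simp add: cov_def power2_eq_square)
  then have "(LINT \<omega>|M. cis (s * X i \<omega> + T \<omega>)) = exp (- (s\<^sup>2 + expectation (\<lambda>\<omega>. (T \<omega>)\<^sup>2)) / 2)"
    using lin_comb_char[OF lin_comb_add[OF lin_comb_scale[OF lin_comb_X] T], of s i] by simp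
  moreover have "exp (- (s\<^sup>2 + expectation (\<lambda>\<omega>. (T \<omega>)\<^sup>2)) / 2) =
      exp (- s\<^sup>2 / 2) * exp (- expectation (\<lambda>\<omega>. (T \<omega>)\<^sup>2) / 2)"
    by (simp add: exp_add[symmetric] add_divide_distrib diff_divide_distrib)
  ultimately show ?thesis using lin_comb_char[OF T] by (simp only: T_def of_real_mult)
qed

text \<open>Characters are exchanged for indicators in two rounds: in the residuals with the weight
  \<open>cis (s * X i) - exp (- s^2 / 2)\<close>, then in \<open>X i\<close> with the centered
  weight \<open>P - p\<close>.\<close>

lemma X_resid_cylinder:
  assumes J: "finite J" and A: "\<And>j. A j \<in> sets borel" and B: "B \<in> sets borel"
  shows "expectation (\<lambda>\<omega>. (\<Prod>j\<in>J. indicator (A j) (resid i \<omega> j)) * indicator B (X i \<omega>))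
    = expectation (\<lambda>\<omega>. \<Prod>j\<in>J. indicator (A j) (resid i \<omega> j)) * prob (X i -` B \<inter> space M)"
proof -
  note [measurable] = A B
  define P where "P \<omega> = (\<Prod>j\<in>J. indicator (A j) (resid i \<omega> j) :: real)" for \<omega>
  have [measurable]: "P \<in> borel_measurable M" unfolding P_def by measurable
  have P01: "0 \<le> P \<omega>" "P \<omega> \<le> 1" for \<omega>
    unfolding P_def by (auto intro!: prod_nonneg prod_le_1 simp: indicator_def)
  have intP: "integrable M P" by (rule integrable_const_bound[of _ 1]) (use P01 in auto)
  define p where "p = expectation P"
  have p01: "0 \<le> p" "p \<le> 1"
  proof -
    show "0 \<le> p" unfolding p_def using P01 by simp
    have "p \<le> expectation (\<lambda>_. 1)" unfolding p_def using intP P01 by (intro integral_mono) auto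
    then show "p \<le> 1" by (simp add: prob_space)
  qed
  have cis_m[measurable]: "(\<lambda>\<omega>. cis (f \<omega>)) \<in> borel_measurable M" if "f \<in> borel_measurable M" for f
    using that unfolding cis_conv_exp by measurable
  have char: "(LINT \<omega>|M. complex_of_real (P \<omega> - p) * cis (s * X i \<omega>)) = 0" for s
  proof -
    have 1: "(LINT \<omega>|M. (cis (s * X i \<omega>) - of_real (exp (- s\<^sup>2 / 2))) * (\<Prod>j\<in>J. indicator (A j) (resid i \<omega> j))) = 0"
    proof (rule weight_char_zero_finite[OF J])
      show "(LINT \<omega>|M. (cis (s * X i \<omega>) - of_real (exp (- s\<^sup>2 / 2))) * cis (\<Sum>j\<in>J. t j * resid i \<omega> j)) = 0" for t
      proof -
        have "(LINT \<omega>|M. (cis (s * X i \<omega>) - of_real (exp (- s\<^sup>2 / 2))) * cis (\<Sum>j\<in>J. t j * resid i \<omega> j))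
          = (LINT \<omega>|M. cis (s * X i \<omega> + (\<Sum>j\<in>J. t j * resid i \<omega> j))
              - of_real (exp (- s\<^sup>2 / 2)) * cis (\<Sum>j\<in>J. t j * resid i \<omega> j))"
          by (simp add: left_diff_distrib cis_mult)
        also have "\<dots> = 0"
          by (subst Bochner_Integration.integral_diff)
            (auto intro!: integrable_cis integrable_mult_right simp: char_X_resid[OF J] simp del: of_real_exp)
        finally show ?thesis .
      qed
      show "norm (cis (s * X i \<omega>) - of_real (exp (- s\<^sup>2 / 2))) \<le> 2" for \<omega>
        by (rule order_trans[OF norm_triangle_ineq4]) simp
    qed (use A in \<open>auto\<close>)
    have P_c: "(\<Prod>j\<in>J. indicator (A j) (resid i \<omega> j) :: complex) = of_real (P \<omega>)" for \<omega>
      unfolding P_def of_real_prod by (intro prod.cong) (auto simp: indicator_def)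
    have c: "(LINT \<omega>|M. cis (s * X i \<omega>)) = complex_of_real (exp (- s\<^sup>2 / 2))"
      using char_X_resid[of "{}" s i] by (simp add: prob_space)
    have ic: "integrable M (\<lambda>\<omega>. cis (s * X i \<omega>))" by (rule integrable_cis) simp
    have iPc: "integrable M (\<lambda>\<omega>. complex_of_real (P \<omega>) * cis (s * X i \<omega>))"
      by (rule integrable_mult_bounded[where B=1]) (use intP in auto)
    have "0 = (LINT \<omega>|M. of_real (P \<omega>) * cis (s * X i \<omega>) - of_real (exp (- s\<^sup>2 / 2)) * of_real (P \<omega>))"
      using 1 by (simp add: P_c algebra_simps)
    also have "\<dots> = (LINT \<omega>|M. of_real (P \<omega>) * cis (s * X i \<omega>)) - of_real (exp (- s\<^sup>2 / 2)) * of_real p"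
      using iPc intP by (simp add: p_def integral_complex_of_real)
    finally have 2: "(LINT \<omega>|M. of_real (P \<omega>) * cis (s * X i \<omega>)) = of_real (exp (- s\<^sup>2 / 2)) * of_real p" by simp
    have "(LINT \<omega>|M. complex_of_real (P \<omega> - p) * cis (s * X i \<omega>))
        = (LINT \<omega>|M. of_real (P \<omega>) * cis (s * X i \<omega>) - of_real p * cis (s * X i \<omega>))"
      by (simp add: left_diff_distrib)
    also have "\<dots> = 0" using iPc ic 2 c by simp
    finally show ?thesis .
  qed
  have "(LINT \<omega>|M. (P \<omega> - p) * indicator B (X i \<omega>)) = 0"
  proof (rule real_weight_char_zero[OF _ _ _ char B])
    show "\<bar>P \<omega> - p\<bar> \<le> 1" for \<omega> using P01[of \<omega>] p01 by linarith
  qed simp_all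
  moreover have "integrable M (\<lambda>\<omega>. P \<omega> * indicator B (X i \<omega>))"
    by (rule integrable_mult_bounded[where B=1]) (use intP in \<open>auto simp: indicator_def\<close>)
  moreover have iB: "integrable M (\<lambda>\<omega>. indicator B (X i \<omega>) :: real)"
    by (rule integrable_const_bound[of _ 1]) auto
  moreover have "expectation (\<lambda>\<omega>. indicator B (X i \<omega>) :: real) = prob (X i -` B \<inter> space M)"
  proof -
    have "expectation (\<lambda>\<omega>. indicator B (X i \<omega>) :: real) = expectation (indicator (X i -` B \<inter> space M))"
      by (intro Bochner_Integration.integral_cong) (auto simp: indicator_def)
    then show ?thesis by simp
  qed
  ultimately show ?thesis by (simp add: P_def[symmetric] p_def[symmetric] left_diff_distrib)
qed

lemma distr_resid_X:
  "distr M (RN \<Otimes>\<^sub>M borel) (\<lambda>\<omega>. (resid i \<omega>, X i \<omega>)) = distr M RN (resid i) \<Otimes>\<^sub>M distr M borel (X i)"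
proof (rule pair_measure_eqI[symmetric])
  interpret R: prob_space "distr M RN (resid i)" by (rule prob_space_distr[OF measurable_resid])
  interpret X: prob_space "distr M borel (X i)" by (rule prob_space_distr) simp
  show "sigma_finite_measure (distr M RN (resid i))" "sigma_finite_measure (distr M borel (X i))"
    by unfold_locales
  show "sets (distr M RN (resid i) \<Otimes>\<^sub>M distr M borel (X i)) = sets (distr M (RN \<Otimes>\<^sub>M borel) (\<lambda>\<omega>. (resid i \<omega>, X i \<omega>)))"
    by (simp cong: sets_pair_measure_cong)
  note [measurable] = measurable_resid
  fix A B assume "A \<in> sets (distr M RN (resid i))" and "B \<in> sets (distr M borel (X i))"
  then have A: "A \<in> sets RN" and B[measurable]: "B \<in> sets borel" by simp_all
  define E where "E = X i -` B \<inter> space M"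
  have E[measurable]: "E \<in> sets M" unfolding E_def by measurable
  \<comment> \<open>For fixed \<open>B\<close> both sides are finite measures in \<open>A\<close> on
    the sequence space, so agreement on cylinders suffices. \<open>Q\<close> is the law of the
    residuals restricted to the event \<open>E\<close>, \<open>Q'\<close> is their law scaled by the
    probability of \<open>E\<close>.\<close>
  define Q where "Q = distr (density M (indicator E)) RN (resid i)"
  define Q' where "Q' = density (distr M RN (resid i)) (\<lambda>_. emeasure M E)"
  have Q_eq: "emeasure Q A' = emeasure M ((resid i -` A' \<inter> space M) \<inter> E)" if [measurable]: "A' \<in> sets RN" for A'
  proof -
    have "emeasure Q A' = emeasure (density M (indicator E)) (resid i -` A' \<inter> space M)"
      unfolding Q_def by (subst emeasure_distr) auto
    also have "\<dots> = emeasure M ((resid i -` A' \<inter> space M) \<inter> E)"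
      by (subst emeasure_density) (auto simp: nn_integral_indicator[symmetric] indicator_inter_arith[symmetric] mult.commute
          intro!: nn_integral_cong simp del: nn_integral_indicator split: split_indicator)
    finally show ?thesis .
  qed
  have Q'_eq: "emeasure Q' A' = emeasure M (resid i -` A' \<inter> space M) * emeasure M E" if [measurable]: "A' \<in> sets RN" for A'
    unfolding Q'_def by (subst emeasure_density) (auto simp: emeasure_distr nn_integral_cmult_indicator, simp add: mult.commute)
  have "Q = Q'"
  proof (rule measure_eqI_PiM_infinite)
    show "sets Q = sets RN" "sets Q' = sets RN" by (simp_all add: Q_def Q'_def)
    show "finite_measure Q"
      by (rule finite_measureI)
        (use Q_eq[of "space RN"] in \<open>auto simp: Q_def emeasure_eq_measure\<close>)
    fix A :: "nat \<Rightarrow> real set" and J :: "nat set" assume J: "finite J" and "\<And>j. j \<in> J \<Longrightarrow> A j \<in> sets borel"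
    \<comment> \<open>The whole line outside \<open>J\<close>, since the cylinder lemma asks for a
      Borel set at every index.\<close>
    define A' where "A' j = (if j \<in> J then A j else UNIV)" for j
    have A': "A' j \<in> sets borel" for j using \<open>\<And>j. j \<in> J \<Longrightarrow> A j \<in> sets borel\<close> by (simp add: A'_def)
    let ?C = "prod_emb UNIV (\<lambda>_. borel) J (Pi\<^sub>E J A)"
    have C[measurable]: "?C \<in> sets RN"
      using J \<open>\<And>j. j \<in> J \<Longrightarrow> A j \<in> sets borel\<close> by (intro sets_PiM_I) auto
    have mem: "resid i \<omega> \<in> ?C \<longleftrightarrow> (\<forall>j\<in>J. resid i \<omega> j \<in> A' j)" for \<omega>
      by (auto simp: prod_emb_def A'_def PiE_iff restrict_def extensional_def)
    have ind: "indicator (resid i -` ?C \<inter> space M) \<omega> = (\<Prod>j\<in>J. indicator (A' j) (resid i \<omega> j) :: real)"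
      if "\<omega> \<in> space M" for \<omega>
    proof (cases "\<forall>j\<in>J. resid i \<omega> j \<in> A' j")
      case True
      then show ?thesis using mem that by (auto intro!: prod.neutral[symmetric])
    next
      case False
      then have "\<exists>j\<in>J. indicator (A' j) (resid i \<omega> j) = (0::real)" by (auto simp: indicator_def)
      then show ?thesis using mem J False by (simp add: prod_zero_iff)
    qed
    have "measure M ((resid i -` ?C \<inter> space M) \<inter> E) = measure M (resid i -` ?C \<inter> space M) * measure M E"
    proof -
      have "measure M ((resid i -` ?C \<inter> space M) \<inter> E) = expectation (indicator ((resid i -` ?C \<inter> space M) \<inter> E))"
        by simp
      also have "\<dots> = expectation (\<lambda>\<omega>. (\<Prod>j\<in>J. indicator (A' j) (resid i \<omega> j)) * indicator B (X i \<omega>))"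
        by (intro Bochner_Integration.integral_cong) (auto simp: ind[symmetric] E_def split: split_indicator)
      also have "\<dots> = expectation (\<lambda>\<omega>. \<Prod>j\<in>J. indicator (A' j) (resid i \<omega> j)) * measure M E"
        unfolding E_def by (rule X_resid_cylinder[OF J A' B])
      also have "expectation (\<lambda>\<omega>. \<Prod>j\<in>J. indicator (A' j) (resid i \<omega> j) :: real) = expectation (indicator (resid i -` ?C \<inter> space M))"
        by (intro Bochner_Integration.integral_cong refl) (rule ind[symmetric])
      finally show ?thesis by simp
    qed
    then show "emeasure Q ?C = emeasure Q' ?C"
      by (simp add: Q_eq Q'_eq C emeasure_eq_measure ennreal_mult)
  qed
  then have "emeasure M ((resid i -` A \<inter> space M) \<inter> E) = emeasure M (resid i -` A \<inter> space M) * emeasure M E"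
    using Q_eq[OF A] Q'_eq[OF A] by simp
  moreover have "(\<lambda>\<omega>. (resid i \<omega>, X i \<omega>)) -` (A \<times> B) \<inter> space M = (resid i -` A \<inter> space M) \<inter> E"
    by (auto simp: E_def)
  ultimately show "emeasure (distr M RN (resid i)) A * emeasure (distr M borel (X i)) B
      = emeasure (distr M (RN \<Otimes>\<^sub>M borel) (\<lambda>\<omega>. (resid i \<omega>, X i \<omega>))) (A \<times> B)"
    using A B by (simp add: emeasure_distr E_def)
qed

text \<open>With the residuals frozen, a change of \<open>X i\<close> moves the whole sequence in
  the direction \<open>cov i\<close>. By independence and Fubini the one-dimensional identity can be
  applied for each value \<open>r\<close> of the residuals.\<close>

lemma integration_by_parts:
  assumes D: "dir_deriv (cov i) \<Phi> \<Phi>'"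
  shows "expectation (\<lambda>\<omega>. X i \<omega> * \<Phi> (\<lambda>j. X j \<omega>)) = expectation (\<lambda>\<omega>. \<Phi>' (\<lambda>j. X j \<omega>))"
proof -
  note [measurable] = measurable_resid
  define \<R> where "\<R> = distr M RN (resid i)"
  interpret R: prob_space \<R> unfolding \<R>_def by (rule prob_space_distr[OF measurable_resid])
  interpret N: prob_space "distr M borel (X i)" by (rule prob_space_distr) simp
  interpret RX: pair_sigma_finite \<R> "distr M borel (X i)" ..
  have X_eq: "(\<lambda>j. X j \<omega>) = (\<lambda>j. resid i \<omega> j + X i \<omega> * cov i j)" for \<omega>
    by (simp add: resid_def fun_eq_iff mult.commute)
  have shift: "(\<lambda>(r, s). (\<lambda>j. r j + s * cov i j)) \<in> measurable (RN \<Otimes>\<^sub>M borel) RN"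
  proof (rule measurable_RN_I)
    fix j
    have [measurable]: "(\<lambda>x. fst x j) \<in> borel_measurable (RN \<Otimes>\<^sub>M borel)"
      by (rule measurable_compose[OF measurable_fst measurable_RN_component])
    have "(\<lambda>x. fst x j + snd x * cov i j) \<in> borel_measurable (RN \<Otimes>\<^sub>M borel)" by measurable
    then show "(\<lambda>\<omega>. (case \<omega> of (r, s) \<Rightarrow> \<lambda>j. r j + s * cov i j) j) \<in> borel_measurable (RN \<Otimes>\<^sub>M borel)"
      by (simp add: case_prod_beta)
  qed
  have fubini: "expectation (\<lambda>\<omega>. f (X i \<omega>) * \<Psi> (\<lambda>j. X j \<omega>))
      = (LINT r|\<R>. LINT s|distr M borel (X i). f s * \<Psi> (\<lambda>j. r j + s * cov i j))"
    if \<Psi>: "poly_growth \<Psi>" and [measurable]: "f \<in> borel_measurable borel"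
      and int: "integrable M (\<lambda>\<omega>. f (X i \<omega>) * \<Psi> (\<lambda>j. X j \<omega>))" for \<Psi> f
  proof -
    define h where "h = (\<lambda>(r, s). f s * \<Psi> (\<lambda>j. r j + s * cov i j))"
    have [measurable]: "(\<lambda>(r, s). \<Psi> (\<lambda>j. r j + s * cov i j)) \<in> borel_measurable (RN \<Otimes>\<^sub>M borel)"
      using measurable_compose[OF shift poly_growth_measurable[OF \<Psi>]] by (simp add: case_prod_beta)
    have hm: "h \<in> borel_measurable (RN \<Otimes>\<^sub>M borel)" 
    proof -
      have "(\<lambda>x. f (snd x) * (case x of (r, s) \<Rightarrow> \<Psi> (\<lambda>j. r j + s * cov i j))) \<in> borel_measurable (RN \<Otimes>\<^sub>M borel)"
        by measurable
      then show ?thesis by (simp add: h_def case_prod_beta)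
    qed
    have h_eq: "f (X i \<omega>) * \<Psi> (\<lambda>j. X j \<omega>) = h (resid i \<omega>, X i \<omega>)" for \<omega>
      unfolding h_def by (subst X_eq) simp
    have pm: "(\<lambda>\<omega>. (resid i \<omega>, X i \<omega>)) \<in> measurable M (RN \<Otimes>\<^sub>M borel)" by measurable
    have "integrable (distr M (RN \<Otimes>\<^sub>M borel) (\<lambda>\<omega>. (resid i \<omega>, X i \<omega>))) h"
      using int by (subst integrable_distr_eq[OF pm hm]) (simp add: h_eq)
    then have i: "integrable (\<R> \<Otimes>\<^sub>M distr M borel (X i)) h" by (simp add: distr_resid_X \<R>_def)
    have "expectation (\<lambda>\<omega>. f (X i \<omega>) * \<Psi> (\<lambda>j. X j \<omega>)) = expectation (\<lambda>\<omega>. h (resid i \<omega>, X i \<omega>))"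
      by (simp add: h_eq)
    also have "\<dots> = integral\<^sup>L (distr M (RN \<Otimes>\<^sub>M borel) (\<lambda>\<omega>. (resid i \<omega>, X i \<omega>))) h"
      by (rule integral_distr[OF pm hm, symmetric])
    also have "\<dots> = integral\<^sup>L (\<R> \<Otimes>\<^sub>M distr M borel (X i)) h" by (simp add: distr_resid_X \<R>_def)
    also have "\<dots> = (LINT r|\<R>. LINT s|distr M borel (X i). h (r, s))"
      by (rule RX.integral_fst'[OF i, symmetric])
    finally show ?thesis by (simp add: h_def)
  qed
  note pg = dir_derivD(1,2)[OF D]
  have inner: "(LINT s|distr M borel (X i). s * \<Phi> (\<lambda>j. r j + s * cov i j))
      = (LINT s|distr M borel (X i). 1 * \<Phi>' (\<lambda>j. r j + s * cov i j))" for r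
  proof -
    obtain C N k where C: "C \<ge> 0" and b: "\<And>x. \<bar>\<Phi> x\<bar> \<le> C * (1 + (\<Sum>j\<le>N::nat. \<bar>x j\<bar>)) ^ k"
      "\<And>x. \<bar>\<Phi>' x\<bar> \<le> C * (1 + (\<Sum>j\<le>N. \<bar>x j\<bar>)) ^ k"
      by (rule poly_growthE[OF pg]; rule that)
    \<comment> \<open>The growth constant may depend on \<open>r\<close>, because the
      one-dimensional identity is applied for each \<open>r\<close> separately.\<close>
    define K where "K = 1 + (\<Sum>j\<le>N. \<bar>r j\<bar>) + (\<Sum>j\<le>N. \<bar>cov i j\<bar>)"
    have K: "1 + (\<Sum>j\<le>N. \<bar>r j + s * cov i j\<bar>) \<le> K * (1 + \<bar>s\<bar>)" for s
    proof -
      have "(\<Sum>j\<le>N. \<bar>r j + s * cov i j\<bar>) \<le> (\<Sum>j\<le>N. \<bar>r j\<bar> + \<bar>s\<bar> * \<bar>cov i j\<bar>)"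
        by (intro sum_mono) (metis abs_mult abs_triangle_ineq)
      also have "\<dots> = (\<Sum>j\<le>N. \<bar>r j\<bar>) + \<bar>s\<bar> * (\<Sum>j\<le>N. \<bar>cov i j\<bar>)"
        by (simp add: sum.distrib sum_distrib_left)
      finally have 1: "(\<Sum>j\<le>N. \<bar>r j + s * cov i j\<bar>) \<le> (\<Sum>j\<le>N. \<bar>r j\<bar>) + \<bar>s\<bar> * (\<Sum>j\<le>N. \<bar>cov i j\<bar>)" .
      have 2: "0 \<le> \<bar>s\<bar> * (\<Sum>j\<le>N. \<bar>r j\<bar>)" "0 \<le> (\<Sum>j\<le>N. \<bar>cov i j\<bar>)" "0 \<le> \<bar>s\<bar>" by (simp_all add: sum_nonneg)
      have "K * (1 + \<bar>s\<bar>) = 1 + (\<Sum>j\<le>N. \<bar>r j\<bar>) + (\<Sum>j\<le>N. \<bar>cov i j\<bar>) + \<bar>s\<bar>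
          + \<bar>s\<bar> * (\<Sum>j\<le>N. \<bar>r j\<bar>) + \<bar>s\<bar> * (\<Sum>j\<le>N. \<bar>cov i j\<bar>)"
        by (simp add: K_def algebra_simps)
      then show ?thesis using 1 2 by linarith
    qed
    have bK: "C * (1 + (\<Sum>j\<le>N. \<bar>r j + s * cov i j\<bar>)) ^ k \<le> C * K ^ k * (1 + \<bar>s\<bar>) ^ k" for s
      unfolding mult.assoc power_mult_distrib[symmetric]
      by (intro mult_left_mono power_mono K C) (simp add: sum_nonneg)
    have "(LINT s|lborel. std_normal_density s * (s * \<Phi> (\<lambda>j. r j + s * cov i j)))
      = (LINT s|lborel. std_normal_density s * \<Phi>' (\<lambda>j. r j + s * cov i j))"
      by (rule normal_integration_by_parts[OF dir_derivD(3)[OF D] dir_derivD(4)[OF D]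
            order_trans[OF b(1) bK] order_trans[OF b(2) bK]])
    moreover have "(\<lambda>s. \<Phi> (\<lambda>j. r j + s * cov i j)) \<in> borel_measurable borel"
      "(\<lambda>s. \<Phi>' (\<lambda>j. r j + s * cov i j)) \<in> borel_measurable borel"
      by (intro borel_measurable_continuous_onI dir_derivD(4,5)[OF D])+
    ultimately show ?thesis
      unfolding distr_X by (simp add: integral_density)
  qed
  have "expectation (\<lambda>\<omega>. X i \<omega> * \<Phi> (\<lambda>j. X j \<omega>)) = (LINT r|\<R>. LINT s|distr M borel (X i). s * \<Phi> (\<lambda>j. r j + s * cov i j))"
    by (rule fubini[of \<Phi> "\<lambda>x. x"])
      (simp_all add: pg integrable_growth[of "\<lambda>x. x i * \<Phi> x"] poly_growth_intros)
  also have "\<dots> = (LINT r|\<R>. LINT s|distr M borel (X i). 1 * \<Phi>' (\<lambda>j. r j + s * cov i j))"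
    by (simp only: inner)
  also have "\<dots> = expectation (\<lambda>\<omega>. 1 * \<Phi>' (\<lambda>j. X j \<omega>))"
    by (rule fubini[of \<Phi>' "\<lambda>x. 1", symmetric]) (auto intro: pg integrable_growth)
  finally show ?thesis by simp
qed

text \<open>In the derivative of the product, the factor \<open>He q\<close> contributes
  \<open>cov i i * pderiv (He q)\<close> with \<open>cov i i = 1\<close>; this cancels the
  correction term of the raising recursion.\<close>

lemma hermite_integration_by_parts:
  assumes D: "dir_deriv (cov i) \<Phi> \<Phi>'"
  shows "expectation (\<lambda>\<omega>. poly (He (Suc q)) (X i \<omega>) * \<Phi> (\<lambda>j. X j \<omega>))
    = expectation (\<lambda>\<omega>. poly (He q) (X i \<omega>) * \<Phi>' (\<lambda>j. X j \<omega>))"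
proof -
  note pg = dir_derivD(1,2)[OF D]
  have D2: "dir_deriv (cov i) (\<lambda>x. poly (He q) (x i) * \<Phi> x)
      (\<lambda>x. cov i i * poly (pderiv (He q)) (x i) * \<Phi> x + poly (He q) (x i) * \<Phi>' x)"
    by (rule dir_deriv_mult[OF dir_deriv_poly_component D])
  have i1: "integrable M (\<lambda>\<omega>. X i \<omega> * (poly (He q) (X i \<omega>) * \<Phi> (\<lambda>j. X j \<omega>)))"
    by (rule integrable_growth[of "\<lambda>x. x i * (poly (He q) (x i) * \<Phi> x)"]) (intro poly_growth_intros pg)
  have i2: "integrable M (\<lambda>\<omega>. poly (pderiv (He q)) (X i \<omega>) * \<Phi> (\<lambda>j. X j \<omega>))"
    by (rule integrable_growth[of "\<lambda>x. poly (pderiv (He q)) (x i) * \<Phi> x"]) (intro poly_growth_intros pg)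
  have i3: "integrable M (\<lambda>\<omega>. poly (He q) (X i \<omega>) * \<Phi>' (\<lambda>j. X j \<omega>))"
    by (rule integrable_growth[of "\<lambda>x. poly (He q) (x i) * \<Phi>' x"]) (intro poly_growth_intros pg)
  have "poly (He (Suc q)) (X i \<omega>) * \<Phi> (\<lambda>j. X j \<omega>) = X i \<omega> * (poly (He q) (X i \<omega>) * \<Phi> (\<lambda>j. X j \<omega>))
      - poly (pderiv (He q)) (X i \<omega>) * \<Phi> (\<lambda>j. X j \<omega>)" for \<omega>
    by (simp add: algebra_simps)
  then show ?thesis
    using integration_by_parts[OF D2] i1 i2 i3 by (simp add: cov_self del: He.simps)
qed

end

section \<open>Mixed moments of Hermite polynomials\<close>

text \<open>Integration by parts removes a pair of factors from \<open>E(\<Prod> H\<^bsub>q a\<^esub>(X\<^bsub>\<kappa> a\<^esub>))\<close>.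
  The resulting recursion determines the moment (it is the diagram formula), and comparing two
  solutions by induction on the total degree replaces the counting of diagrams.\<close>

definition dec2 :: "nat \<Rightarrow> nat \<Rightarrow> (nat \<Rightarrow> nat) \<Rightarrow> nat \<Rightarrow> nat" where
  "dec2 a b q = q(a := q a - 1, b := q b - 1)"

text \<open>The recursion is required at every factor of positive degree, so a proof may start from
  whichever factor suits it. Partners of degree \<open>0\<close> drop out through
  \<open>real (q b)\<close>, so the truncated subtraction in \<open>dec2\<close> is
  harmless.\<close>

definition moment_rec :: "nat set \<Rightarrow> (nat \<Rightarrow> nat \<Rightarrow> real) \<Rightarrow> ((nat \<Rightarrow> nat) \<Rightarrow> real) \<Rightarrow> bool" where
  "moment_rec B r E \<longleftrightarrow> (\<forall>q. (\<forall>a\<in>B. q a = 0) \<longrightarrow> E q = 1) \<and>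
     (\<forall>q. \<forall>a\<in>B. 0 < q a \<longrightarrow> E q = (\<Sum>b\<in>B - {a}. r a b * real (q b) * E (dec2 a b q)))"

lemma moment_recD:
  assumes "moment_rec B r E"
  shows "(\<And>a. a \<in> B \<Longrightarrow> q a = 0) \<Longrightarrow> E q = 1"
    and "a \<in> B \<Longrightarrow> 0 < q a \<Longrightarrow> E q = (\<Sum>b\<in>B - {a}. r a b * real (q b) * E (dec2 a b q))"
  using assms unfolding moment_rec_def by blast+

lemma sum_dec2_less:
  assumes "finite B" "a \<in> B" "0 < q a"
  shows "(\<Sum>c\<in>B. dec2 a b q c) < (\<Sum>c\<in>B. q c)"
  using assms by (intro sum_strict_mono_ex1) (auto simp: dec2_def intro!: bexI[of _ a])

text \<open>The total degree over \<open>B\<close> drops even if the partner \<open>b\<close> has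
  degree \<open>0\<close> already, because \<open>q a\<close> is positive.\<close>

lemma degree_induct [consumes 1, case_names zero step]:
  fixes q :: "nat \<Rightarrow> nat"
  assumes "finite B"
    and zero: "\<And>q. (\<And>a. a \<in> B \<Longrightarrow> q a = 0) \<Longrightarrow> P q"
    and step: "\<And>q a. a \<in> B \<Longrightarrow> 0 < q a \<Longrightarrow> (\<And>a b. a \<in> B \<Longrightarrow> 0 < q a \<Longrightarrow> P (dec2 a b q)) \<Longrightarrow> P q"
  shows "P q"
proof (induction "\<Sum>c\<in>B. q c" arbitrary: q rule: less_induct)
  case less
  show ?case
  proof (cases "\<exists>a\<in>B. 0 < q a")
    case True
    then obtain a where "a \<in> B" "0 < q a" by blast
    then show ?thesis by (rule step) (rule less, rule sum_dec2_less[OF \<open>finite B\<close>])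
  next
    case False
    then show ?thesis by (intro zero) auto
  qed
qed

text \<open>In terms of diagrams, \<open>E\<close> weighs each one by the product of its
  correlations and \<open>E1\<close> counts them; \<open>E1\<close> is the common majorant of all
  estimates.\<close>

locale moment_compare =
  fixes B :: "nat set" and r :: "nat \<Rightarrow> nat \<Rightarrow> real" and E E1 :: "(nat \<Rightarrow> nat) \<Rightarrow> real"
  assumes fin: "finite B"
    and E: "moment_rec B r E" and E1: "moment_rec B (\<lambda>_ _. 1) E1"
    and r1: "\<And>a b. \<bar>r a b\<bar> \<le> 1"
begin

lemma E1_nonneg: "0 \<le> E1 q"
  using fin
proof (induction q rule: degree_induct)
  case (zero q)
  then show ?case using moment_recD(1)[OF E1] by simp
next
  case (step q a)
  show ?case unfolding moment_recD(2)[where q=q, OF E1 step(1,2)]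
    by (intro sum_nonneg mult_nonneg_nonneg step) auto
qed

lemma E_le: "\<bar>E q\<bar> \<le> E1 q"
  using fin
proof (induction q rule: degree_induct)
  case (zero q)
  then show ?case using moment_recD(1)[OF E1] moment_recD(1)[OF E] by simp
next
  case (step q a)
  have "\<bar>E q\<bar> \<le> (\<Sum>b\<in>B - {a}. \<bar>r a b * real (q b) * E (dec2 a b q)\<bar>)"
    unfolding moment_recD(2)[where q=q, OF E step(1,2)] by (rule sum_abs)
  also have "\<dots> \<le> (\<Sum>b\<in>B - {a}. 1 * real (q b) * E1 (dec2 a b q))"
    unfolding abs_mult using r1 by (intro sum_mono mult_mono step) auto
  also have "\<dots> = E1 q" by (rule moment_recD(2)[where q=q, OF E1 step(1,2), symmetric])
  finally show ?case .
qed

text \<open>Along kept edges both recursions agree. At the first erased edge the recursion for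
  \<open>E'\<close> breaks off, and the remainder of \<open>E\<close> costs \<open>\<delta>\<close>
  times the majorant. So \<open>\<delta>\<close> is paid once and not for each edge.\<close>

lemma E_diff_le:
  assumes E': "moment_rec B r' E'" and r': "\<And>a b. a \<in> B \<Longrightarrow> b \<in> B \<Longrightarrow> a \<noteq> b \<Longrightarrow> r' a b = r a b \<or> r' a b = 0 \<and> \<bar>r a b\<bar> \<le> \<delta>"
    and \<delta>: "0 \<le> \<delta>"
  shows "\<bar>E q - E' q\<bar> \<le> \<delta> * E1 q"
  using fin
proof (induction q rule: degree_induct)
  case (zero q)
  then have "E q = 1" "E' q = 1" using moment_recD(1)[OF E'] moment_recD(1)[OF E] by simp_all
  then show ?case using \<delta> E1_nonneg by simp
next
  case (step q a)
  have "\<bar>E q - E' q\<bar> = \<bar>\<Sum>b\<in>B - {a}. r a b * real (q b) * E (dec2 a b q) - r' a b * real (q b) * E' (dec2 a b q)\<bar>"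
    unfolding moment_recD(2)[where q=q, OF E step(1,2)] moment_recD(2)[where q=q, OF E' step(1,2)] sum_subtractf ..
  also have "\<dots> \<le> (\<Sum>b\<in>B - {a}. \<bar>r a b * real (q b) * E (dec2 a b q) - r' a b * real (q b) * E' (dec2 a b q)\<bar>)"
    by (rule sum_abs)
  also have "\<dots> \<le> (\<Sum>b\<in>B - {a}. \<delta> * (1 * real (q b) * E1 (dec2 a b q)))"
  proof (rule sum_mono)
    fix b assume b: "b \<in> B - {a}"
    from r'[of a b] b step(1) consider "r' a b = r a b" | "r' a b = 0" "\<bar>r a b\<bar> \<le> \<delta>" by blast
    then show "\<bar>r a b * real (q b) * E (dec2 a b q) - r' a b * real (q b) * E' (dec2 a b q)\<bar>
        \<le> \<delta> * (1 * real (q b) * E1 (dec2 a b q))"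
    proof cases
      case 1
      have "\<bar>r a b * real (q b) * E (dec2 a b q) - r' a b * real (q b) * E' (dec2 a b q)\<bar>
          = \<bar>r a b\<bar> * real (q b) * \<bar>E (dec2 a b q) - E' (dec2 a b q)\<bar>"
        unfolding 1 right_diff_distrib[symmetric] abs_mult by simp
      also have "\<dots> \<le> 1 * real (q b) * (\<delta> * E1 (dec2 a b q))"
        using r1 by (intro mult_mono step) auto
      finally show ?thesis by (simp add: mult_ac)
    next
      case 2
      have "\<bar>r a b * real (q b) * E (dec2 a b q) - r' a b * real (q b) * E' (dec2 a b q)\<bar>
          = \<bar>r a b\<bar> * real (q b) * \<bar>E (dec2 a b q)\<bar>"
        using 2 by (simp add: abs_mult)
      also have "\<dots> \<le> \<delta> * real (q b) * E1 (dec2 a b q)"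
        using 2 \<delta> by (intro mult_mono E_le) auto
      finally show ?thesis by (simp add: mult_ac)
    qed
  qed
  also have "\<dots> = \<delta> * E1 q"
    unfolding moment_recD(2)[where q=q, OF E1 step(1,2)] sum_distrib_left ..
  finally show ?case .
qed

text \<open>Every factor of positive degree has to be paired with another one; \<open>cover L\<close> sums over the
  ways of pairing the factors listed in \<open>L\<close>, one after the other.\<close>

fun cover :: "nat list \<Rightarrow> real" where
  "cover [] = 1"
| "cover (a # L) = (\<Sum>b\<in>B - {a}. \<bar>r a b\<bar> * cover (filter (\<lambda>c. c \<noteq> b) L))"

lemma cover_nonneg: "0 \<le> cover L"
  by (induction L rule: cover.induct) (auto intro!: sum_nonneg mult_nonneg_nonneg)

text \<open>One recursion step is taken at the head of the list and its weight
  \<open>|r a b|\<close> is kept; what remains is absorbed, since each single summand of the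
  recursion for \<open>E1 q\<close> is at most \<open>E1 q\<close>. The partner leaves the list as
  its degree may have dropped to \<open>0\<close>, while the others keep theirs.\<close>

lemma E_le_cover:
  assumes "distinct L" "set L \<subseteq> B" "\<And>a. a \<in> set L \<Longrightarrow> 0 < q a"
  shows "\<bar>E q\<bar> \<le> cover L * E1 q"
  using assms
proof (induction L arbitrary: q rule: cover.induct)
  case 1
  then show ?case using E_le by simp
next
  case (2 a L)
  have a: "a \<in> B" "0 < q a" using 2 by auto
  have "\<bar>E q\<bar> \<le> (\<Sum>b\<in>B - {a}. \<bar>r a b * real (q b) * E (dec2 a b q)\<bar>)"
    unfolding moment_recD(2)[where q=q, OF E a] by (rule sum_abs)
  also have "\<dots> \<le> (\<Sum>b\<in>B - {a}. \<bar>r a b\<bar> * cover (filter (\<lambda>c. c \<noteq> b) L) * (1 * real (q b) * E1 (dec2 a b q)))"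
  proof (rule sum_mono)
    fix b assume b: "b \<in> B - {a}"
    have "\<bar>E (dec2 a b q)\<bar> \<le> cover (filter (\<lambda>c. c \<noteq> b) L) * E1 (dec2 a b q)"
      using 2 b by (intro 2(1)) (auto simp: dec2_def)
    then have "(\<bar>r a b\<bar> * real (q b)) * \<bar>E (dec2 a b q)\<bar> \<le> (\<bar>r a b\<bar> * real (q b)) * (cover (filter (\<lambda>c. c \<noteq> b) L) * E1 (dec2 a b q))"
      by (rule mult_left_mono) simp
    then show "\<bar>r a b * real (q b) * E (dec2 a b q)\<bar> \<le> \<bar>r a b\<bar> * cover (filter (\<lambda>c. c \<noteq> b) L) * (1 * real (q b) * E1 (dec2 a b q))"
      by (simp add: abs_mult mult_ac)
  qed
  also have "\<dots> \<le> (\<Sum>b\<in>B - {a}. \<bar>r a b\<bar> * cover (filter (\<lambda>c. c \<noteq> b) L) * E1 q)"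
  proof (rule sum_mono)
    fix b assume b: "b \<in> B - {a}"
    have "1 * real (q b) * E1 (dec2 a b q) \<le> E1 q"
      unfolding moment_recD(2)[where q=q, OF E1 a]
      by (rule member_le_sum[where f="\<lambda>b. 1 * real (q b) * E1 (dec2 a b q)", OF b])
        (use fin E1_nonneg in auto)
    then show "\<bar>r a b\<bar> * cover (filter (\<lambda>c. c \<noteq> b) L) * (1 * real (q b) * E1 (dec2 a b q))
        \<le> \<bar>r a b\<bar> * cover (filter (\<lambda>c. c \<noteq> b) L) * E1 q"
      by (rule mult_left_mono) (simp add: cover_nonneg)
  qed
  also have "\<dots> = cover (a # L) * E1 q" by (simp add: sum_distrib_right)
  finally show ?case .
qed

end

text \<open>The model of two independent groups: a product of moments solves the recursion in which
  the correlations across the groups are erased. The congruence hypotheses let the moment of the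
  untouched group ignore \<open>dec2\<close>.\<close>

lemma moment_rec_product:
  assumes F: "moment_rec B r E" and G: "moment_rec C r E'" and disj: "B \<inter> C = {}" and fin: "finite B" "finite C"
    and E: "\<And>q q'. (\<And>a. a \<in> B \<Longrightarrow> q a = q' a) \<Longrightarrow> E q = E q'"
    and E': "\<And>q q'. (\<And>a. a \<in> C \<Longrightarrow> q a = q' a) \<Longrightarrow> E' q = E' q'"
  shows "moment_rec (B \<union> C) (\<lambda>a b. if a \<in> B \<longleftrightarrow> b \<in> B then r a b else 0) (\<lambda>q. E q * E' q)"
  unfolding moment_rec_def
proof (intro conjI allI ballI impI)
  fix q :: "nat \<Rightarrow> nat" assume "\<forall>a\<in>B \<union> C. q a = 0"
  then have "E q = 1" "E' q = 1" using moment_recD(1)[OF F] moment_recD(1)[OF G] by auto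
  then show "E q * E' q = 1" by simp
next
  fix q :: "nat \<Rightarrow> nat" and a assume a: "a \<in> B \<union> C" "0 < q a"
  let ?r = "\<lambda>a b. if a \<in> B \<longleftrightarrow> b \<in> B then r a b else 0"
  show "E q * E' q = (\<Sum>b\<in>B \<union> C - {a}. ?r a b * real (q b) * (E (dec2 a b q) * E' (dec2 a b q)))"
  proof (cases "a \<in> B")
    case True
    have "(\<Sum>b\<in>B \<union> C - {a}. ?r a b * real (q b) * (E (dec2 a b q) * E' (dec2 a b q)))
        = (\<Sum>b\<in>B - {a}. r a b * real (q b) * (E (dec2 a b q) * E' (dec2 a b q)))"
      using True fin disj by (intro sum.mono_neutral_cong_right) auto
    also have "\<dots> = (\<Sum>b\<in>B - {a}. r a b * real (q b) * E (dec2 a b q)) * E' q"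
      unfolding sum_distrib_right
    proof (rule sum.cong[OF refl])
      fix b assume "b \<in> B - {a}"
      then have "E' (dec2 a b q) = E' q" using True disj by (intro E') (auto simp: dec2_def)
      then show "r a b * real (q b) * (E (dec2 a b q) * E' (dec2 a b q)) = r a b * real (q b) * E (dec2 a b q) * E' q"
        by simp
    qed
    finally show ?thesis using moment_recD(2)[where q=q, OF F True a(2)] by simp
  next
    case False
    then have aC: "a \<in> C" using a by simp
    have "(\<Sum>b\<in>B \<union> C - {a}. ?r a b * real (q b) * (E (dec2 a b q) * E' (dec2 a b q)))
        = (\<Sum>b\<in>C - {a}. r a b * real (q b) * (E (dec2 a b q) * E' (dec2 a b q)))"
      using False fin disj by (intro sum.mono_neutral_cong_right) auto
    also have "\<dots> = E q * (\<Sum>b\<in>C - {a}. r a b * real (q b) * E' (dec2 a b q))"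
      unfolding sum_distrib_left
    proof (rule sum.cong[OF refl])
      fix b assume "b \<in> C - {a}"
      then have "E (dec2 a b q) = E q" using aC disj by (intro E) (auto simp: dec2_def)
      then show "r a b * real (q b) * (E (dec2 a b q) * E' (dec2 a b q)) = E q * (r a b * real (q b) * E' (dec2 a b q))"
        by simp
    qed
    finally show ?thesis using moment_recD(2)[where q=q, OF G aC a(2)] by simp
  qed
qed

section \<open>Moments of finite Hermite expansions\<close>

definition he_comb :: "nat \<Rightarrow> (nat \<Rightarrow> real) \<Rightarrow> real poly" where
  "he_comb m c = (\<Sum>q\<le>m. smult (c q) (He q))"

lemma poly_he_comb: "poly (he_comb m c) x = (\<Sum>q\<le>m. c q * poly (He q) x)"
  by (simp add: he_comb_def poly_sum)

context gaussian_process
begin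

text \<open>\<open>\<kappa>\<close> assigns a variable to each factor, so factors may share one. The
  constant assignment \<open>\<lambda>_. 0\<close> realizes the case of all correlations equal to
  \<open>1\<close>.\<close>

definition hmoment :: "(nat \<Rightarrow> nat) \<Rightarrow> nat set \<Rightarrow> (nat \<Rightarrow> nat) \<Rightarrow> real" where
  "hmoment \<kappa> B q = expectation (\<lambda>\<omega>. \<Prod>a\<in>B. poly (He (q a)) (X (\<kappa> a) \<omega>))"

lemma integrable_poly_prod: "integrable M (\<lambda>\<omega>. \<Prod>a\<in>B. poly (P a) (X (\<kappa> a) \<omega>))"
  by (rule integrable_growth[of "\<lambda>x. \<Prod>a\<in>B. poly (P a) (x (\<kappa> a))"]) (intro poly_growth_intros)

lemma moment_rec_hmoment:
  assumes "finite B"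
  shows "moment_rec B (\<lambda>a b. cov (\<kappa> a) (\<kappa> b)) (hmoment \<kappa> B)"
  unfolding moment_rec_def
proof (intro conjI allI ballI impI)
  fix q :: "nat \<Rightarrow> nat" assume "\<forall>a\<in>B. q a = 0"
  then show "hmoment \<kappa> B q = 1" by (simp add: hmoment_def prob_space)
next
  fix q :: "nat \<Rightarrow> nat" and a assume a: "a \<in> B" "0 < q a"
  define f where "f b x = poly (He (q b)) (x (\<kappa> b))" for b and x :: "nat \<Rightarrow> real"
  define f' where "f' b x = cov (\<kappa> a) (\<kappa> b) * poly (pderiv (He (q b))) (x (\<kappa> b))" for b and x :: "nat \<Rightarrow> real"
  \<comment> \<open>Only the factor \<open>a\<close> is lowered; the product rule lets the
    derivative along \<open>cov (\<kappa> a)\<close> hit each remaining factor once, which gives the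
    sum over partners \<open>b\<close>.\<close>
  have D: "dir_deriv (cov (\<kappa> a)) (\<lambda>x. \<Prod>b\<in>B - {a}. f b x)
      (\<lambda>x. \<Sum>b\<in>B - {a}. f' b x * (\<Prod>c\<in>B - {a} - {b}. f c x))"
    using assms by (intro dir_deriv_prod) (auto simp: f_def[abs_def] f'_def[abs_def] dir_deriv_poly_component)
  let ?X = "\<lambda>\<omega> j. X j \<omega>"
  have "hmoment \<kappa> B q = expectation (\<lambda>\<omega>. poly (He (Suc (q a - 1))) (X (\<kappa> a) \<omega>) * (\<Prod>b\<in>B - {a}. f b (?X \<omega>)))"
    unfolding hmoment_def f_def using assms a by (subst prod.remove[of B a]) (auto simp del: He.simps)
  also have "\<dots> = expectation (\<lambda>\<omega>. poly (He (q a - 1)) (X (\<kappa> a) \<omega>) *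
      (\<Sum>b\<in>B - {a}. f' b (?X \<omega>) * (\<Prod>c\<in>B - {a} - {b}. f c (?X \<omega>))))"
    by (rule hermite_integration_by_parts[OF D])
  also have "\<dots> = expectation (\<lambda>\<omega>. \<Sum>b\<in>B - {a}. cov (\<kappa> a) (\<kappa> b) * real (q b) *
      (\<Prod>c\<in>B. poly (He (dec2 a b q c)) (X (\<kappa> c) \<omega>)))"
  proof (intro Bochner_Integration.integral_cong refl)
    fix \<omega>
    have "poly (He (q a - 1)) (X (\<kappa> a) \<omega>) * (f' b (?X \<omega>) * (\<Prod>c\<in>B - {a} - {b}. f c (?X \<omega>)))
      = cov (\<kappa> a) (\<kappa> b) * real (q b) * (\<Prod>c\<in>B. poly (He (dec2 a b q c)) (X (\<kappa> c) \<omega>))"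
      if b: "b \<in> B - {a}" for b
    proof -
      have "(\<Prod>c\<in>B. poly (He (dec2 a b q c)) (X (\<kappa> c) \<omega>)) =
          poly (He (q a - 1)) (X (\<kappa> a) \<omega>) * (poly (He (q b - 1)) (X (\<kappa> b) \<omega>) *
            (\<Prod>c\<in>B - {a} - {b}. poly (He (dec2 a b q c)) (X (\<kappa> c) \<omega>)))"
        using assms a b by (subst prod.remove[of B a], simp, simp, subst prod.remove[of "B - {a}" b])
          (auto simp: dec2_def)
      also have "(\<Prod>c\<in>B - {a} - {b}. poly (He (dec2 a b q c)) (X (\<kappa> c) \<omega>)) = (\<Prod>c\<in>B - {a} - {b}. f c (?X \<omega>))"
        by (intro prod.cong) (auto simp: dec2_def f_def)
      finally show ?thesis by (simp add: f'_def pderiv_He mult_ac)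
    qed
    then show "poly (He (q a - 1)) (X (\<kappa> a) \<omega>) * (\<Sum>b\<in>B - {a}. f' b (?X \<omega>) * (\<Prod>c\<in>B - {a} - {b}. f c (?X \<omega>)))
      = (\<Sum>b\<in>B - {a}. cov (\<kappa> a) (\<kappa> b) * real (q b) * (\<Prod>c\<in>B. poly (He (dec2 a b q c)) (X (\<kappa> c) \<omega>)))"
      unfolding sum_distrib_left by (rule sum.cong[OF refl])
  qed
  also have "\<dots> = (\<Sum>b\<in>B - {a}. cov (\<kappa> a) (\<kappa> b) * real (q b) * hmoment \<kappa> B (dec2 a b q))"
    unfolding hmoment_def using integrable_poly_prod[of "\<lambda>c. He (dec2 a b q c)" for b] by simp
  finally show "hmoment \<kappa> B q = (\<Sum>b\<in>B - {a}. cov (\<kappa> a) (\<kappa> b) * real (q b) * hmoment \<kappa> B (dec2 a b q))" .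
qed

lemma moment_compare_hmoment:
  assumes "finite B"
  shows "moment_compare B (\<lambda>a b. cov (\<kappa> a) (\<kappa> b)) (hmoment \<kappa> B) (hmoment (\<lambda>_. 0) B)"
proof
  show "moment_rec B (\<lambda>_ _. 1) (hmoment (\<lambda>_. 0) B)"
    using moment_rec_hmoment[OF assms, of "\<lambda>_. 0"] by (simp add: cov_self)
qed (use assms moment_rec_hmoment abs_cov_le_1 in auto)

lemma expectation_he_comb_prod:
  assumes "finite B"
  shows "expectation (\<lambda>\<omega>. \<Prod>a\<in>B. poly (he_comb m (c a)) (X (\<kappa> a) \<omega>))
    = (\<Sum>q\<in>Pi\<^sub>E B (\<lambda>_. {..m}). (\<Prod>a\<in>B. c a (q a)) * hmoment \<kappa> B q)"
proof -
  have "(\<Prod>a\<in>B. poly (he_comb m (c a)) (X (\<kappa> a) \<omega>)) =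
    (\<Sum>q\<in>Pi\<^sub>E B (\<lambda>_. {..m}). (\<Prod>a\<in>B. c a (q a)) * (\<Prod>a\<in>B. poly (He (q a)) (X (\<kappa> a) \<omega>)))" for \<omega>
    unfolding poly_he_comb using assms by (subst prod_sum_PiE) (auto simp: prod.distrib)
  then show ?thesis
    unfolding hmoment_def
    by (simp add: Bochner_Integration.integral_sum integrable_mult_right integrable_poly_prod[of "\<lambda>a. He (q a)" for q])
qed

text \<open>Carries an inequality between moments over to expansions, term by term. The price is the
  absolute values of the coefficients on the right, which is how \<open>A(g)\<close> enters. Tuples
  with a vanishing coefficient are exempt, so \<open>c 0 = 0\<close> will guarantee positive
  degrees.\<close>

lemma abs_expectation_he_comb_diff:
  assumes "finite B"
    and H: "\<And>q. q \<in> Pi\<^sub>E B (\<lambda>_. {..m}) \<Longrightarrow> (\<And>a. a \<in> B \<Longrightarrow> c a (q a) \<noteq> 0) \<Longrightarrow> \<bar>hmoment \<kappa> B q - D q\<bar> \<le> \<delta> * hmoment (\<lambda>_. 0) B q"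
    and S: "S = (\<Sum>q\<in>Pi\<^sub>E B (\<lambda>_. {..m}). (\<Prod>a\<in>B. c a (q a)) * D q)"
  shows "\<bar>expectation (\<lambda>\<omega>. \<Prod>a\<in>B. poly (he_comb m (c a)) (X (\<kappa> a) \<omega>)) - S\<bar>
    \<le> \<delta> * expectation (\<lambda>\<omega>. \<Prod>a\<in>B. poly (he_comb m (\<lambda>q. \<bar>c a q\<bar>)) (X 0 \<omega>))"
proof -
  have "\<bar>expectation (\<lambda>\<omega>. \<Prod>a\<in>B. poly (he_comb m (c a)) (X (\<kappa> a) \<omega>)) - S\<bar>
     = \<bar>\<Sum>q\<in>Pi\<^sub>E B (\<lambda>_. {..m}). (\<Prod>a\<in>B. c a (q a)) * (hmoment \<kappa> B q - D q)\<bar>"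
    unfolding S expectation_he_comb_prod[OF assms(1)] sum_subtractf[symmetric] right_diff_distrib ..
  also have "\<dots> \<le> (\<Sum>q\<in>Pi\<^sub>E B (\<lambda>_. {..m}). \<bar>(\<Prod>a\<in>B. c a (q a)) * (hmoment \<kappa> B q - D q)\<bar>)"
    by (rule sum_abs)
  also have "\<dots> \<le> (\<Sum>q\<in>Pi\<^sub>E B (\<lambda>_. {..m}). \<delta> * ((\<Prod>a\<in>B. \<bar>c a (q a)\<bar>) * hmoment (\<lambda>_. 0) B q))"
  proof (rule sum_mono)
    fix q assume q: "q \<in> Pi\<^sub>E B (\<lambda>_. {..m})"
    show "\<bar>(\<Prod>a\<in>B. c a (q a)) * (hmoment \<kappa> B q - D q)\<bar> \<le> \<delta> * ((\<Prod>a\<in>B. \<bar>c a (q a)\<bar>) * hmoment (\<lambda>_. 0) B q)"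
    proof (cases "\<forall>a\<in>B. c a (q a) \<noteq> 0")
      case True
      then have "(\<Prod>a\<in>B. \<bar>c a (q a)\<bar>) * \<bar>hmoment \<kappa> B q - D q\<bar> \<le> (\<Prod>a\<in>B. \<bar>c a (q a)\<bar>) * (\<delta> * hmoment (\<lambda>_. 0) B q)"
        by (intro mult_left_mono H q prod_nonneg) auto
      then show ?thesis by (simp add: abs_mult abs_prod mult_ac)
    next
      case False
      then have "(\<Prod>a\<in>B. c a (q a)) = 0" "(\<Prod>a\<in>B. \<bar>c a (q a)\<bar>) = 0" using assms(1) by auto
      then show ?thesis by simp
    qed
  qed
  also have "\<dots> = \<delta> * expectation (\<lambda>\<omega>. \<Prod>a\<in>B. poly (he_comb m (\<lambda>q. \<bar>c a q\<bar>)) (X 0 \<omega>))"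
    unfolding expectation_he_comb_prod[OF assms(1), where \<kappa>="\<lambda>_. 0" and c="\<lambda>a q. \<bar>c a q\<bar>"] sum_distrib_left ..
  finally show ?thesis .
qed

end

lemma sum_PiE_Un:
  fixes f g :: "(nat \<Rightarrow> nat) \<Rightarrow> real"
  assumes disj: "B \<inter> C = {}"
    and f: "\<And>q q'. (\<And>a. a \<in> B \<Longrightarrow> q a = q' a) \<Longrightarrow> f q = f q'"
    and g: "\<And>q q'. (\<And>a. a \<in> C \<Longrightarrow> q a = q' a) \<Longrightarrow> g q = g q'"
  shows "(\<Sum>q\<in>Pi\<^sub>E (B \<union> C) (\<lambda>_. A). f q * g q) = (\<Sum>q\<in>Pi\<^sub>E B (\<lambda>_. A). f q) * (\<Sum>q\<in>Pi\<^sub>E C (\<lambda>_. A). g q)"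
proof -
  have "(\<Sum>q\<in>Pi\<^sub>E (B \<union> C) (\<lambda>_. A). f q * g q) = (\<Sum>(q1, q2)\<in>Pi\<^sub>E B (\<lambda>_. A) \<times> Pi\<^sub>E C (\<lambda>_. A). f q1 * g q2)"
  proof (rule sum.reindex_bij_witness[where j="\<lambda>q. (restrict q B, restrict q C)"
        and i="\<lambda>(q1, q2) a. if a \<in> B then q1 a else if a \<in> C then q2 a else undefined"], goal_cases)
    case (1 q)
    then show ?case by (auto simp: PiE_def extensional_def fun_eq_iff)
  next
    case (2 q)
    then show ?case by (auto simp: PiE_def)
  next
    case (3 b)
    then show ?case using disj by (fastforce simp: PiE_def extensional_def restrict_def fun_eq_iff)
  next
    case (4 b)
    then show ?case using disj by (auto simp: PiE_def extensional_def)
  next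
    case (5 q)
    have "f (restrict q B) = f q" "g (restrict q C) = g q" by (auto intro: f g)
    then show ?case by simp
  qed
  then show ?thesis by (simp add: sum_product sum.cartesian_product)
qed

section \<open>Products of four factors\<close>

definition four :: "'a \<Rightarrow> 'a \<Rightarrow> 'a \<Rightarrow> 'a \<Rightarrow> nat \<Rightarrow> 'a" where
  "four i j k l a = (if a = 0 then i else if a = 1 then j else if a = 2 then k else l)"

lemma four_simps [simp]: "four i j k l 0 = i" "four i j k l (Suc 0) = j" "four i j k l 1 = j"
    "four i j k l 2 = k" "four i j k l 3 = l"
  by (simp_all add: four_def)

context gaussian_process
begin

lemma integrable_poly_mult4:
  "integrable M (\<lambda>\<omega>. poly P (X i \<omega>) * poly Q (X j \<omega>) * poly R (X k \<omega>) * poly S (X l \<omega>))"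
  by (rule integrable_growth[of "\<lambda>x. poly P (x i) * poly Q (x j) * poly R (x k) * poly S (x l)"])
    (intro poly_growth_intros)

lemma integrable_poly_mult2: "integrable M (\<lambda>\<omega>. poly P (X i \<omega>) * poly Q (X j \<omega>))"
  by (rule integrable_growth[of "\<lambda>x. poly P (x i) * poly Q (x j)"]) (intro poly_growth_intros)

text \<open>The argument order of \<open>pair\<close> records the first pairing: \<open>j\<close>
  and \<open>k\<close> are joined; then either \<open>l\<close> and \<open>m\<close> are joined as
  well, or \<open>l\<close> is attached to \<open>j\<close> or \<open>k\<close> and \<open>m\<close>
  to any of the others. The three summands are the possible partners of the first factor.\<close>

lemma four_factor_cover:
  fixes c :: "nat \<Rightarrow> real" and N :: nat
  assumes "c 0 = 0"
  defines "pair \<equiv> (\<lambda>j k l m. \<bar>cov j k\<bar> * (\<bar>cov l m\<bar> + (\<bar>cov l j\<bar> + \<bar>cov l k\<bar>) * (\<bar>cov m j\<bar> + \<bar>cov m k\<bar> + \<bar>cov m l\<bar>)))"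
    and "P \<equiv> he_comb N c" and "Q \<equiv> he_comb N (\<lambda>q. \<bar>c q\<bar>)"
  shows "\<bar>expectation (\<lambda>\<omega>. poly P (X j \<omega>) * poly P (X k \<omega>) * poly P (X l \<omega>) * poly P (X m \<omega>))\<bar>
    \<le> (pair j k l m + pair j l k m + pair j m k l) * expectation (\<lambda>\<omega>. poly Q (X 0 \<omega>) ^ 4)"
proof -
  define \<kappa> where "\<kappa> = four j k l m"
  define B :: "nat set" where "B = {0, 1, 2, 3}"
  interpret moment_compare B "\<lambda>a b. cov (\<kappa> a) (\<kappa> b)" "hmoment \<kappa> B" "hmoment (\<lambda>_. 0) B"
    by (rule moment_compare_hmoment) (simp add: B_def)
  have "\<bar>expectation (\<lambda>\<omega>. \<Prod>a\<in>B. poly (he_comb N ((\<lambda>_. c) a)) (X (\<kappa> a) \<omega>)) - 0\<bar>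
    \<le> cover [0, 1, 2, 3] * expectation (\<lambda>\<omega>. \<Prod>a\<in>B. poly (he_comb N (\<lambda>q. \<bar>(\<lambda>_. c) a q\<bar>)) (X 0 \<omega>))"
  proof (rule abs_expectation_he_comb_diff[where D="\<lambda>_. 0", OF fin])
    fix q assume "\<And>a. a \<in> B \<Longrightarrow> c (q a) \<noteq> 0"
    then have "\<And>a. a \<in> B \<Longrightarrow> 0 < q a" using assms(1) by (metis gr0I)
    then show "\<bar>hmoment \<kappa> B q - 0\<bar> \<le> cover [0, 1, 2, 3] * hmoment (\<lambda>_. 0) B q"
      using E_le_cover[of "[0,1,2,3]" q] by (auto simp: B_def)
  qed simp
  moreover have "cover [0, 1, 2, 3] = pair j k l m + pair j l k m + pair j m k l"
  proof -
    have BD: "B - {0} = {1, 2, 3}" "B - {1} = {0, 2, 3}" "B - {2} = {0, 1, 3}" "B - {3} = {0, 1, 2}"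
      by (auto simp: B_def)
    have \<kappa>: "\<kappa> 0 = j" "\<kappa> 1 = k" "\<kappa> (Suc 0) = k" "\<kappa> 2 = l" "\<kappa> 3 = m"
      by (simp_all add: \<kappa>_def)
    have 3: "cover [3] = \<bar>cov m j\<bar> + \<bar>cov m k\<bar> + \<bar>cov m l\<bar>"
      unfolding cover.simps BD by (simp add: \<kappa>)
    have 2: "cover [2] = \<bar>cov l j\<bar> + \<bar>cov l k\<bar> + \<bar>cov l m\<bar>"
      unfolding cover.simps BD by (simp add: \<kappa>)
    have 23: "cover [2, 3] = (\<bar>cov l j\<bar> + \<bar>cov l k\<bar>) * cover [3] + \<bar>cov l m\<bar>"
      unfolding cover.simps(2)[of 2 "[3]"] BD by (simp add: \<kappa> distrib_right del: cover.simps(2))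
    have 13: "cover [1, 3] = (\<bar>cov k j\<bar> + \<bar>cov k l\<bar>) * cover [3] + \<bar>cov k m\<bar>"
      unfolding cover.simps(2)[of 1 "[3]"] BD by (simp add: \<kappa> distrib_right del: cover.simps(2))
    have 12: "cover [1, 2] = (\<bar>cov k j\<bar> + \<bar>cov k m\<bar>) * cover [2] + \<bar>cov k l\<bar>"
      unfolding cover.simps(2)[of 1 "[2]"] BD by (simp add: \<kappa> distrib_right del: cover.simps(2))
    have "cover [0, 1, 2, 3] = \<bar>cov j k\<bar> * cover [2, 3] + \<bar>cov j l\<bar> * cover [1, 3] + \<bar>cov j m\<bar> * cover [1, 2]"
      unfolding cover.simps(2)[of 0 "[1, 2, 3]"] BD by (simp add: \<kappa> del: cover.simps(2))
    then show ?thesis unfolding 12 13 23 2 3 pair_def by (simp only: add_ac)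
  qed
  ultimately show ?thesis
    by (simp add: B_def \<kappa>_def P_def Q_def power4_eq_xxxx mult.assoc)
qed

text \<open>Erasing the correlations between the groups \<open>{i, j}\<close> and
  \<open>{k, l}\<close> turns the moment into the product of two means. Each of the four erased ones
  is in absolute value at most \<open>\<delta>\<close>, the sum of all four absolute values.\<close>

lemma four_factor_covariance:
  fixes c d :: "nat \<Rightarrow> real" and N :: nat
  defines "A \<equiv> he_comb N c" and "B \<equiv> he_comb N d"
    and "A' \<equiv> he_comb N (\<lambda>q. \<bar>c q\<bar>)" and "B' \<equiv> he_comb N (\<lambda>q. \<bar>d q\<bar>)"
  shows "\<bar>expectation (\<lambda>\<omega>. poly A (X i \<omega>) * poly B (X j \<omega>) * poly A (X k \<omega>) * poly B (X l \<omega>))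
      - expectation (\<lambda>\<omega>. poly A (X i \<omega>) * poly B (X j \<omega>)) * expectation (\<lambda>\<omega>. poly A (X k \<omega>) * poly B (X l \<omega>))\<bar>
    \<le> (\<bar>cov i k\<bar> + \<bar>cov i l\<bar> + \<bar>cov j k\<bar> + \<bar>cov j l\<bar>)
      * expectation (\<lambda>\<omega>. poly A' (X 0 \<omega>) * poly B' (X 0 \<omega>) * poly A' (X 0 \<omega>) * poly B' (X 0 \<omega>))"
proof -
  define \<kappa> where "\<kappa> = four i j k l"
  define e where "e = four c d c d"
  define B1 B2 :: "nat set" where "B1 = {0, 1}" and "B2 = {2, 3}"
  have f: "finite B1" "finite B2" "B1 \<inter> B2 = {}" by (auto simp: B1_def B2_def)
  interpret moment_compare "B1 \<union> B2" "\<lambda>a b. cov (\<kappa> a) (\<kappa> b)" "hmoment \<kappa> (B1 \<union> B2)" "hmoment (\<lambda>_. 0) (B1 \<union> B2)"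
    by (rule moment_compare_hmoment) (use f in simp)
  have ext: "hmoment \<kappa> C q = hmoment \<kappa> C q'" if "\<And>a. a \<in> C \<Longrightarrow> q a = q' a" for C q q'
    using that unfolding hmoment_def by (intro Bochner_Integration.integral_cong prod.cong) auto
  define \<delta> where "\<delta> = \<bar>cov i k\<bar> + \<bar>cov i l\<bar> + \<bar>cov j k\<bar> + \<bar>cov j l\<bar>"
  have rec: "moment_rec (B1 \<union> B2) (\<lambda>a b. if a \<in> B1 \<longleftrightarrow> b \<in> B1 then cov (\<kappa> a) (\<kappa> b) else 0)
      (\<lambda>q. hmoment \<kappa> B1 q * hmoment \<kappa> B2 q)"
    using f by (intro moment_rec_product moment_rec_hmoment ext) auto
  have "\<bar>expectation (\<lambda>\<omega>. \<Prod>a\<in>B1 \<union> B2. poly (he_comb N (e a)) (X (\<kappa> a) \<omega>))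
      - expectation (\<lambda>\<omega>. \<Prod>a\<in>B1. poly (he_comb N (e a)) (X (\<kappa> a) \<omega>)) * expectation (\<lambda>\<omega>. \<Prod>a\<in>B2. poly (he_comb N (e a)) (X (\<kappa> a) \<omega>))\<bar>
    \<le> \<delta> * expectation (\<lambda>\<omega>. \<Prod>a\<in>B1 \<union> B2. poly (he_comb N (\<lambda>q. \<bar>e a q\<bar>)) (X 0 \<omega>))"
  proof (rule abs_expectation_he_comb_diff[where D="\<lambda>q. hmoment \<kappa> B1 q * hmoment \<kappa> B2 q", OF fin])
    fix q
    show "\<bar>hmoment \<kappa> (B1 \<union> B2) q - hmoment \<kappa> B1 q * hmoment \<kappa> B2 q\<bar> \<le> \<delta> * hmoment (\<lambda>_. 0) (B1 \<union> B2) q"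
    proof (rule E_diff_le[OF rec])
      fix a b :: nat assume "a \<in> B1 \<union> B2" "b \<in> B1 \<union> B2"
      then show "(if a \<in> B1 \<longleftrightarrow> b \<in> B1 then cov (\<kappa> a) (\<kappa> b) else 0) = cov (\<kappa> a) (\<kappa> b) \<or>
         (if a \<in> B1 \<longleftrightarrow> b \<in> B1 then cov (\<kappa> a) (\<kappa> b) else 0) = 0 \<and> \<bar>cov (\<kappa> a) (\<kappa> b)\<bar> \<le> \<delta>"
        by (auto simp: B1_def B2_def \<kappa>_def \<delta>_def cov_commute)
    qed (simp add: \<delta>_def)
  next
    have "(\<Sum>q\<in>Pi\<^sub>E (B1 \<union> B2) (\<lambda>_. {..N}). (\<Prod>a\<in>B1 \<union> B2. e a (q a)) * (hmoment \<kappa> B1 q * hmoment \<kappa> B2 q))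
      = (\<Sum>q\<in>Pi\<^sub>E (B1 \<union> B2) (\<lambda>_. {..N}). ((\<Prod>a\<in>B1. e a (q a)) * hmoment \<kappa> B1 q) * ((\<Prod>a\<in>B2. e a (q a)) * hmoment \<kappa> B2 q))"
      using f by (simp add: prod.union_disjoint mult_ac)
    also have "\<dots> = (\<Sum>q\<in>Pi\<^sub>E B1 (\<lambda>_. {..N}). (\<Prod>a\<in>B1. e a (q a)) * hmoment \<kappa> B1 q) *
        (\<Sum>q\<in>Pi\<^sub>E B2 (\<lambda>_. {..N}). (\<Prod>a\<in>B2. e a (q a)) * hmoment \<kappa> B2 q)"
      by (rule sum_PiE_Un[OF f(3)]; intro arg_cong2[where f="(*)"] prod.cong ext refl; simp)
    finally show "expectation (\<lambda>\<omega>. \<Prod>a\<in>B1. poly (he_comb N (e a)) (X (\<kappa> a) \<omega>)) * expectation (\<lambda>\<omega>. \<Prod>a\<in>B2. poly (he_comb N (e a)) (X (\<kappa> a) \<omega>))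
      = (\<Sum>q\<in>Pi\<^sub>E (B1 \<union> B2) (\<lambda>_. {..N}). (\<Prod>a\<in>B1 \<union> B2. e a (q a)) * (hmoment \<kappa> B1 q * hmoment \<kappa> B2 q))"
      using f by (simp add: expectation_he_comb_prod)
  qed
  moreover have U: "B1 \<union> B2 = {0, 1, 2, 3}" by (auto simp: B1_def B2_def)
  ultimately show ?thesis
    unfolding U
    by (simp add: B1_def B2_def \<kappa>_def e_def \<delta>_def A_def B_def A'_def B'_def mult.assoc)
qed

lemma hmoment_0_nonneg: "finite B \<Longrightarrow> 0 \<le> hmoment (\<lambda>_. 0) B q"
  using moment_compare.E1_nonneg[OF moment_compare_hmoment] .

lemma expectation_he_comb_mono:
  fixes B :: "nat set"
  assumes "finite B" and c: "\<And>a q. 0 \<le> c a q" "\<And>a q. c a q \<le> d a q"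
  shows "expectation (\<lambda>\<omega>. \<Prod>a\<in>B. poly (he_comb m (c a)) (X 0 \<omega>))
    \<le> expectation (\<lambda>\<omega>. \<Prod>a\<in>B. poly (he_comb m (d a)) (X 0 \<omega>))"
  unfolding expectation_he_comb_prod[OF assms(1), where \<kappa>="\<lambda>_. 0"]
  by (intro sum_mono mult_right_mono prod_mono hmoment_0_nonneg assms) (use c in auto)

text \<open>Comparison with all correlations equal to \<open>1\<close>, followed by monotonicity in
  nonnegative coefficients, which rests on the positivity of the moments there.\<close>

lemma expectation_he_comb_power4_le:
  fixes c d :: "nat \<Rightarrow> real"
  assumes "\<And>q. \<bar>c q\<bar> \<le> d q"
  shows "expectation (\<lambda>\<omega>. poly (he_comb m c) (X i \<omega>) ^ 4) \<le> expectation (\<lambda>\<omega>. poly (he_comb m d) (X 0 \<omega>) ^ 4)"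
proof -
  define B :: "nat set" where "B = {0, 1, 2, 3}"
  interpret moment_compare B "\<lambda>a b. cov ((\<lambda>_. i) a) ((\<lambda>_. i) b)" "hmoment (\<lambda>_. i) B" "hmoment (\<lambda>_. 0) B"
    by (rule moment_compare_hmoment) (simp add: B_def)
  have "\<bar>expectation (\<lambda>\<omega>. \<Prod>a\<in>B. poly (he_comb m ((\<lambda>_. c) a)) (X ((\<lambda>_. i) a) \<omega>)) - 0\<bar>
    \<le> 1 * expectation (\<lambda>\<omega>. \<Prod>a\<in>B. poly (he_comb m (\<lambda>q. \<bar>(\<lambda>_. c) a q\<bar>)) (X 0 \<omega>))"
    by (rule abs_expectation_he_comb_diff[where D="\<lambda>_. 0", OF fin]) (use E_le in auto)
  moreover have "expectation (\<lambda>\<omega>. \<Prod>a\<in>B. poly (he_comb m ((\<lambda>_ q. \<bar>c q\<bar>) a)) (X 0 \<omega>))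
    \<le> expectation (\<lambda>\<omega>. \<Prod>a\<in>B. poly (he_comb m ((\<lambda>_. d) a)) (X 0 \<omega>))"
    by (rule expectation_he_comb_mono[OF fin]) (use assms in auto)
  ultimately show ?thesis by (simp add: B_def power4_eq_xxxx mult.assoc)
qed

end

text \<open>A factor attached to already paired ones costs only \<open>K\<close>, so the perfect matchings dominate.\<close>

lemma sum_pair_le:
  fixes w :: "nat \<Rightarrow> real" and R :: "nat \<Rightarrow> nat \<Rightarrow> real"
  assumes w: "\<And>j. 0 \<le> w j" and R: "\<And>j k. 0 \<le> R j k"
    and K: "\<And>a. a \<in> I \<Longrightarrow> (\<Sum>l\<in>I. w l * R l a) \<le> K"
    and S: "(\<Sum>j\<in>I. \<Sum>k\<in>I. w j * w k * R j k) \<le> S"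
  shows "(\<Sum>j\<in>I. \<Sum>k\<in>I. \<Sum>l\<in>I. \<Sum>m\<in>I. w j * w k * w l * w m *
      (R j k * (R l m + (R l j + R l k) * (R m j + R m k + R m l)))) \<le> S * (S + 6 * K\<^sup>2)"
proof -
  \<comment> \<open>The constant \<open>6\<close> is two anchors \<open>j, k\<close> for
    \<open>l\<close> times three anchors for \<open>m\<close>; every attached factor sums to at most
    \<open>K\<close>.\<close>
  have inner: "(\<Sum>l\<in>I. \<Sum>m\<in>I. w l * w m * (R l m + (R l j + R l k) * (R m j + R m k + R m l))) \<le> S + 6 * K\<^sup>2"
    if "j \<in> I" "k \<in> I" for j k
  proof -
    have "(\<Sum>l\<in>I. \<Sum>m\<in>I. w l * w m * (R l m + (R l j + R l k) * (R m j + R m k + R m l)))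
      = (\<Sum>l\<in>I. \<Sum>m\<in>I. w l * w m * R l m) +
        (\<Sum>l\<in>I. (w l * R l j + w l * R l k) * ((\<Sum>m\<in>I. w m * R m j) + (\<Sum>m\<in>I. w m * R m k) + (\<Sum>m\<in>I. w m * R m l)))"
      by (simp add: sum.distrib sum_distrib_left sum_distrib_right algebra_simps)
    also have "\<dots> \<le> S + (\<Sum>l\<in>I. (w l * R l j + w l * R l k) * (K + K + K))"
      using w R K that S by (intro add_mono sum_mono mult_left_mono) auto
    also have "(\<Sum>l\<in>I. (w l * R l j + w l * R l k) * (K + K + K))
        = ((\<Sum>l\<in>I. w l * R l j) + (\<Sum>l\<in>I. w l * R l k)) * (K + K + K)"
      by (simp add: sum.distrib sum_distrib_left sum_distrib_right algebra_simps)
    also have "\<dots> \<le> (K + K) * (K + K + K)"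
    proof -
      have "0 \<le> (\<Sum>l\<in>I. w l * R l j)" using w R by (intro sum_nonneg) auto
      then have "0 \<le> K" using K[OF that(1)] by linarith
      then show ?thesis using K that by (intro mult_right_mono add_mono) auto
    qed
    finally show ?thesis by (simp add: power2_eq_square)
  qed
  have S0: "0 \<le> S" by (rule order_trans[OF _ S]) (use w R in \<open>intro sum_nonneg mult_nonneg_nonneg\<close>)
  have "(\<Sum>j\<in>I. \<Sum>k\<in>I. \<Sum>l\<in>I. \<Sum>m\<in>I. w j * w k * w l * w m *
      (R j k * (R l m + (R l j + R l k) * (R m j + R m k + R m l))))
    = (\<Sum>j\<in>I. \<Sum>k\<in>I. w j * w k * R j k *
        (\<Sum>l\<in>I. \<Sum>m\<in>I. w l * w m * (R l m + (R l j + R l k) * (R m j + R m k + R m l))))"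
    unfolding sum_distrib_left by (intro sum.cong refl) (simp add: mult_ac)
  also have "\<dots> \<le> (\<Sum>j\<in>I. \<Sum>k\<in>I. w j * w k * R j k * (S + 6 * K\<^sup>2))"
    using w R by (intro sum_mono mult_left_mono inner) auto
  also have "\<dots> = (\<Sum>j\<in>I. \<Sum>k\<in>I. w j * w k * R j k) * (S + 6 * K\<^sup>2)"
    by (simp add: sum_distrib_right)
  also have "\<dots> \<le> S * (S + 6 * K\<^sup>2)" using S0 S by (intro mult_right_mono) auto
  finally show ?thesis .
qed

context gaussian_process
begin

text \<open>The weights are symmetric in the four indices, so relabelling shows that the three
  choices of the first pairing have the same sum, whence the factor \<open>3\<close>. The weights in
  the application are \<open>w j = cov i j\<close>, and \<open>S\<close> is then the triangle sum at
  \<open>i\<close>.\<close>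

lemma weighted_sum_power4_le:
  fixes c :: "nat \<Rightarrow> real" and w :: "nat \<Rightarrow> real"
  assumes c0: "c 0 = 0"
    and K: "\<And>a. a \<in> I \<Longrightarrow> (\<Sum>l\<in>I. \<bar>w l\<bar> * \<bar>cov l a\<bar>) \<le> K"
    and S: "(\<Sum>j\<in>I. \<Sum>k\<in>I. \<bar>w j\<bar> * \<bar>w k\<bar> * \<bar>cov j k\<bar>) \<le> S"
  shows "expectation (\<lambda>\<omega>. (\<Sum>j\<in>I. w j * poly (he_comb N c) (X j \<omega>)) ^ 4)
    \<le> 3 * (S * (S + 6 * K\<^sup>2)) * expectation (\<lambda>\<omega>. poly (he_comb N (\<lambda>q. \<bar>c q\<bar>)) (X 0 \<omega>) ^ 4)"
proof -
  define P where "P = he_comb N c"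
  define G where "G = expectation (\<lambda>\<omega>. poly (he_comb N (\<lambda>q. \<bar>c q\<bar>)) (X 0 \<omega>) ^ 4)"
  have G: "0 \<le> G" unfolding G_def by simp
  define W where "W j k l m = \<bar>w j\<bar> * \<bar>w k\<bar> * \<bar>w l\<bar> * \<bar>w m\<bar>" for j k l m
  define pair where "pair = (\<lambda>j k l m. \<bar>cov j k\<bar> * (\<bar>cov l m\<bar> + (\<bar>cov l j\<bar> + \<bar>cov l k\<bar>) * (\<bar>cov m j\<bar> + \<bar>cov m k\<bar> + \<bar>cov m l\<bar>)))"
  have pair_sum: "(\<Sum>j\<in>I. \<Sum>k\<in>I. \<Sum>l\<in>I. \<Sum>m\<in>I. W j k l m * pair j k l m) \<le> S * (S + 6 * K\<^sup>2)"
    unfolding pair_def W_def by (rule sum_pair_le) (use K S in auto)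
  have "(\<Sum>j\<in>I. w j * poly P (X j \<omega>)) ^ 4 = (\<Sum>j\<in>I. \<Sum>k\<in>I. \<Sum>l\<in>I. \<Sum>m\<in>I.
      (w j * w k * w l * w m) * (poly P (X j \<omega>) * poly P (X k \<omega>) * poly P (X l \<omega>) * poly P (X m \<omega>)))" for \<omega>
    unfolding power4_eq_xxxx sum_product by (simp add: sum_distrib_left sum_distrib_right mult_ac)
  then have "expectation (\<lambda>\<omega>. (\<Sum>j\<in>I. w j * poly P (X j \<omega>)) ^ 4) = (\<Sum>j\<in>I. \<Sum>k\<in>I. \<Sum>l\<in>I. \<Sum>m\<in>I.
      (w j * w k * w l * w m) * expectation (\<lambda>\<omega>. poly P (X j \<omega>) * poly P (X k \<omega>) * poly P (X l \<omega>) * poly P (X m \<omega>)))"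
    by (simp add: Bochner_Integration.integral_sum integrable_mult_right integrable_poly_mult4)
  also have "\<dots> \<le> (\<Sum>j\<in>I. \<Sum>k\<in>I. \<Sum>l\<in>I. \<Sum>m\<in>I. W j k l m * ((pair j k l m + pair j l k m + pair j m k l) * G))"
  proof (intro sum_mono)
    fix j k l m
    let ?E = "expectation (\<lambda>\<omega>. poly P (X j \<omega>) * poly P (X k \<omega>) * poly P (X l \<omega>) * poly P (X m \<omega>))"
    have "(w j * w k * w l * w m) * ?E \<le> W j k l m * \<bar>?E\<bar>"
      using abs_ge_self[of "(w j * w k * w l * w m) * ?E"] by (simp add: W_def abs_mult)
    also have "\<dots> \<le> W j k l m * ((pair j k l m + pair j l k m + pair j m k l) * G)"
      unfolding P_def pair_def G_def by (intro mult_left_mono four_factor_cover c0) (simp add: W_def)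
    finally show "(w j * w k * w l * w m) * ?E \<le> W j k l m * ((pair j k l m + pair j l k m + pair j m k l) * G)" .
  qed
  also have "\<dots> = ((\<Sum>j\<in>I. \<Sum>k\<in>I. \<Sum>l\<in>I. \<Sum>m\<in>I. W j k l m * pair j k l m) +
      (\<Sum>j\<in>I. \<Sum>k\<in>I. \<Sum>l\<in>I. \<Sum>m\<in>I. W j k l m * pair j l k m) +
      (\<Sum>j\<in>I. \<Sum>k\<in>I. \<Sum>l\<in>I. \<Sum>m\<in>I. W j k l m * pair j m k l)) * G"
    by (simp add: sum.distrib sum_distrib_right distrib_left distrib_right mult.assoc)
  also have "(\<Sum>j\<in>I. \<Sum>k\<in>I. \<Sum>l\<in>I. \<Sum>m\<in>I. W j k l m * pair j l k m)
      = (\<Sum>j\<in>I. \<Sum>k\<in>I. \<Sum>l\<in>I. \<Sum>m\<in>I. W j k l m * pair j k l m)"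
  proof (rule sum.cong[OF refl])
    fix j
    show "(\<Sum>k\<in>I. \<Sum>l\<in>I. \<Sum>m\<in>I. W j k l m * pair j l k m) = (\<Sum>k\<in>I. \<Sum>l\<in>I. \<Sum>m\<in>I. W j k l m * pair j k l m)"
      by (subst sum.swap) (simp add: W_def mult_ac)
  qed
  also have "(\<Sum>j\<in>I. \<Sum>k\<in>I. \<Sum>l\<in>I. \<Sum>m\<in>I. W j k l m * pair j m k l)
      = (\<Sum>j\<in>I. \<Sum>k\<in>I. \<Sum>l\<in>I. \<Sum>m\<in>I. W j k l m * pair j k l m)"
  proof (rule sum.cong[OF refl])
    fix j
    have "(\<Sum>k\<in>I. \<Sum>l\<in>I. \<Sum>m\<in>I. W j k l m * pair j m k l) = (\<Sum>k\<in>I. \<Sum>m\<in>I. \<Sum>l\<in>I. W j k l m * pair j m k l)"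
      by (intro sum.cong refl sum.swap)
    also have "\<dots> = (\<Sum>m\<in>I. \<Sum>k\<in>I. \<Sum>l\<in>I. W j k l m * pair j m k l)" by (rule sum.swap)
    also have "\<dots> = (\<Sum>k\<in>I. \<Sum>l\<in>I. \<Sum>m\<in>I. W j k l m * pair j k l m)"
      by (intro sum.cong refl) (simp add: W_def mult_ac)
    finally show "(\<Sum>k\<in>I. \<Sum>l\<in>I. \<Sum>m\<in>I. W j k l m * pair j m k l) = (\<Sum>k\<in>I. \<Sum>l\<in>I. \<Sum>m\<in>I. W j k l m * pair j k l m)" .
  qed
  also have "((\<Sum>j\<in>I. \<Sum>k\<in>I. \<Sum>l\<in>I. \<Sum>m\<in>I. W j k l m * pair j k l m) +
      (\<Sum>j\<in>I. \<Sum>k\<in>I. \<Sum>l\<in>I. \<Sum>m\<in>I. W j k l m * pair j k l m) +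
      (\<Sum>j\<in>I. \<Sum>k\<in>I. \<Sum>l\<in>I. \<Sum>m\<in>I. W j k l m * pair j k l m)) * G \<le> (3 * (S * (S + 6 * K\<^sup>2))) * G"
    using pair_sum by (intro mult_right_mono G) linarith
  finally show ?thesis by (simp add: P_def G_def)
qed

end

section \<open>The bound for polynomials\<close>

lemma pderiv_sum_eq: "pderiv (\<Sum>i\<in>A. f i) = (\<Sum>i\<in>A. pderiv (f i))"
  by (induction A rule: infinite_finite_induct) (simp_all add: pderiv_add)

text \<open>Vanishing beyond \<open>m\<close> lets the shifted expansion keep the length
  \<open>m\<close>: its top coefficient contains \<open>c (Suc m) = 0\<close>.\<close>

lemma pderiv_he_comb:
  assumes "\<And>q. m < q \<Longrightarrow> c q = 0"
  shows "pderiv (he_comb m c) = he_comb m (\<lambda>q. real (Suc q) * c (Suc q))"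
proof -
  have "pderiv (he_comb m c) = (\<Sum>q\<le>m. smult (c q * real q) (He (q - 1)))"
    unfolding he_comb_def by (simp add: pderiv_sum_eq pderiv_smult pderiv_He)
  also have "\<dots> = (\<Sum>q\<le>m. smult (real (Suc q) * c (Suc q)) (He q))"
    using assms by (subst sum.atMost_shift) (simp add: lessThan_Suc_atMost[symmetric] mult.commute)
  finally show ?thesis by (simp add: he_comb_def)
qed

lemma dir_deriv_cmult: "dir_deriv v \<Phi> \<Phi>' \<Longrightarrow> dir_deriv v (\<lambda>x. c * \<Phi> x) (\<lambda>x. c * \<Phi>' x)"
  using dir_deriv_mult[OF dir_deriv_const[of v c], of \<Phi> \<Phi>'] by simp

text \<open>In the application \<open>a\<close> consists of the squared correlations. By the
  symmetry of \<open>a\<close> the four links reduce to sums over \<open>k\<close>, so the row sums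
  of \<open>a\<close> enter twice, giving \<open>K^2\<close>, but those of \<open>R\<close> only
  once.\<close>

lemma sum_covariance_le:
  fixes a R :: "nat \<Rightarrow> nat \<Rightarrow> real"
  assumes "finite I"
    and a: "\<And>i j. 0 \<le> a i j" "\<And>i j. a i j = a j i" and R: "\<And>i j. 0 \<le> R i j"
    and K: "\<And>i. i \<in> I \<Longrightarrow> (\<Sum>j\<in>I. a i j) \<le> K" and T: "\<And>i. i \<in> I \<Longrightarrow> (\<Sum>k\<in>I. R i k) \<le> T"
  shows "(\<Sum>i\<in>I. \<Sum>j\<in>I. a i j * (\<Sum>k\<in>I. \<Sum>l\<in>I. a k l * (R i k + R i l + R j k + R j l))) \<le> 4 * K\<^sup>2 * T * real (card I)"
proof (cases "I = {}")
  case False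
  then obtain i0 where i0: "i0 \<in> I" by blast
  have K0: "0 \<le> K" using order_trans[OF _ K[OF i0]] a by (simp add: sum_nonneg)
  have T0: "0 \<le> T" using order_trans[OF _ T[OF i0]] R by (simp add: sum_nonneg)
  have inner: "(\<Sum>k\<in>I. \<Sum>l\<in>I. a k l * (R i k + R i l + R j k + R j l)) \<le> 4 * K * T" if "i \<in> I" "j \<in> I" for i j
  proof -
    have "(\<Sum>k\<in>I. \<Sum>l\<in>I. a k l * (R i k + R i l + R j k + R j l))
      = (\<Sum>k\<in>I. \<Sum>l\<in>I. a k l * (R i k + R j k)) + (\<Sum>k\<in>I. \<Sum>l\<in>I. a k l * (R i l + R j l))"
      by (simp add: sum.distrib[symmetric] algebra_simps)
    also have "(\<Sum>k\<in>I. \<Sum>l\<in>I. a k l * (R i l + R j l)) = (\<Sum>k\<in>I. \<Sum>l\<in>I. a k l * (R i k + R j k))"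
      by (subst sum.swap) (simp add: a(2))
    also have "(\<Sum>k\<in>I. \<Sum>l\<in>I. a k l * (R i k + R j k)) = (\<Sum>k\<in>I. (\<Sum>l\<in>I. a k l) * (R i k + R j k))"
      by (simp add: sum_distrib_right)
    also have "\<dots> \<le> (\<Sum>k\<in>I. K * (R i k + R j k))"
      using R K by (intro sum_mono mult_right_mono) auto
    also have "\<dots> = K * ((\<Sum>k\<in>I. R i k) + (\<Sum>k\<in>I. R j k))"
      by (simp add: sum.distrib sum_distrib_left distrib_left)
    also have "\<dots> \<le> K * (T + T)" using T that K0 by (intro mult_left_mono add_mono) auto
    finally show ?thesis by (simp add: algebra_simps)
  qed
  have "(\<Sum>i\<in>I. \<Sum>j\<in>I. a i j * (\<Sum>k\<in>I. \<Sum>l\<in>I. a k l * (R i k + R i l + R j k + R j l)))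
      \<le> (\<Sum>i\<in>I. \<Sum>j\<in>I. a i j * (4 * K * T))"
    using a by (intro sum_mono mult_left_mono inner) auto
  also have "\<dots> = (\<Sum>i\<in>I. (\<Sum>j\<in>I. a i j) * (4 * K * T))" by (simp add: sum_distrib_right)
  also have "\<dots> \<le> (\<Sum>i\<in>I. K * (4 * K * T))" using K K0 T0 by (intro sum_mono mult_right_mono) auto
  finally show ?thesis by (simp add: power2_eq_square mult_ac)
qed simp

lemma linear_growth:
  fixes f f' :: "real \<Rightarrow> real"
  assumes D: "\<And>x. (f has_real_derivative f' x) (at x)" and B: "\<And>x. \<bar>f' x\<bar> \<le> B"
  shows "\<bar>f y\<bar> \<le> (\<bar>f 0\<bar> + B) * (1 + \<bar>y\<bar>)"
proof -
  have "\<bar>f y - f 0\<bar> \<le> B * \<bar>y\<bar>"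
    using field_differentiable_bound[of UNIV f f' B y 0] D B by simp
  moreover have "0 \<le> B" using B[of 0] by linarith
  moreover have "0 \<le> \<bar>f 0\<bar> * \<bar>y\<bar>" by simp
  moreover have "(\<bar>f 0\<bar> + B) * (1 + \<bar>y\<bar>) = \<bar>f 0\<bar> + B + \<bar>f 0\<bar> * \<bar>y\<bar> + B * \<bar>y\<bar>" by (simp add: algebra_simps)
  ultimately show ?thesis using abs_triangle_ineq2[of "f y" "f 0"] by linarith
qed

context gaussian_process
begin

text \<open>\<open>c\<close> is replaced by its shift, without the factor \<open>q + 1\<close> that
  a derivative would bring; two rounds produce the coefficients of \<open>g\<^sub>2\<close>.\<close>

lemma he_comb_integration_by_parts:
  assumes D: "dir_deriv (cov i) \<Phi> \<Phi>'" and c0: "c 0 = 0" and cm: "\<And>q. m < q \<Longrightarrow> c q = 0"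
  shows "expectation (\<lambda>\<omega>. poly (he_comb m c) (X i \<omega>) * \<Phi> (\<lambda>j. X j \<omega>))
    = expectation (\<lambda>\<omega>. poly (he_comb m (\<lambda>q. c (Suc q))) (X i \<omega>) * \<Phi>' (\<lambda>j. X j \<omega>))"
proof -
  note pg = dir_derivD(1,2)[OF D]
  have i: "integrable M (\<lambda>\<omega>. poly P (X i \<omega>) * \<Psi> (\<lambda>j. X j \<omega>))" if "poly_growth \<Psi>" for P \<Psi>
    by (rule integrable_growth[of "\<lambda>x. poly P (x i) * \<Psi> x"]) (intro poly_growth_intros that)
  have e: "expectation (\<lambda>\<omega>. poly (he_comb m d) (X i \<omega>) * \<Psi> (\<lambda>j. X j \<omega>))
      = (\<Sum>q\<le>m. d q * expectation (\<lambda>\<omega>. poly (He q) (X i \<omega>) * \<Psi> (\<lambda>j. X j \<omega>)))" if "poly_growth \<Psi>" for d \<Psi>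
    using i[OF that] by (simp add: poly_he_comb sum_distrib_right mult.assoc)
  have "expectation (\<lambda>\<omega>. poly (he_comb m c) (X i \<omega>) * \<Phi> (\<lambda>j. X j \<omega>))
      = (\<Sum>q<m. c (Suc q) * expectation (\<lambda>\<omega>. poly (He q) (X i \<omega>) * \<Phi>' (\<lambda>j. X j \<omega>)))"
    unfolding e[OF pg(1)] by (subst sum.atMost_shift) (simp add: c0 hermite_integration_by_parts[OF D] del: He.simps)
  also have "\<dots> = expectation (\<lambda>\<omega>. poly (he_comb m (\<lambda>q. c (Suc q))) (X i \<omega>) * \<Phi>' (\<lambda>j. X j \<omega>))"
    unfolding e[OF pg(2)] by (simp add: cm lessThan_Suc_atMost[symmetric])
  finally show ?thesis .
qed

text \<open>\<open>K\<close> bounds the products of two rows of the covariance matrix in absolute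
  values, \<open>S\<close> its triangle sums and \<open>T\<close> its row sums. \<open>G1\<close>
  and \<open>G2\<close> control the fourth moments of the first and second derivative with absolute
  coefficients. The weights \<open>8\<close> and \<open>12\<close> are the bounds for
  \<open>f'\<close> and \<open>f''\<close> of the Stein solution.\<close>

theorem polynomial_stein_bound:
  fixes c :: "nat \<Rightarrow> real" and h h' :: "real \<Rightarrow> real" and I :: "nat set"
  assumes I: "finite I"
    and c: "c 0 = 0" "c 1 = 0" "\<And>q. m < q \<Longrightarrow> c q = 0"
    and \<tau>: "\<tau> > 0" "\<tau>\<^sup>2 = expectation (\<lambda>\<omega>. (\<Sum>i\<in>I. poly (he_comb m c) (X i \<omega>))\<^sup>2)"
    and G1: "expectation (\<lambda>\<omega>. poly (he_comb m (\<lambda>q. \<bar>real (Suc q) * c (Suc q)\<bar>)) (X 0 \<omega>) ^ 4) \<le> G1"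
    and G2: "expectation (\<lambda>\<omega>. poly (he_comb m (\<lambda>q. \<bar>real (Suc q) * real (Suc (Suc q)) * c (Suc (Suc q))\<bar>)) (X 0 \<omega>) ^ 4) \<le> G2"
    and K: "\<And>i a. i \<in> I \<Longrightarrow> a \<in> I \<Longrightarrow> (\<Sum>l\<in>I. \<bar>cov i l\<bar> * \<bar>cov l a\<bar>) \<le> K"
    and S: "\<And>i. i \<in> I \<Longrightarrow> (\<Sum>j\<in>I. \<Sum>k\<in>I. \<bar>cov i j\<bar> * \<bar>cov i k\<bar> * \<bar>cov j k\<bar>) \<le> S" "1 \<le> S"
    and T: "\<And>i. i \<in> I \<Longrightarrow> (\<Sum>k\<in>I. \<bar>cov i k\<bar>) \<le> T"
    and h: "\<And>x. (h has_real_derivative h' x) (at x)" "continuous_on UNIV h'" "\<And>x. \<bar>h' x\<bar> \<le> 1"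
  shows "\<bar>expectation (\<lambda>\<omega>. h ((\<Sum>i\<in>I. poly (he_comb m c) (X i \<omega>)) / \<tau>)) - (LINT y|lborel. std_normal_density y * h y)\<bar>
    \<le> 8 * sqrt (4 * K\<^sup>2 * T * real (card I) * G2) / \<tau>\<^sup>2
      + 12 * real (card I) * (S * (1 + G2 + 3 * (1 + 6 * K\<^sup>2) * G1)) / \<tau> ^ 3"
proof -
  define x where "x \<omega> = (\<lambda>j. X j \<omega>)" for \<omega>
  define p where "p = he_comb m c"
  define p2 where "p2 = he_comb m (\<lambda>q. c (Suc (Suc q)))"
  have p': "pderiv p = he_comb m (\<lambda>q. real (Suc q) * c (Suc q))"
    unfolding p_def by (rule pderiv_he_comb) (rule c)
  have p'': "pderiv (pderiv p) = he_comb m (\<lambda>q. real (Suc q) * real (Suc (Suc q)) * c (Suc (Suc q)))"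
    unfolding p' by (subst pderiv_he_comb) (simp_all add: c mult_ac)
  define Y where "Y x = 1 / \<tau> * (\<Sum>j\<in>I. poly p (x j))" for x :: "nat \<Rightarrow> real"
  \<comment> \<open>\<open>V i\<close> and \<open>W i\<close> are the first and second derivative of
    the unnormalized sum in the direction \<open>cov i\<close>.\<close>
  define V where "V i x = (\<Sum>j\<in>I. cov i j * poly (pderiv p) (x j))" for i and x :: "nat \<Rightarrow> real"
  define W where "W i x = (\<Sum>j\<in>I. cov i j * (cov i j * poly (pderiv (pderiv p)) (x j)))" for i and x :: "nat \<Rightarrow> real"
  define U where "U x = 1 / \<tau>\<^sup>2 * (\<Sum>i\<in>I. poly p2 (x i) * W i x)" for x :: "nat \<Rightarrow> real"
  define R where "R x = 1 / \<tau> ^ 3 * (\<Sum>i\<in>I. poly p2 (x i) * (V i x)\<^sup>2)" for x :: "nat \<Rightarrow> real"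
  have DY: "dir_deriv (cov i) Y (\<lambda>x. 1 / \<tau> * V i x)" for i
    unfolding Y_def[abs_def] V_def by (intro dir_deriv_cmult dir_deriv_sum dir_deriv_poly_component)
  have DV: "dir_deriv (cov i) (V i) (W i)" for i
    unfolding V_def[abs_def] W_def[abs_def] by (intro dir_deriv_cmult dir_deriv_sum dir_deriv_poly_component)
  have pgY: "poly_growth Y" and pgV: "poly_growth (V i)" and pgW: "poly_growth (W i)" for i
    unfolding Y_def[abs_def] V_def[abs_def] W_def[abs_def] by (intro poly_growth_intros)+
  have pgU: "poly_growth U" and pgR: "poly_growth R"
    unfolding U_def[abs_def] R_def[abs_def] by (intro poly_growth_intros pgV pgW)+
  have int: "integrable M (\<lambda>\<omega>. \<Phi> (x \<omega>))" if "poly_growth \<Phi>" for \<Phi>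
    unfolding x_def by (rule integrable_growth[OF that])
  \<comment> \<open>Stated for general \<open>f\<close>, because besides the Stein solution it is
    applied to \<open>f y = y\<close>, where it yields that \<open>U\<close> has mean
    \<open>1\<close>.\<close>
  have identity: "expectation (\<lambda>\<omega>. Y (x \<omega>) * f (Y (x \<omega>)))
      = expectation (\<lambda>\<omega>. f' (Y (x \<omega>)) * U (x \<omega>) + f'' (Y (x \<omega>)) * R (x \<omega>))"
    and pgf: "poly_growth (\<lambda>x. f (Y x))" "poly_growth (\<lambda>x. f' (Y x))" "poly_growth (\<lambda>x. f'' (Y x))"
    if f: "\<And>y. (f has_real_derivative f' y) (at y)" "\<And>y. (f' has_real_derivative f'' y) (at y)"
      "continuous_on UNIV f''" "\<And>y. \<bar>f' y\<bar> \<le> B1" "\<And>y. \<bar>f'' y\<bar> \<le> B2" for f f' f'' B1 B2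
  proof -
    have cf: "continuous_on UNIV f" "continuous_on UNIV f'"
      by (rule DERIV_continuous_on_UNIV[OF f(1)], rule DERIV_continuous_on_UNIV[OF f(2)])
    have B0: "0 \<le> B1" "0 \<le> B2" using f(4)[of 0] f(5)[of 0] by linarith+
    have b0: "\<bar>f y\<bar> \<le> (\<bar>f 0\<bar> + B1) * (1 + \<bar>y\<bar>)" for y by (rule linear_growth[OF f(1,4)])
    have b1: "\<bar>f' y\<bar> \<le> B1 * (1 + \<bar>y\<bar>)" for y
    proof -
      have "0 \<le> B1 * \<bar>y\<bar>" using B0 by simp
      then show ?thesis unfolding distrib_left using f(4)[of y] by linarith
    qed
    have b2: "\<bar>f'' y\<bar> \<le> B2 * (1 + \<bar>y\<bar>)" for y
    proof -
      have "0 \<le> B2 * \<bar>y\<bar>" using B0 by simp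
      then show ?thesis unfolding distrib_left using f(5)[of y] by linarith
    qed
    show pgf: "poly_growth (\<lambda>x. f (Y x))" "poly_growth (\<lambda>x. f' (Y x))" "poly_growth (\<lambda>x. f'' (Y x))"
      by (intro poly_growth_compose[OF pgY _ b0] poly_growth_compose[OF pgY _ b1] poly_growth_compose[OF pgY _ b2]
          borel_measurable_continuous_onI cf f(3))+
    have D1: "dir_deriv (cov i) (\<lambda>x. f (Y x)) (\<lambda>x. f' (Y x) * (1 / \<tau> * V i x))" for i
      by (rule dir_deriv_compose[OF DY f(1) cf(2) b0 b1])
    have D2: "dir_deriv (cov i) (\<lambda>x. f' (Y x) * (1 / \<tau> * V i x))
        (\<lambda>x. (f'' (Y x) * (1 / \<tau> * V i x)) * (1 / \<tau> * V i x) + f' (Y x) * (1 / \<tau> * W i x))" for i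
      by (rule dir_deriv_mult[OF dir_deriv_compose[OF DY f(2,3) b1 b2] dir_deriv_cmult[OF DV]])
    \<comment> \<open>The two rounds of integration by parts consume \<open>c 0 = 0\<close> and
      \<open>c 1 = 0\<close>; this is where rank 2 enters.\<close>
    have step: "expectation (\<lambda>\<omega>. poly p (X i \<omega>) * f (Y (x \<omega>)))
        = expectation (\<lambda>\<omega>. poly p2 (X i \<omega>) * ((f'' (Y (x \<omega>)) * (1 / \<tau> * V i (x \<omega>))) * (1 / \<tau> * V i (x \<omega>))
            + f' (Y (x \<omega>)) * (1 / \<tau> * W i (x \<omega>))))" for i
      unfolding p_def p2_def x_def using c
      by (subst he_comb_integration_by_parts[OF D1], simp, simp, subst he_comb_integration_by_parts[OF D2], simp_all)
    have i1: "integrable M (\<lambda>\<omega>. poly p (X i \<omega>) * f (Y (x \<omega>)))" for i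
      using int[of "\<lambda>x. poly p (x i) * f (Y x)"] by (simp add: x_def poly_growth_intros pgf)
    have i2: "integrable M (\<lambda>\<omega>. poly p2 (X i \<omega>) * ((f'' (Y (x \<omega>)) * (1 / \<tau> * V i (x \<omega>))) * (1 / \<tau> * V i (x \<omega>))
            + f' (Y (x \<omega>)) * (1 / \<tau> * W i (x \<omega>))))" for i
    proof -
      have "poly_growth (\<lambda>x. poly p2 (x i) * ((f'' (Y x) * (1 / \<tau> * V i x)) * (1 / \<tau> * V i x) + f' (Y x) * (1 / \<tau> * W i x)))"
        by (intro poly_growth_intros pgf pgV pgW)
      from int[OF this] show ?thesis by (simp add: x_def)
    qed
    have "expectation (\<lambda>\<omega>. Y (x \<omega>) * f (Y (x \<omega>))) = expectation (\<lambda>\<omega>. 1 / \<tau> * (\<Sum>i\<in>I. poly p (X i \<omega>) * f (Y (x \<omega>))))"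
    proof -
      have "Y (x \<omega>) * z = 1 / \<tau> * (\<Sum>i\<in>I. poly p (X i \<omega>) * z)" for \<omega> z
        by (simp add: Y_def x_def sum_distrib_right)
      then show ?thesis by simp
    qed
    also have "\<dots> = 1 / \<tau> * (\<Sum>i\<in>I. expectation (\<lambda>\<omega>. poly p (X i \<omega>) * f (Y (x \<omega>))))"
      using i1 by simp
    also have "\<dots> = 1 / \<tau> * (\<Sum>i\<in>I. expectation (\<lambda>\<omega>. poly p2 (X i \<omega>) * ((f'' (Y (x \<omega>)) * (1 / \<tau> * V i (x \<omega>))) * (1 / \<tau> * V i (x \<omega>))
            + f' (Y (x \<omega>)) * (1 / \<tau> * W i (x \<omega>)))))"
      by (simp only: step)
    also have "\<dots> = expectation (\<lambda>\<omega>. 1 / \<tau> * (\<Sum>i\<in>I. poly p2 (X i \<omega>) * ((f'' (Y (x \<omega>)) * (1 / \<tau> * V i (x \<omega>))) * (1 / \<tau> * V i (x \<omega>))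
            + f' (Y (x \<omega>)) * (1 / \<tau> * W i (x \<omega>)))))"
      by (simp only: Bochner_Integration.integral_mult_right_zero Bochner_Integration.integral_sum[OF i2])
    also have "\<dots> = expectation (\<lambda>\<omega>. f' (Y (x \<omega>)) * U (x \<omega>) + f'' (Y (x \<omega>)) * R (x \<omega>))"
    proof (intro Bochner_Integration.integral_cong refl)
      fix \<omega>
      have "1 / \<tau> * (poly p2 (X i \<omega>) * ((f'' (Y (x \<omega>)) * (1 / \<tau> * V i (x \<omega>))) * (1 / \<tau> * V i (x \<omega>)) + f' (Y (x \<omega>)) * (1 / \<tau> * W i (x \<omega>))))
        = f' (Y (x \<omega>)) * (1 / \<tau>\<^sup>2 * (poly p2 (X i \<omega>) * W i (x \<omega>))) + f'' (Y (x \<omega>)) * (1 / \<tau> ^ 3 * (poly p2 (X i \<omega>) * (V i (x \<omega>))\<^sup>2))" for i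
        by (simp add: power2_eq_square power3_eq_cube distrib_left mult_ac)
      then show "1 / \<tau> * (\<Sum>i\<in>I. poly p2 (X i \<omega>) * ((f'' (Y (x \<omega>)) * (1 / \<tau> * V i (x \<omega>))) * (1 / \<tau> * V i (x \<omega>)) + f' (Y (x \<omega>)) * (1 / \<tau> * W i (x \<omega>))))
        = f' (Y (x \<omega>)) * U (x \<omega>) + f'' (Y (x \<omega>)) * R (x \<omega>)"
        unfolding U_def R_def sum_distrib_left by (simp add: sum.distrib x_def)
    qed
    finally show "expectation (\<lambda>\<omega>. Y (x \<omega>) * f (Y (x \<omega>)))
      = expectation (\<lambda>\<omega>. f' (Y (x \<omega>)) * U (x \<omega>) + f'' (Y (x \<omega>)) * R (x \<omega>))" .
  qed
  have EY2: "expectation (\<lambda>\<omega>. Y (x \<omega>) * Y (x \<omega>)) = 1"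
  proof -
    have "Y (x \<omega>) * Y (x \<omega>) = 1 / \<tau>\<^sup>2 * (\<Sum>i\<in>I. poly p (X i \<omega>))\<^sup>2" for \<omega>
      by (simp add: Y_def x_def power2_eq_square)
    then have "expectation (\<lambda>\<omega>. Y (x \<omega>) * Y (x \<omega>)) = 1 / \<tau>\<^sup>2 * expectation (\<lambda>\<omega>. (\<Sum>i\<in>I. poly p (X i \<omega>))\<^sup>2)"
      by (simp only: Bochner_Integration.integral_mult_right_zero)
    also have "\<dots> = 1" using \<tau>(1) unfolding p_def \<tau>(2)[symmetric] by simp
    finally show ?thesis .
  qed
  have EU: "expectation (\<lambda>\<omega>. U (x \<omega>)) = 1"
    using identity[of "\<lambda>y. y" "\<lambda>_. 1" "\<lambda>_. 0" 1 0] EY2 by simp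
  define Q where "Q = expectation (\<lambda>\<omega>. poly (he_comb m (\<lambda>q. \<bar>c (Suc (Suc q))\<bar>)) (X 0 \<omega>) *
      poly (he_comb m (\<lambda>q. \<bar>real (Suc q) * real (Suc (Suc q)) * c (Suc (Suc q))\<bar>)) (X 0 \<omega>) *
      poly (he_comb m (\<lambda>q. \<bar>c (Suc (Suc q))\<bar>)) (X 0 \<omega>) *
      poly (he_comb m (\<lambda>q. \<bar>real (Suc q) * real (Suc (Suc q)) * c (Suc (Suc q))\<bar>)) (X 0 \<omega>))"
  have abs_le: "\<bar>c (Suc (Suc q))\<bar> \<le> \<bar>real (Suc q) * real (Suc (Suc q)) * c (Suc (Suc q))\<bar>" for q
  proof -
    have "1 * 1 \<le> real (Suc q) * real (Suc (Suc q))" by (intro mult_mono) auto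
    then have "1 * \<bar>c (Suc (Suc q))\<bar> \<le> (real (Suc q) * real (Suc (Suc q))) * \<bar>c (Suc (Suc q))\<bar>"
      by (intro mult_right_mono) auto
    then show ?thesis by (simp add: abs_mult)
  qed
  \<comment> \<open>Dropping the factor \<open>(q + 1) * (q + 2)\<close> makes coefficients smaller
    in absolute value, so by monotonicity the mixed moment is bounded by a pure fourth
    power.\<close>
  have QG: "Q \<le> G2"
  proof -
    define d where "d = (\<lambda>q. \<bar>real (Suc q) * real (Suc (Suc q)) * c (Suc (Suc q))\<bar>)"
    define e where "e = (\<lambda>q. \<bar>c (Suc (Suc q))\<bar>)"
    have "expectation (\<lambda>\<omega>. \<Prod>a\<in>{0,1,2,3}. poly (he_comb m (four e d e d a)) (X 0 \<omega>))
        \<le> expectation (\<lambda>\<omega>. \<Prod>a\<in>{0,1,2,3}. poly (he_comb m (four d d d d a)) (X 0 \<omega>))"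
      by (rule expectation_he_comb_mono) (auto simp: four_def d_def e_def abs_le simp del: of_nat_Suc)
    then show ?thesis using G2 by (simp add: Q_def d_def e_def power4_eq_xxxx mult.assoc del: of_nat_Suc)
  qed
  have VarU: "expectation (\<lambda>\<omega>. (1 - U (x \<omega>))\<^sup>2) \<le> 4 * K\<^sup>2 * T * real (card I) * G2 / \<tau> ^ 4"
  proof -
    define a where "a i j = cov i j * cov i j" for i j
    define P where "P = pderiv (pderiv p)"
    define e where "e i j = expectation (\<lambda>\<omega>. poly p2 (X i \<omega>) * poly P (X j \<omega>))" for i j
    define e4 where "e4 i j k l = expectation (\<lambda>\<omega>. poly p2 (X i \<omega>) * poly P (X j \<omega>) * poly p2 (X k \<omega>) * poly P (X l \<omega>))" for i j k l
    have U_eq: "U (x \<omega>) = 1 / \<tau>\<^sup>2 * (\<Sum>i\<in>I. \<Sum>j\<in>I. a i j * (poly p2 (X i \<omega>) * poly P (X j \<omega>)))" for \<omega>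
      unfolding U_def W_def a_def P_def x_def sum_distrib_left by (intro sum.cong refl) (simp add: mult_ac)
    have "expectation (\<lambda>\<omega>. U (x \<omega>)) = 1 / \<tau>\<^sup>2 * (\<Sum>i\<in>I. \<Sum>j\<in>I. a i j * e i j)"
      unfolding U_eq e_def by (simp add: integrable_poly_mult2)
    then have EU': "1 = 1 / \<tau>\<^sup>2 * (\<Sum>i\<in>I. \<Sum>j\<in>I. a i j * e i j)" by (simp only: EU)
    have sq: "(\<Sum>i\<in>I. \<Sum>j\<in>I. f i j) * (\<Sum>k\<in>I. \<Sum>l\<in>I. f k l) = (\<Sum>i\<in>I. \<Sum>j\<in>I. \<Sum>k\<in>I. \<Sum>l\<in>I. f i j * f k l)" for f :: "nat \<Rightarrow> nat \<Rightarrow> real"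
      by (simp only: sum_distrib_right) (simp only: sum_distrib_left)
    \<comment> \<open>The square of the mean \<open>1\<close> is written as a fourfold sum, so that
      it can be subtracted term by term from the second moment of \<open>U\<close>.\<close>
    have one: "1 = 1 / \<tau> ^ 4 * (\<Sum>i\<in>I. \<Sum>j\<in>I. \<Sum>k\<in>I. \<Sum>l\<in>I. a i j * e i j * (a k l * e k l))"
    proof -
      have "1 = (1 / \<tau>\<^sup>2 * (\<Sum>i\<in>I. \<Sum>j\<in>I. a i j * e i j)) * (1 / \<tau>\<^sup>2 * (\<Sum>i\<in>I. \<Sum>j\<in>I. a i j * e i j))"
        by (simp only: EU'[symmetric] mult_1)
      also have "\<dots> = 1 / \<tau> ^ 4 * ((\<Sum>i\<in>I. \<Sum>j\<in>I. a i j * e i j) * (\<Sum>i\<in>I. \<Sum>j\<in>I. a i j * e i j))"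
        by (simp add: power2_eq_square power4_eq_xxxx mult_ac)
      finally show ?thesis unfolding sq .
    qed
    have "(U (x \<omega>))\<^sup>2 = 1 / \<tau> ^ 4 * (\<Sum>i\<in>I. \<Sum>j\<in>I. \<Sum>k\<in>I. \<Sum>l\<in>I. (a i j * a k l) *
        (poly p2 (X i \<omega>) * poly P (X j \<omega>) * poly p2 (X k \<omega>) * poly P (X l \<omega>)))" for \<omega>
    proof -
      have "(U (x \<omega>))\<^sup>2 = 1 / \<tau> ^ 4 * ((\<Sum>i\<in>I. \<Sum>j\<in>I. a i j * (poly p2 (X i \<omega>) * poly P (X j \<omega>))) *
          (\<Sum>i\<in>I. \<Sum>j\<in>I. a i j * (poly p2 (X i \<omega>) * poly P (X j \<omega>))))"
        unfolding U_eq by (simp add: power2_eq_square power4_eq_xxxx mult_ac)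
      then show ?thesis unfolding sq by (simp add: mult_ac)
    qed
    then have EU2: "expectation (\<lambda>\<omega>. (U (x \<omega>))\<^sup>2) = 1 / \<tau> ^ 4 * (\<Sum>i\<in>I. \<Sum>j\<in>I. \<Sum>k\<in>I. \<Sum>l\<in>I. (a i j * a k l) * e4 i j k l)"
      unfolding e4_def by (simp add: integrable_poly_mult4)
    have iU: "integrable M (\<lambda>\<omega>. U (x \<omega>))" "integrable M (\<lambda>\<omega>. (U (x \<omega>))\<^sup>2)"
      by (rule int[OF pgU], rule int[OF poly_growth_power[OF pgU]])
    have "(1 - U (x \<omega>))\<^sup>2 = 1 - 2 * U (x \<omega>) + (U (x \<omega>))\<^sup>2" for \<omega>
      by (simp add: power2_diff)
    then have "expectation (\<lambda>\<omega>. (1 - U (x \<omega>))\<^sup>2) = expectation (\<lambda>\<omega>. (U (x \<omega>))\<^sup>2) - 1"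
      using iU EU by (simp add: prob_space)
    also have "\<dots> = 1 / \<tau> ^ 4 * (\<Sum>i\<in>I. \<Sum>j\<in>I. \<Sum>k\<in>I. \<Sum>l\<in>I. (a i j * a k l) * (e4 i j k l - e i j * e k l))"
    proof -
      have "1 / \<tau> ^ 4 * (\<Sum>i\<in>I. \<Sum>j\<in>I. \<Sum>k\<in>I. \<Sum>l\<in>I. (a i j * a k l) * e4 i j k l)
          - 1 / \<tau> ^ 4 * (\<Sum>i\<in>I. \<Sum>j\<in>I. \<Sum>k\<in>I. \<Sum>l\<in>I. a i j * e i j * (a k l * e k l))
        = 1 / \<tau> ^ 4 * (\<Sum>i\<in>I. \<Sum>j\<in>I. \<Sum>k\<in>I. \<Sum>l\<in>I. (a i j * a k l) * (e4 i j k l - e i j * e k l))"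
        unfolding right_diff_distrib[symmetric] sum_subtractf[symmetric]
        by (intro arg_cong[where f="\<lambda>z. 1 / \<tau> ^ 4 * z"] sum.cong refl) (simp add: right_diff_distrib mult_ac)
      then show ?thesis unfolding EU2 using one by linarith
    qed
    also have "\<dots> \<le> 1 / \<tau> ^ 4 * (\<Sum>i\<in>I. \<Sum>j\<in>I. \<Sum>k\<in>I. \<Sum>l\<in>I. (a i j * a k l) * ((\<bar>cov i k\<bar> + \<bar>cov i l\<bar> + \<bar>cov j k\<bar> + \<bar>cov j l\<bar>) * G2))"
    proof (intro mult_left_mono sum_mono)
      fix i j k l
      have "e4 i j k l - e i j * e k l \<le> (\<bar>cov i k\<bar> + \<bar>cov i l\<bar> + \<bar>cov j k\<bar> + \<bar>cov j l\<bar>) * Q"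
        unfolding e4_def e_def P_def p'' p2_def Q_def by (rule order_trans[OF abs_ge_self four_factor_covariance])
      also have "\<dots> \<le> (\<bar>cov i k\<bar> + \<bar>cov i l\<bar> + \<bar>cov j k\<bar> + \<bar>cov j l\<bar>) * G2"
        by (intro mult_left_mono QG) simp
      finally show "e4 i j k l - e i j * e k l \<le> (\<bar>cov i k\<bar> + \<bar>cov i l\<bar> + \<bar>cov j k\<bar> + \<bar>cov j l\<bar>) * G2" .
    qed (use \<tau> in \<open>auto simp: a_def\<close>)
    also have "\<dots> = 1 / \<tau> ^ 4 * ((\<Sum>i\<in>I. \<Sum>j\<in>I. a i j * (\<Sum>k\<in>I. \<Sum>l\<in>I. a k l * (\<bar>cov i k\<bar> + \<bar>cov i l\<bar> + \<bar>cov j k\<bar> + \<bar>cov j l\<bar>))) * G2)"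
      unfolding sum_distrib_left sum_distrib_right by (simp only: mult.assoc)
    also have "\<dots> \<le> 1 / \<tau> ^ 4 * ((4 * K\<^sup>2 * T * real (card I)) * G2)"
    proof (intro mult_left_mono mult_right_mono)
      show "(\<Sum>i\<in>I. \<Sum>j\<in>I. a i j * (\<Sum>k\<in>I. \<Sum>l\<in>I. a k l * (\<bar>cov i k\<bar> + \<bar>cov i l\<bar> + \<bar>cov j k\<bar> + \<bar>cov j l\<bar>)))
          \<le> 4 * K\<^sup>2 * T * real (card I)"
      proof (rule sum_covariance_le[OF I])
        show "(\<Sum>j\<in>I. a i j) \<le> K" if "i \<in> I" for i
          using K[OF that that] by (simp add: a_def cov_commute[of _ i] abs_mult[symmetric])
      qed (use T in \<open>auto simp: a_def cov_commute\<close>)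
      show "0 \<le> G2" by (rule order_trans[OF _ G2]) simp
    qed (use \<tau> in auto)
    finally show ?thesis by simp
  qed
  have "0 \<le> G1" by (rule order_trans[OF _ G1]) simp
  have R_bound: "expectation (\<lambda>\<omega>. \<bar>R (x \<omega>)\<bar>) \<le> real (card I) * (S * (1 + G2 + 3 * (1 + 6 * K\<^sup>2) * G1)) / \<tau> ^ 3"
  proof -
    \<comment> \<open>The fourth moment of \<open>V i\<close> is of order
      \<open>S * (S + 6 * K^2)\<close>. Weighting the inequality of the means by \<open>S\<close>
      balances both summands at order \<open>S\<close>.\<close>
    define b where "b i \<omega> = S * (1 + poly p2 (X i \<omega>) ^ 4) + 1 / S * V i (x \<omega>) ^ 4" for i \<omega>
    have i4: "integrable M (\<lambda>\<omega>. poly p2 (X i \<omega>) ^ 4)" "integrable M (\<lambda>\<omega>. V i (x \<omega>) ^ 4)" for i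
    proof -
      show "integrable M (\<lambda>\<omega>. V i (x \<omega>) ^ 4)" by (rule int) (intro poly_growth_power pgV)
      have "poly_growth (\<lambda>x. poly p2 (x i) ^ 4)" by (intro poly_growth_intros)
      from int[OF this] show "integrable M (\<lambda>\<omega>. poly p2 (X i \<omega>) ^ 4)" by (simp add: x_def)
    qed
    have pt: "\<bar>poly p2 (X i \<omega>) * (V i (x \<omega>))\<^sup>2\<bar> \<le> b i \<omega>" for i \<omega>
    proof -
      define u v where "u = \<bar>poly p2 (X i \<omega>)\<bar>" and "v = (V i (x \<omega>))\<^sup>2"
      have v0: "0 \<le> v" "0 \<le> u" by (simp_all add: v_def u_def)
      have "0 \<le> (S * u - v)\<^sup>2" by simp
      then have 1: "2 * (S * (u * v)) \<le> S * (S * u\<^sup>2) + v\<^sup>2"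
        by (simp add: power2_diff power_mult_distrib power2_eq_square algebra_simps)
      \<comment> \<open>Passing from \<open>u^2\<close> to \<open>u^4\<close> makes the bound
        \<open>G2\<close> applicable to \<open>p2\<close>.\<close>
      have 2: "u\<^sup>2 \<le> 1 + u ^ 4"
      proof -
        have "0 \<le> (u\<^sup>2 - 1 / 2)\<^sup>2" by simp
        also have "\<dots> = (u\<^sup>2)\<^sup>2 - u\<^sup>2 + 1 / 4" unfolding power2_diff by (simp add: power2_eq_square)
        also have "(u\<^sup>2)\<^sup>2 = u ^ 4" by simp
        finally show ?thesis by linarith
      qed
      have "S * (S * u\<^sup>2) \<le> S * (S * (1 + u ^ 4))" using 2 S(2) by (intro mult_left_mono) auto
      then have "2 * (S * (u * v)) \<le> S * (S * (1 + u ^ 4)) + v\<^sup>2" using 1 by linarith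
      moreover have "0 \<le> S * (u * v)" using v0 S(2) by simp
      ultimately have "S * (u * v) \<le> S * (S * (1 + u ^ 4) + 1 / S * v\<^sup>2)"
        using S(2) by (simp add: distrib_left)
      then have "u * v \<le> S * (1 + u ^ 4) + 1 / S * v\<^sup>2" using S(2) by (simp add: mult_le_cancel_left_pos)
      moreover have "u ^ 4 = poly p2 (X i \<omega>) ^ 4" "v\<^sup>2 = V i (x \<omega>) ^ 4" by (simp_all add: u_def v_def)
      moreover have "\<bar>poly p2 (X i \<omega>) * (V i (x \<omega>))\<^sup>2\<bar> = u * v" by (simp add: u_def v_def abs_mult)
      ultimately show ?thesis by (simp only: b_def)
    qed
    have Eb: "expectation (b i) \<le> S * (1 + G2 + 3 * (1 + 6 * K\<^sup>2) * G1)" if i: "i \<in> I" for i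
    proof -
      have "expectation (b i) = S * (1 + expectation (\<lambda>\<omega>. poly p2 (X i \<omega>) ^ 4)) + 1 / S * expectation (\<lambda>\<omega>. V i (x \<omega>) ^ 4)"
        unfolding b_def[abs_def] using i4 by (simp add: prob_space)
      also have "\<dots> \<le> S * (1 + G2) + 1 / S * (3 * (S * (S + 6 * K\<^sup>2)) * G1)"
      proof (intro add_mono mult_left_mono)
        show "expectation (\<lambda>\<omega>. poly p2 (X i \<omega>) ^ 4) \<le> G2"
          unfolding p2_def by (rule order_trans[OF expectation_he_comb_power4_le[OF abs_le] G2])
        have "expectation (\<lambda>\<omega>. V i (x \<omega>) ^ 4) \<le> 3 * (S * (S + 6 * K\<^sup>2)) *
            expectation (\<lambda>\<omega>. poly (he_comb m (\<lambda>q. \<bar>real (Suc q) * c (Suc q)\<bar>)) (X 0 \<omega>) ^ 4)"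
          unfolding V_def x_def p' by (rule weighted_sum_power4_le) (use c(2) K S(1) i in auto)
        also have "\<dots> \<le> 3 * (S * (S + 6 * K\<^sup>2)) * G1"
          using S(2) by (intro mult_left_mono G1) auto
        finally show "expectation (\<lambda>\<omega>. V i (x \<omega>) ^ 4) \<le> 3 * (S * (S + 6 * K\<^sup>2)) * G1" .
      qed (use S(2) in auto)
      also have "1 / S * (3 * (S * (S + 6 * K\<^sup>2)) * G1) = 3 * (S + 6 * K\<^sup>2) * G1" using S(2) by simp
      \<comment> \<open>\<open>1 \<le> S\<close> allows a single factor \<open>S\<close> to be
        pulled out of both summands.\<close>
      also have "\<dots> \<le> 3 * (S * (1 + 6 * K\<^sup>2)) * G1"
      proof (intro mult_right_mono mult_left_mono)
        have "1 * (6 * K\<^sup>2) \<le> S * (6 * K\<^sup>2)" using S(2) by (intro mult_right_mono) auto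
        then show "S + 6 * K\<^sup>2 \<le> S * (1 + 6 * K\<^sup>2)" by (simp add: distrib_left)
      qed (use \<open>0 \<le> G1\<close> in auto)
      finally show ?thesis by (simp add: algebra_simps)
    qed
    have ib: "integrable M (b i)" for i unfolding b_def[abs_def] using i4 by simp
    have "expectation (\<lambda>\<omega>. \<bar>R (x \<omega>)\<bar>) \<le> expectation (\<lambda>\<omega>. 1 / \<tau> ^ 3 * (\<Sum>i\<in>I. b i \<omega>))"
    proof (rule integral_mono)
      show "integrable M (\<lambda>\<omega>. \<bar>R (x \<omega>)\<bar>)" by (intro integrable_abs int pgR)
      show "integrable M (\<lambda>\<omega>. 1 / \<tau> ^ 3 * (\<Sum>i\<in>I. b i \<omega>))" using ib by simp
      fix \<omega>
      have "\<bar>R (x \<omega>)\<bar> = 1 / \<tau> ^ 3 * \<bar>\<Sum>i\<in>I. poly p2 (X i \<omega>) * (V i (x \<omega>))\<^sup>2\<bar>"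
        unfolding R_def abs_mult using \<tau>(1) by (simp add: x_def)
      also have "\<dots> \<le> 1 / \<tau> ^ 3 * (\<Sum>i\<in>I. b i \<omega>)"
        using \<tau>(1) by (intro mult_left_mono order_trans[OF sum_abs] sum_mono pt) auto
      finally show "\<bar>R (x \<omega>)\<bar> \<le> 1 / \<tau> ^ 3 * (\<Sum>i\<in>I. b i \<omega>)" .
    qed
    also have "\<dots> = 1 / \<tau> ^ 3 * (\<Sum>i\<in>I. expectation (b i))" using ib by simp
    also have "\<dots> \<le> 1 / \<tau> ^ 3 * (\<Sum>i\<in>I. S * (1 + G2 + 3 * (1 + 6 * K\<^sup>2) * G1))"
      using \<tau>(1) by (intro mult_left_mono sum_mono Eb) auto
    finally show ?thesis by simp
  qed
  obtain f f' f'' :: "real \<Rightarrow> real" where f: "\<And>y. (f has_real_derivative f' y) (at y)" "\<And>y. (f' has_real_derivative f'' y) (at y)"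
    "continuous_on UNIV f''" "\<And>y. \<bar>f' y\<bar> \<le> 8" "\<And>y. \<bar>f'' y\<bar> \<le> 12"
    and stein: "\<And>y. f' y - y * f y = h y - (LINT y|lborel. std_normal_density y * h y)"
    by (rule stein_solution[OF h]; rule that)
  define mh where "mh = (LINT y|lborel. std_normal_density y * h y)"
  note pgf = pgf[OF f] and ident = identity[OF f]
  have i_f': "integrable M (\<lambda>\<omega>. f' (Y (x \<omega>)))" by (rule int[OF pgf(2)])
  have i_Yf: "integrable M (\<lambda>\<omega>. Y (x \<omega>) * f (Y (x \<omega>)))" by (rule int[OF poly_growth_mult[OF pgY pgf(1)]])
  have i_f'U: "integrable M (\<lambda>\<omega>. f' (Y (x \<omega>)) * U (x \<omega>))" by (rule int[OF poly_growth_mult[OF pgf(2) pgU]])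
  have i_f''R: "integrable M (\<lambda>\<omega>. f'' (Y (x \<omega>)) * R (x \<omega>))" by (rule int[OF poly_growth_mult[OF pgf(3) pgR]])
  have "h (Y (x \<omega>)) = mh + (f' (Y (x \<omega>)) - Y (x \<omega>) * f (Y (x \<omega>)))" for \<omega>
    using stein[of "Y (x \<omega>)"] by (simp add: mh_def)
  then have "expectation (\<lambda>\<omega>. h (Y (x \<omega>))) - mh = expectation (\<lambda>\<omega>. f' (Y (x \<omega>))) - expectation (\<lambda>\<omega>. Y (x \<omega>) * f (Y (x \<omega>)))"
    using i_f' i_Yf by (simp add: prob_space)
  also have "\<dots> = expectation (\<lambda>\<omega>. f' (Y (x \<omega>)) * (1 - U (x \<omega>))) - expectation (\<lambda>\<omega>. f'' (Y (x \<omega>)) * R (x \<omega>))"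
    unfolding ident using i_f' i_f'U i_f''R by (simp add: right_diff_distrib)
  finally have main: "expectation (\<lambda>\<omega>. h (Y (x \<omega>))) - mh
      = expectation (\<lambda>\<omega>. f' (Y (x \<omega>)) * (1 - U (x \<omega>))) - expectation (\<lambda>\<omega>. f'' (Y (x \<omega>)) * R (x \<omega>))" .
  have abs_prod_le: "\<bar>expectation (\<lambda>\<omega>. \<phi> (x \<omega>) * \<psi> (x \<omega>))\<bar> \<le> B * expectation (\<lambda>\<omega>. \<bar>\<psi> (x \<omega>)\<bar>)"
    if "poly_growth \<phi>" "poly_growth \<psi>" "\<And>x. \<bar>\<phi> x\<bar> \<le> B" for \<phi> \<psi> B
  proof -
    have "\<bar>expectation (\<lambda>\<omega>. \<phi> (x \<omega>) * \<psi> (x \<omega>))\<bar> \<le> expectation (\<lambda>\<omega>. \<bar>\<phi> (x \<omega>) * \<psi> (x \<omega>)\<bar>)"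
      using integral_norm_bound[of M "\<lambda>\<omega>. \<phi> (x \<omega>) * \<psi> (x \<omega>)"] unfolding real_norm_def .
    also have "\<dots> \<le> expectation (\<lambda>\<omega>. B * \<bar>\<psi> (x \<omega>)\<bar>)"
      unfolding abs_mult[symmetric] using int[OF poly_growth_mult[OF that(1,2)]] int[OF that(2)] that(3)
      by (intro integral_mono integrable_abs integrable_mult_right) (auto simp: abs_mult intro!: mult_right_mono)
    finally show ?thesis by simp
  qed
  have pg1U: "poly_growth (\<lambda>x. 1 - U x)"
    using poly_growth_add[OF poly_growth_const[of 1] poly_growth_mult[OF poly_growth_const[of "-1"] pgU]] by simp
  have "\<bar>expectation (\<lambda>\<omega>. h (Y (x \<omega>))) - mh\<bar> \<le> 8 * expectation (\<lambda>\<omega>. \<bar>1 - U (x \<omega>)\<bar>) + 12 * expectation (\<lambda>\<omega>. \<bar>R (x \<omega>)\<bar>)"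
    using abs_prod_le[OF pgf(2) pg1U f(4)] abs_prod_le[OF pgf(3) pgR f(5)] unfolding main by linarith
  also have "\<dots> \<le> 8 * (sqrt (4 * K\<^sup>2 * T * real (card I) * G2) / \<tau>\<^sup>2) + 12 * (real (card I) * (S * (1 + G2 + 3 * (1 + 6 * K\<^sup>2) * G1)) / \<tau> ^ 3)"
  proof (intro add_mono mult_left_mono R_bound)
    \<comment> \<open>As \<open>U\<close> has mean \<open>1\<close>, the second moment on the right
      is its variance.\<close>
    have "expectation (\<lambda>\<omega>. \<bar>1 - U (x \<omega>)\<bar>) \<le> sqrt (expectation (\<lambda>\<omega>. (1 - U (x \<omega>))\<^sup>2))"
      by (rule abs_expectation_le_sqrt) (rule int[OF pg1U], rule int[OF poly_growth_power[OF pg1U]])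
    also have "\<dots> \<le> sqrt (4 * K\<^sup>2 * T * real (card I) * G2 / \<tau> ^ 4)" using VarU by simp
    also have "\<dots> = sqrt (4 * K\<^sup>2 * T * real (card I) * G2) / \<tau>\<^sup>2"
      using real_sqrt_unique[of "\<tau>\<^sup>2" "\<tau> ^ 4"] \<tau>(1) by (simp add: real_sqrt_divide power_mult[symmetric])
    finally show "expectation (\<lambda>\<omega>. \<bar>1 - U (x \<omega>)\<bar>) \<le> sqrt (4 * K\<^sup>2 * T * real (card I) * G2) / \<tau>\<^sup>2" .
  qed auto
  finally show ?thesis by (simp add: Y_def x_def p_def mh_def)
qed

end

section \<open>Passage to the limit\<close>

text \<open>\<open>h\<close> is the average of \<open>f\<close> over
  \<open>[x, x + \<epsilon>]\<close>. Its derivative is a difference quotient of \<open>f\<close>,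
  so continuity and the bound \<open>1\<close> come for free, and by the mean value theorem
  \<open>h x\<close> is a value of \<open>f\<close> within distance \<open>\<epsilon>\<close> of
  \<open>x\<close>.\<close>

lemma lipschitz_smooth_approx:
  fixes f :: "real \<Rightarrow> real"
  assumes f: "1-lipschitz_on UNIV f" and \<epsilon>: "0 < \<epsilon>"
  obtains h h' :: "real \<Rightarrow> real" where "\<And>x. (h has_real_derivative h' x) (at x)"
    "continuous_on UNIV h'" "\<And>x. \<bar>h' x\<bar> \<le> 1" "\<And>x. \<bar>h x - f x\<bar> \<le> \<epsilon>"
proof -
  have cf: "continuous_on UNIV f" by (rule lipschitz_on_continuous_on[OF f])
  have "\<exists>F. \<forall>x. - \<infinity> < ereal x \<longrightarrow> ereal x < \<infinity> \<longrightarrow> (F has_vector_derivative f x) (at x)"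
    by (rule einterval_antiderivative) (use cf in \<open>auto simp: continuous_on_eq_continuous_at\<close>)
  then obtain F where F: "\<And>x. (F has_real_derivative f x) (at x)"
    by (auto simp: has_real_derivative_iff_has_vector_derivative)
  define h where "h x = (F (x + \<epsilon>) - F x) / \<epsilon>" for x
  define h' where "h' x = (f (x + \<epsilon>) - f x) / \<epsilon>" for x
  show thesis
  proof (rule that[of h h'])
    show "(h has_real_derivative h' x) (at x)" for x
    proof -
      have "((\<lambda>x. F (x + \<epsilon>)) has_real_derivative f (x + \<epsilon>) * 1) (at x)"
        by (rule DERIV_chain2[OF F]) (auto intro!: derivative_eq_intros)
      from DERIV_cdivide[OF DERIV_diff[OF this F], of \<epsilon>] show ?thesis by (simp add: h_def[abs_def] h'_def)
    qed
    show "continuous_on UNIV h'"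
      unfolding h'_def[abs_def] by (intro continuous_intros continuous_on_compose2[OF cf] cf) (use \<epsilon> in auto)
    show "\<bar>h' x\<bar> \<le> 1" for x
      using lipschitz_abs_le[OF f, of "x + \<epsilon>" x] \<epsilon> by (simp add: h'_def)
    show "\<bar>h x - f x\<bar> \<le> \<epsilon>" for x
    proof -
      obtain z where z: "x < z" "z < x + \<epsilon>" "F (x + \<epsilon>) - F x = (x + \<epsilon> - x) * f z"
        using MVT2[of x "x + \<epsilon>" F f] \<epsilon> F by auto
      then have "h x = f z" using \<epsilon> by (simp add: h_def)
      then show ?thesis using lipschitz_abs_le[OF f, of z x] z by linarith
    qed
  qed
qed

lemma abs_mult3_le:
  fixes a b c :: real
  assumes "0 \<le> a" "0 \<le> b" "0 \<le> c"
  shows "a * b * c \<le> (a ^ 3 + b ^ 3 + c ^ 3) / 3"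
proof -
  \<comment> \<open>The classical factorization of \<open>a^3 + b^3 + c^3 - 3 a b c\<close>,
    doubled.\<close>
  have "0 \<le> (a + b + c) * ((a - b)\<^sup>2 + (b - c)\<^sup>2 + (c - a)\<^sup>2)" using assms by simp
  also have "\<dots> = 2 * (a ^ 3 + b ^ 3 + c ^ 3 - 3 * (a * b * c))"
    by (simp add: power2_eq_square power3_eq_cube algebra_simps)
  finally show ?thesis by simp
qed

lemma powr_three_halves: "0 \<le> x \<Longrightarrow> x powr (3 / 2) = sqrt x ^ 3"
proof (cases "x = 0")
  case False
  assume "0 \<le> x"
  then have "x > 0" using False by simp
  then have "sqrt x ^ 3 = (x powr (1 / 2)) powr 3" by (simp add: powr_half_sqrt powr_numeral)
  then show ?thesis by (simp add: powr_powr)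
qed simp

context prob_space
begin

lemma integrable_of_square:
  fixes A :: "'a \<Rightarrow> real"
  assumes "A \<in> borel_measurable M" "integrable M (\<lambda>\<omega>. (A \<omega>)\<^sup>2)"
  shows "integrable M A"
  using integrable_mult_square[OF assms, of "\<lambda>_. 1"] by simp

lemma second_moment_tendsto:
  fixes Z :: "nat \<Rightarrow> 'a \<Rightarrow> real"
  assumes Z: "\<And>m. Z m \<in> borel_measurable M" "\<And>m. integrable M (\<lambda>\<omega>. (Z m \<omega>)\<^sup>2)"
    and Z': "Z' \<in> borel_measurable M" "integrable M (\<lambda>\<omega>. (Z' \<omega>)\<^sup>2)"
    and lim: "(\<lambda>m. expectation (\<lambda>\<omega>. (Z m \<omega> - Z' \<omega>)\<^sup>2)) \<longlonglongrightarrow> 0"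
  shows "(\<lambda>m. expectation (\<lambda>\<omega>. (Z m \<omega>)\<^sup>2)) \<longlonglongrightarrow> expectation (\<lambda>\<omega>. (Z' \<omega>)\<^sup>2)"
proof -
  define d where "d m = expectation (\<lambda>\<omega>. (Z m \<omega> - Z' \<omega>)\<^sup>2)" for m
  \<comment> \<open>The summand \<open>1 / (m + 1)\<close> keeps the weight positive when
    \<open>d m = 0\<close>, and \<open>t m \<ge> sqrt (d m)\<close> gives
    \<open>d m / t m \<le> sqrt (d m)\<close>.\<close>
  define t where "t m = sqrt (d m) + 1 / real (Suc m)" for m
  have d0: "0 \<le> d m" for m by (simp add: d_def)
  have t0: "0 < t m" for m unfolding t_def using d0[of m] by (intro add_nonneg_pos) auto
  have d: "d \<longlonglongrightarrow> 0" using lim by (simp add: d_def[abs_def])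
  then have sd: "(\<lambda>m. sqrt (d m)) \<longlonglongrightarrow> 0" using tendsto_real_sqrt[of d 0] by simp
  have "(\<lambda>m. 1 / real (Suc m)) \<longlonglongrightarrow> 0" using LIMSEQ_inverse_real_of_nat by (simp add: inverse_eq_divide)
  from tendsto_add[OF sd this] have t: "t \<longlonglongrightarrow> 0" by (simp add: t_def[abs_def])
  have iZ: "integrable M (\<lambda>\<omega>. (Z m \<omega> - Z' \<omega>)\<^sup>2)" for m
    using Z(2)[of m] Z'(2) integrable_mult_square[OF Z(1)[of m] Z(2)[of m] Z'] by (simp add: power2_diff mult.assoc)
  have bound: "\<bar>expectation (\<lambda>\<omega>. (Z m \<omega>)\<^sup>2) - expectation (\<lambda>\<omega>. (Z' \<omega>)\<^sup>2)\<bar>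
      \<le> d m + (t m * expectation (\<lambda>\<omega>. (Z' \<omega>)\<^sup>2) + sqrt (d m))" for m
  proof -
    have "\<bar>expectation (\<lambda>\<omega>. (Z m \<omega>)\<^sup>2) - expectation (\<lambda>\<omega>. (Z' \<omega>)\<^sup>2)\<bar> = \<bar>expectation (\<lambda>\<omega>. (Z m \<omega>)\<^sup>2 - (Z' \<omega>)\<^sup>2)\<bar>"
      using Z(2) Z'(2) by simp
    also have "\<dots> \<le> expectation (\<lambda>\<omega>. \<bar>(Z m \<omega>)\<^sup>2 - (Z' \<omega>)\<^sup>2\<bar>)"
      using integral_norm_bound[of M "\<lambda>\<omega>. (Z m \<omega>)\<^sup>2 - (Z' \<omega>)\<^sup>2"] unfolding real_norm_def .
    also have "\<dots> \<le> expectation (\<lambda>\<omega>. (Z m \<omega> - Z' \<omega>)\<^sup>2 + (t m * (Z' \<omega>)\<^sup>2 + (Z m \<omega> - Z' \<omega>)\<^sup>2 / t m))"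
    proof (rule integral_mono)
      show "integrable M (\<lambda>\<omega>. \<bar>(Z m \<omega>)\<^sup>2 - (Z' \<omega>)\<^sup>2\<bar>)" using Z(2) Z'(2) by (intro integrable_abs) simp
      show "integrable M (\<lambda>\<omega>. (Z m \<omega> - Z' \<omega>)\<^sup>2 + (t m * (Z' \<omega>)\<^sup>2 + (Z m \<omega> - Z' \<omega>)\<^sup>2 / t m))"
        using iZ[of m] Z'(2) by simp
      fix \<omega>
      define u v where "u = \<bar>Z m \<omega> - Z' \<omega>\<bar>" and "v = \<bar>Z' \<omega>\<bar>"
      have "0 \<le> (t m * v - u)\<^sup>2 / t m" using t0[of m] by simp
      also have "\<dots> = t m * v\<^sup>2 + u\<^sup>2 / t m - 2 * (u * v)"
        using t0[of m] by (simp add: power2_diff divide_simps) (simp add: power2_eq_square algebra_simps)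
      finally have 1: "2 * (u * v) \<le> t m * v\<^sup>2 + u\<^sup>2 / t m" by simp
      have "(Z m \<omega>)\<^sup>2 - (Z' \<omega>)\<^sup>2 = (Z m \<omega> - Z' \<omega>)\<^sup>2 + 2 * ((Z m \<omega> - Z' \<omega>) * Z' \<omega>)"
        by (simp add: power2_eq_square algebra_simps)
      then have "\<bar>(Z m \<omega>)\<^sup>2 - (Z' \<omega>)\<^sup>2\<bar> \<le> u\<^sup>2 + 2 * (u * v)"
        using abs_triangle_ineq[of "(Z m \<omega> - Z' \<omega>)\<^sup>2" "2 * ((Z m \<omega> - Z' \<omega>) * Z' \<omega>)"]
        by (simp add: u_def v_def abs_mult)
      then show "\<bar>(Z m \<omega>)\<^sup>2 - (Z' \<omega>)\<^sup>2\<bar> \<le> (Z m \<omega> - Z' \<omega>)\<^sup>2 + (t m * (Z' \<omega>)\<^sup>2 + (Z m \<omega> - Z' \<omega>)\<^sup>2 / t m)"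
        using 1 by (simp add: u_def v_def)
    qed
    also have "\<dots> = d m + (t m * expectation (\<lambda>\<omega>. (Z' \<omega>)\<^sup>2) + d m / t m)"
      using iZ[of m] Z'(2) by (simp add: d_def)
    also have "d m / t m \<le> sqrt (d m)"
    proof -
      have "d m = sqrt (d m) * sqrt (d m)" using d0 by simp
      also have "\<dots> \<le> sqrt (d m) * t m" using d0[of m] by (intro mult_left_mono) (auto simp: t_def)
      finally show ?thesis using t0[of m] by (simp add: divide_le_eq)
    qed
    finally show ?thesis by simp
  qed
  have "(\<lambda>m. d m + (t m * expectation (\<lambda>\<omega>. (Z' \<omega>)\<^sup>2) + sqrt (d m))) \<longlonglongrightarrow> 0 + (0 * expectation (\<lambda>\<omega>. (Z' \<omega>)\<^sup>2) + 0)"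
    by (intro tendsto_intros d t sd)
  then have z: "(\<lambda>m. d m + (t m * expectation (\<lambda>\<omega>. (Z' \<omega>)\<^sup>2) + sqrt (d m))) \<longlonglongrightarrow> 0" by simp
  have "(\<lambda>m. expectation (\<lambda>\<omega>. (Z m \<omega>)\<^sup>2) - expectation (\<lambda>\<omega>. (Z' \<omega>)\<^sup>2)) \<longlonglongrightarrow> 0"
  proof (rule Lim_null_comparison[OF always_eventually z], rule allI)
    fix m
    show "norm (expectation (\<lambda>\<omega>. (Z m \<omega>)\<^sup>2) - expectation (\<lambda>\<omega>. (Z' \<omega>)\<^sup>2))
        \<le> d m + (t m * expectation (\<lambda>\<omega>. (Z' \<omega>)\<^sup>2) + sqrt (d m))"
      unfolding real_norm_def by (rule bound)
  qed
  then show ?thesis by (rule LIM_zero_cancel)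
qed

lemma integrable_lipschitz:
  fixes h :: "real \<Rightarrow> real"
  assumes h: "1-lipschitz_on UNIV h" and "integrable M Z"
  shows "integrable M (\<lambda>\<omega>. h (Z \<omega>))"
proof (rule Bochner_Integration.integrable_bound)
  show "integrable M (\<lambda>\<omega>. \<bar>h 0\<bar> + \<bar>Z \<omega>\<bar>)" using assms(2) by simp
  have "h \<in> borel_measurable borel"
    using lipschitz_on_continuous_on[OF h] by (intro borel_measurable_continuous_onI)
  then show "(\<lambda>\<omega>. h (Z \<omega>)) \<in> borel_measurable M"
    using borel_measurable_integrable[OF assms(2)] by simp
  show "AE \<omega> in M. norm (h (Z \<omega>)) \<le> norm (\<bar>h 0\<bar> + \<bar>Z \<omega>\<bar>)"
  proof (rule AE_I2)
    fix \<omega>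
    show "norm (h (Z \<omega>)) \<le> norm (\<bar>h 0\<bar> + \<bar>Z \<omega>\<bar>)"
      using lipschitz_abs_le[OF h, of "Z \<omega>" 0] by simp
  qed
qed

text \<open>The normalizations \<open>\<tau> m\<close> may vary, so that a bound for smooth functions of \<open>Z m / \<tau> m\<close>
  passes to Lipschitz functions of \<open>Z' / \<tau>\<close> whenever \<open>Z m\<close> tends to \<open>Z'\<close> in mean square.\<close>

lemma lipschitz_bound_limit:
  fixes Z :: "nat \<Rightarrow> 'a \<Rightarrow> real" and B :: real
  assumes Z: "\<And>m. Z m \<in> borel_measurable M" "\<And>m. integrable M (\<lambda>\<omega>. (Z m \<omega>)\<^sup>2)"
    and Z': "Z' \<in> borel_measurable M" "integrable M (\<lambda>\<omega>. (Z' \<omega>)\<^sup>2)"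
    and lim: "(\<lambda>m. expectation (\<lambda>\<omega>. (Z m \<omega> - Z' \<omega>)\<^sup>2)) \<longlonglongrightarrow> 0"
    and \<tau>: "\<tau> \<longlonglongrightarrow> \<tau>'" "\<tau>' > 0"
    and B: "\<And>h h'. (\<And>x. (h has_real_derivative h' x) (at x)) \<Longrightarrow> continuous_on UNIV h' \<Longrightarrow> (\<And>x. \<bar>h' x\<bar> \<le> 1)
      \<Longrightarrow> \<forall>\<^sub>F m in sequentially. \<bar>expectation (\<lambda>\<omega>. h (Z m \<omega> / \<tau> m)) - (LINT y|lborel. std_normal_density y * h y)\<bar> \<le> B"
    and f: "1-lipschitz_on UNIV f"
  shows "\<bar>expectation (\<lambda>\<omega>. f (Z' \<omega> / \<tau>')) - (LINT y|lborel. std_normal_density y * f y)\<bar> \<le> B"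
proof (rule field_le_epsilon)
  fix e :: real assume "0 < e"
  \<comment> \<open>One half of \<open>e\<close> pays for smoothing \<open>f\<close> under the law
    of the sum, the other for smoothing it under the normal law.\<close>
  define \<epsilon> where "\<epsilon> = e / 2"
  have \<epsilon>: "0 < \<epsilon>" using \<open>0 < e\<close> by (simp add: \<epsilon>_def)
  obtain h h' :: "real \<Rightarrow> real" where h: "\<And>x. (h has_real_derivative h' x) (at x)"
    "continuous_on UNIV h'" "\<And>x. \<bar>h' x\<bar> \<le> 1" and hf: "\<And>x. \<bar>h x - f x\<bar> \<le> \<epsilon>"
    by (rule lipschitz_smooth_approx[OF f \<epsilon>]; rule that)
  have lh: "1-lipschitz_on UNIV h" by (rule C1_imp_lipschitz[OF h(1,3)])
  have iZ: "integrable M (Z m)" "integrable M Z'" for m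
    by (rule integrable_of_square[OF Z], rule integrable_of_square[OF Z'])
  have iZd: "integrable M (\<lambda>\<omega>. Z m \<omega> / \<tau> m)" "integrable M (\<lambda>\<omega>. Z' \<omega> / \<tau>')" for m using iZ by simp_all
  define \<delta> where "\<delta> m = expectation (\<lambda>\<omega>. \<bar>Z m \<omega> / \<tau> m - Z' \<omega> / \<tau>'\<bar>)" for m
  have iZ2: "integrable M (\<lambda>\<omega>. (Z m \<omega> - Z' \<omega>)\<^sup>2)" for m
    using Z(2)[of m] Z'(2) integrable_mult_square[OF Z(1)[of m] Z(2)[of m] Z'] by (simp add: power2_diff mult.assoc)
  \<comment> \<open>Separates the mean square distance of the sums from the change of normalization.
    The latter costs \<open>|1 / \<tau> m - 1 / \<tau>'|\<close> times the first absolute moment of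
    the limit, and it tends to \<open>0\<close> since \<open>\<tau>'\<close> is positive.\<close>
  have \<delta>_le: "\<delta> m \<le> 1 / \<bar>\<tau> m\<bar> * sqrt (expectation (\<lambda>\<omega>. (Z m \<omega> - Z' \<omega>)\<^sup>2)) + \<bar>1 / \<tau> m - 1 / \<tau>'\<bar> * expectation (\<lambda>\<omega>. \<bar>Z' \<omega>\<bar>)" for m
  proof -
    have "\<delta> m \<le> expectation (\<lambda>\<omega>. 1 / \<bar>\<tau> m\<bar> * \<bar>Z m \<omega> - Z' \<omega>\<bar> + \<bar>1 / \<tau> m - 1 / \<tau>'\<bar> * \<bar>Z' \<omega>\<bar>)"
      unfolding \<delta>_def
    proof (rule integral_mono)
      show "integrable M (\<lambda>\<omega>. \<bar>Z m \<omega> / \<tau> m - Z' \<omega> / \<tau>'\<bar>)"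
        using iZd by (intro integrable_abs Bochner_Integration.integrable_diff)
      show "integrable M (\<lambda>\<omega>. 1 / \<bar>\<tau> m\<bar> * \<bar>Z m \<omega> - Z' \<omega>\<bar> + \<bar>1 / \<tau> m - 1 / \<tau>'\<bar> * \<bar>Z' \<omega>\<bar>)"
        using iZ by (intro Bochner_Integration.integrable_add integrable_mult_right integrable_abs Bochner_Integration.integrable_diff)
      fix \<omega>
      have "Z m \<omega> / \<tau> m - Z' \<omega> / \<tau>' = 1 / \<tau> m * (Z m \<omega> - Z' \<omega>) + (1 / \<tau> m - 1 / \<tau>') * Z' \<omega>"
        by (simp add: algebra_simps)
      then show "\<bar>Z m \<omega> / \<tau> m - Z' \<omega> / \<tau>'\<bar> \<le> 1 / \<bar>\<tau> m\<bar> * \<bar>Z m \<omega> - Z' \<omega>\<bar> + \<bar>1 / \<tau> m - 1 / \<tau>'\<bar> * \<bar>Z' \<omega>\<bar>"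
        using abs_triangle_ineq[of "1 / \<tau> m * (Z m \<omega> - Z' \<omega>)" "(1 / \<tau> m - 1 / \<tau>') * Z' \<omega>"]
        by (simp only: abs_mult abs_divide abs_one)
    qed
    also have "\<dots> = 1 / \<bar>\<tau> m\<bar> * expectation (\<lambda>\<omega>. \<bar>Z m \<omega> - Z' \<omega>\<bar>) + \<bar>1 / \<tau> m - 1 / \<tau>'\<bar> * expectation (\<lambda>\<omega>. \<bar>Z' \<omega>\<bar>)"
      using iZ by (subst Bochner_Integration.integral_add) (auto intro!: integrable_mult_right integrable_abs Bochner_Integration.integrable_diff)
    also have "\<dots> \<le> 1 / \<bar>\<tau> m\<bar> * sqrt (expectation (\<lambda>\<omega>. (Z m \<omega> - Z' \<omega>)\<^sup>2)) + \<bar>1 / \<tau> m - 1 / \<tau>'\<bar> * expectation (\<lambda>\<omega>. \<bar>Z' \<omega>\<bar>)"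
    proof -
      have "expectation (\<lambda>\<omega>. \<bar>Z m \<omega> - Z' \<omega>\<bar>) \<le> sqrt (expectation (\<lambda>\<omega>. (Z m \<omega> - Z' \<omega>)\<^sup>2))"
        using iZ iZ2 by (intro abs_expectation_le_sqrt) auto
      then show ?thesis by (intro add_right_mono mult_left_mono) auto
    qed
    finally show ?thesis .
  qed
  have "(\<lambda>m. 1 / \<bar>\<tau> m\<bar> * sqrt (expectation (\<lambda>\<omega>. (Z m \<omega> - Z' \<omega>)\<^sup>2)) + \<bar>1 / \<tau> m - 1 / \<tau>'\<bar> * expectation (\<lambda>\<omega>. \<bar>Z' \<omega>\<bar>))
      \<longlonglongrightarrow> 1 / \<bar>\<tau>'\<bar> * sqrt 0 + \<bar>1 / \<tau>' - 1 / \<tau>'\<bar> * expectation (\<lambda>\<omega>. \<bar>Z' \<omega>\<bar>)"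
    using \<tau> by (intro tendsto_intros lim) auto
  then have z: "(\<lambda>m. 1 / \<bar>\<tau> m\<bar> * sqrt (expectation (\<lambda>\<omega>. (Z m \<omega> - Z' \<omega>)\<^sup>2)) + \<bar>1 / \<tau> m - 1 / \<tau>'\<bar> * expectation (\<lambda>\<omega>. \<bar>Z' \<omega>\<bar>)) \<longlonglongrightarrow> 0"
    by simp
  have \<delta>0: "\<delta> \<longlonglongrightarrow> 0"
  proof (rule Lim_null_comparison[OF always_eventually z], rule allI)
    fix m
    have "0 \<le> \<delta> m" by (simp add: \<delta>_def)
    then show "norm (\<delta> m) \<le> 1 / \<bar>\<tau> m\<bar> * sqrt (expectation (\<lambda>\<omega>. (Z m \<omega> - Z' \<omega>)\<^sup>2)) + \<bar>1 / \<tau> m - 1 / \<tau>'\<bar> * expectation (\<lambda>\<omega>. \<bar>Z' \<omega>\<bar>)"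
      using \<delta>_le[of m] by simp
  qed
  have mean: "\<bar>(LINT y|lborel. std_normal_density y * h y) - (LINT y|lborel. std_normal_density y * f y)\<bar> \<le> \<epsilon>"
  proof -
    note ih = lipschitz_integrable_normal[OF lh] and iff = lipschitz_integrable_normal[OF f]
    have i: "integrable lborel (\<lambda>y. std_normal_density y * h y - std_normal_density y * f y)" using ih iff by simp
    have "\<bar>(LINT y|lborel. std_normal_density y * h y) - (LINT y|lborel. std_normal_density y * f y)\<bar>
        = \<bar>LINT y|lborel. std_normal_density y * h y - std_normal_density y * f y\<bar>" using ih iff by simp
    also have "\<dots> \<le> (LINT y|lborel. \<bar>std_normal_density y * h y - std_normal_density y * f y\<bar>)"
      using integral_norm_bound[of lborel "\<lambda>y. std_normal_density y * h y - std_normal_density y * f y"] unfolding real_norm_def .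
    also have "\<dots> \<le> (LINT y|lborel. std_normal_density y * \<epsilon>)"
    proof (rule integral_mono[OF integrable_abs[OF i]])
      show "integrable lborel (\<lambda>y. std_normal_density y * \<epsilon>)" by simp
      show "\<bar>std_normal_density y * h y - std_normal_density y * f y\<bar> \<le> std_normal_density y * \<epsilon>" for y
        unfolding right_diff_distrib[symmetric] abs_mult abs_of_nonneg[OF normal_density_nonneg]
        by (intro mult_left_mono hf) simp
    qed
    finally show ?thesis by simp
  qed
  have approx: "\<bar>expectation (\<lambda>\<omega>. f (Z' \<omega> / \<tau>')) - expectation (\<lambda>\<omega>. h (Z m \<omega> / \<tau> m))\<bar> \<le> \<epsilon> + \<delta> m" for m
  proof -
    note i1 = integrable_lipschitz[OF f iZd(2)] and i2 = integrable_lipschitz[OF lh iZd(1)[of m]]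
    have "\<bar>expectation (\<lambda>\<omega>. f (Z' \<omega> / \<tau>')) - expectation (\<lambda>\<omega>. h (Z m \<omega> / \<tau> m))\<bar>
      = \<bar>expectation (\<lambda>\<omega>. f (Z' \<omega> / \<tau>') - h (Z m \<omega> / \<tau> m))\<bar>" using i1 i2 by simp
    also have "\<dots> \<le> expectation (\<lambda>\<omega>. \<bar>f (Z' \<omega> / \<tau>') - h (Z m \<omega> / \<tau> m)\<bar>)"
      using integral_norm_bound[of M "\<lambda>\<omega>. f (Z' \<omega> / \<tau>') - h (Z m \<omega> / \<tau> m)"] unfolding real_norm_def .
    also have "\<dots> \<le> expectation (\<lambda>\<omega>. \<epsilon> + \<bar>Z m \<omega> / \<tau> m - Z' \<omega> / \<tau>'\<bar>)"
    proof (rule integral_mono)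
      show "integrable M (\<lambda>\<omega>. \<bar>f (Z' \<omega> / \<tau>') - h (Z m \<omega> / \<tau> m)\<bar>)" using i1 i2 by (intro integrable_abs) simp
      show "integrable M (\<lambda>\<omega>. \<epsilon> + \<bar>Z m \<omega> / \<tau> m - Z' \<omega> / \<tau>'\<bar>)"
        using iZd by (intro Bochner_Integration.integrable_add integrable_abs Bochner_Integration.integrable_diff) auto
      show "\<bar>f (Z' \<omega> / \<tau>') - h (Z m \<omega> / \<tau> m)\<bar> \<le> \<epsilon> + \<bar>Z m \<omega> / \<tau> m - Z' \<omega> / \<tau>'\<bar>" for \<omega>
        using hf[of "Z' \<omega> / \<tau>'"] lipschitz_abs_le[OF lh, of "Z m \<omega> / \<tau> m" "Z' \<omega> / \<tau>'"] by linarith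
    qed
    also have "\<dots> = \<epsilon> + \<delta> m"
      unfolding \<delta>_def using iZd
      by (subst Bochner_Integration.integral_add) (auto intro!: integrable_abs Bochner_Integration.integrable_diff simp: prob_space)
    finally show ?thesis .
  qed
  have "\<forall>\<^sub>F m in sequentially. \<bar>expectation (\<lambda>\<omega>. f (Z' \<omega> / \<tau>')) - (LINT y|lborel. std_normal_density y * f y)\<bar> \<le> B + e + \<delta> m"
    using B[OF h]
  proof eventually_elim
    case (elim m)
    moreover have "e = \<epsilon> + \<epsilon>" by (simp add: \<epsilon>_def)
    ultimately show ?case using approx[of m] mean by linarith
  qed
  moreover have "(\<lambda>m. B + e + \<delta> m) \<longlonglongrightarrow> B + e + 0" by (intro tendsto_intros \<delta>0)
  ultimately have "\<bar>expectation (\<lambda>\<omega>. f (Z' \<omega> / \<tau>')) - (LINT y|lborel. std_normal_density y * f y)\<bar> \<le> B + e + 0"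
    by (intro tendsto_lowerbound[of "\<lambda>m. B + e + \<delta> m"]) auto
  then show "\<bar>expectation (\<lambda>\<omega>. f (Z' \<omega> / \<tau>')) - (LINT y|lborel. std_normal_density y * f y)\<bar> \<le> B + e" by simp
qed

end

context gaussian_process
begin

lemma distr_X_gauss: "distr M borel (X n) = \<gamma>"
  by (simp add: distr_X gauss_def)

lemma expectation_X:
  fixes F :: "real \<Rightarrow> real"
  assumes [measurable]: "F \<in> borel_measurable borel"
  shows "expectation (\<lambda>\<omega>. F (X n \<omega>)) = (LINT x|\<gamma>. F x)"
    and "integrable M (\<lambda>\<omega>. F (X n \<omega>)) \<longleftrightarrow> integrable \<gamma> F"
  unfolding distr_X_gauss[of n, symmetric] by (simp_all add: integral_distr integrable_distr_eq)

text \<open>Positivity of the mixed moments gives \<open>E(S\<^sup>4) \<le> E(S\<^sup>3 h)\<close> for the partial sums \<open>S\<close> of a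
  function \<open>h\<close> with nonnegative coefficients; Young's inequality does the rest.\<close>

lemma partial_sum_power4_le:
  assumes h: "h \<in> Lp_gauss 6" and d: "\<And>q. (LINT x|\<gamma>. h x * poly (He q) x) = fact q * d q" "\<And>q. 0 \<le> d q"
  shows "expectation (\<lambda>\<omega>. poly (he_comb m d) (X 0 \<omega>) ^ 4) \<le> (LINT x|\<gamma>. (h x) ^ 4)"
proof -
  note h2 = Lp_gauss_6_imp(1)[OF h] and h4 = Lp_gauss_6_imp(2)[OF h]
  note [measurable] = Lp_gauss_even(1)[OF h]
  define S where "S = he_comb m d"
  define T where "T = S ^ 3"
  have T: "poly T x = poly S x ^ 3" for x by (simp add: T_def)
  have TS: "poly T x * poly S x = poly S x ^ 4" for x unfolding T by (simp add: eval_nat_numeral)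
  define \<beta> where "\<beta> r = (LINT x|\<gamma>. poly T x * poly (He r) x)" for r
  \<comment> \<open>The pairing of \<open>S^3\<close> with \<open>He r\<close> is a mixed moment of
    four expansions with nonnegative coefficients in the single variable \<open>X 0\<close>,
    \<open>He r\<close> being the fourth.\<close>
  have \<beta>0: "0 \<le> \<beta> r" for r
  proof -
    define N where "N = max m r"
    define e where "e q = (if q \<le> m then d q else 0)" for q
    define \<delta> where "\<delta> q = (if q = r then 1 else 0 :: real)" for q
    have S_eq: "S = he_comb N e"
      unfolding S_def he_comb_def e_def N_def by (rule sum.mono_neutral_cong_left) auto
    have He_eq: "He r = he_comb N \<delta>"
    proof -
      have "he_comb N \<delta> = (\<Sum>q\<le>N. if q = r then He q else 0)"
        unfolding he_comb_def \<delta>_def by (intro sum.cong) auto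
      then show ?thesis by (simp add: N_def)
    qed
    have nonneg: "0 \<le> four e e e \<delta> a q" for a q by (simp add: four_def e_def \<delta>_def d(2))
    have "0 \<le> (\<Sum>q\<in>Pi\<^sub>E {0,1,2,3} (\<lambda>_. {..N}). (\<Prod>a\<in>{0,1,2,3}. four e e e \<delta> a (q a)) * hmoment (\<lambda>_. 0) {0,1,2,3} q)"
      by (intro sum_nonneg mult_nonneg_nonneg prod_nonneg ballI hmoment_0_nonneg nonneg) simp
    also have "\<dots> = expectation (\<lambda>\<omega>. \<Prod>a\<in>{0,1,2,3}. poly (he_comb N (four e e e \<delta> a)) (X 0 \<omega>))"
      by (rule expectation_he_comb_prod[where \<kappa>="\<lambda>_. 0", symmetric]) simp
    also have "\<dots> = expectation (\<lambda>\<omega>. poly T (X 0 \<omega>) * poly (He r) (X 0 \<omega>))"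
      unfolding S_eq[symmetric] He_eq by (simp add: S_eq[symmetric] T power3_eq_cube mult.assoc)
    also have "\<dots> = \<beta> r" unfolding \<beta>_def
      by (rule expectation_X(1)[where F="\<lambda>x. poly T x * poly (He r) x"]) (intro borel_measurable_times borel_measurable_poly)
    finally show ?thesis .
  qed
  \<comment> \<open>\<open>S^3\<close> is a finite Hermite sum, so its pairing with \<open>h\<close>
    is a finite sum of products of coefficients.\<close>
  obtain b where b: "T = (\<Sum>q\<le>degree T. smult (b q) (He q))" using poly_eq_He_sum by blast
  define D where "D = degree T"
  have S3: "poly T x = (\<Sum>q\<le>D. b q * poly (He q) x)" for x
    by (subst b) (simp add: poly_sum D_def)
  have \<beta>_eq: "\<beta> r = (if r \<le> D then b r * fact r else 0)" for r
  proof -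
    have "\<beta> r = (\<Sum>q\<le>D. b q * (LINT x|\<gamma>. poly (He q) x * poly (He r) x))"
      unfolding \<beta>_def S3 using integrable_gauss_poly_mult by (simp add: sum_distrib_right mult.assoc)
    also have "\<dots> = (\<Sum>q\<le>D. if q = r then b r * fact r else 0)"
      by (intro sum.cong) (auto simp: hermite_orthogonal)
    finally show ?thesis by simp
  qed
  have "poly T x * h x = (\<Sum>q\<le>D. b q * (h x * poly (He q) x))" for x
    unfolding S3 sum_distrib_right by (intro sum.cong refl) (simp only: mult_ac)
  then have "(LINT x|\<gamma>. poly T x * h x) = (\<Sum>q\<le>D. b q * (LINT x|\<gamma>. h x * poly (He q) x))"
    using integrable_gauss_mult_poly[OF h2] by (simp del: He.simps)
  also have "\<dots> = (\<Sum>q\<le>D. \<beta> q * d q)" by (intro sum.cong) (auto simp: d(1) \<beta>_eq)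
  also have "\<dots> = (\<Sum>q\<le>max D m. \<beta> q * d q)" by (rule sum.mono_neutral_left) (auto simp: \<beta>_eq)
  finally have S3h: "(LINT x|\<gamma>. poly T x * h x) = (\<Sum>q\<le>max D m. \<beta> q * d q)" .
  have "(LINT x|\<gamma>. poly T x * poly S x) = (\<Sum>q\<le>m. d q * \<beta> q)"
    unfolding S_def[THEN arg_cong[where f=poly]] poly_he_comb \<beta>_def
    using integrable_gauss_poly_mult by (simp add: sum_distrib_left mult.left_commute)
  then have "(LINT x|\<gamma>. (poly S x) ^ 4) = (\<Sum>q\<le>m. \<beta> q * d q)"
    unfolding TS by (simp add: mult.commute)
  \<comment> \<open>The fourth moment of \<open>S\<close> involves the coefficients of
    \<open>h\<close> up to \<open>m\<close> only; adding those up to \<open>D\<close> increases the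
    sum because all terms are nonnegative.\<close>
  also have "\<dots> \<le> (\<Sum>q\<le>max D m. \<beta> q * d q)" by (rule sum_mono2) (auto simp: \<beta>0 d(2))
  also have "\<dots> = (LINT x|\<gamma>. poly T x * h x)" by (rule S3h[symmetric])
  also have "\<dots> \<le> (LINT x|\<gamma>. 3 / 4 * (poly S x) ^ 4 + 1 / 4 * (h x) ^ 4)"
  proof (rule integral_mono)
    show "integrable \<gamma> (\<lambda>x. poly T x * h x)"
      using integrable_gauss_mult_poly[OF h2, of T] by (simp add: mult.commute)
    show "integrable \<gamma> (\<lambda>x. 3 / 4 * (poly S x) ^ 4 + 1 / 4 * (h x) ^ 4)"
      using h4 integrable_gauss_poly_mult[of T S] unfolding TS by simp
    fix x
    define u v where "u = poly S x" and "v = h x"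
    \<comment> \<open>Young's inequality with exponents 4/3 and 4 in factored form. Three quarters
      of the fourth moment of \<open>S\<close> are then absorbed on the left.\<close>
    have "0 \<le> (u - v)\<^sup>2 * ((u + v)\<^sup>2 + 2 * u\<^sup>2)" by simp
    also have "\<dots> = 3 * u ^ 4 + v ^ 4 - 4 * (u ^ 3 * v)"
      by (simp add: eval_nat_numeral algebra_simps)
    finally show "poly T x * h x \<le> 3 / 4 * (poly S x) ^ 4 + 1 / 4 * (h x) ^ 4"
      by (simp add: u_def v_def T)
  qed
  also have "\<dots> = 3 / 4 * (LINT x|\<gamma>. (poly S x) ^ 4) + 1 / 4 * (LINT x|\<gamma>. (h x) ^ 4)"
    using h4 integrable_gauss_poly_mult[of T S] unfolding TS by simp
  finally have "(LINT x|\<gamma>. (poly S x) ^ 4) \<le> (LINT x|\<gamma>. (h x) ^ 4)" by simp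
  moreover have "expectation (\<lambda>\<omega>. poly S (X 0 \<omega>) ^ 4) = (LINT x|\<gamma>. (poly S x) ^ 4)"
    by (rule expectation_X(1)[where F="\<lambda>x. (poly S x) ^ 4"]) (intro borel_measurable_power borel_measurable_poly)
  ultimately show ?thesis by (simp only: S_def)
qed

section \<open>Second moments of Hermite sums\<close>

lemma expectation_hermite_pair:
  "expectation (\<lambda>\<omega>. poly (He p) (X i \<omega>) * poly (He q) (X j \<omega>)) = (if p = q then fact p * cov i j ^ p else 0)"
proof (induction p arbitrary: q)
  case 0
  have "expectation (\<lambda>\<omega>. poly (He q) (X j \<omega>)) = (LINT x|\<gamma>. poly (He q) x)"
    by (rule expectation_X(1)[where F="poly (He q)"]) (rule borel_measurable_poly)
  then show ?case using hermite_orthogonal[of 0 q] by simp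
next
  case (Suc p)
  have "expectation (\<lambda>\<omega>. poly (He (Suc p)) (X i \<omega>) * poly (He q) (X j \<omega>))
      = expectation (\<lambda>\<omega>. poly (He p) (X i \<omega>) * (cov i j * poly (pderiv (He q)) (X j \<omega>)))"
    using hermite_integration_by_parts[OF dir_deriv_poly_component[of "cov i" "He q" j], of p] .
  also have "\<dots> = cov i j * real q * expectation (\<lambda>\<omega>. poly (He p) (X i \<omega>) * poly (He (q - 1)) (X j \<omega>))"
    by (simp add: pderiv_He mult_ac)
  finally show ?case using Suc by (cases q) (simp_all del: He.simps(2))
qed

text \<open>Different Hermite orders are orthogonal, and each contributes a nonnegative amount. Only
  order 2 is kept, and of it only the diagonal, where \<open>cov i i = 1\<close>. The bound does not
  depend on the truncation \<open>m\<close>, so it survives the limit.\<close>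

lemma second_moment_lower_bound:
  assumes "finite I" "2 \<le> m"
  shows "2 * (c 2)\<^sup>2 * real (card I) \<le> expectation (\<lambda>\<omega>. (\<Sum>i\<in>I. poly (he_comb m c) (X i \<omega>))\<^sup>2)"
proof -
  define N where "N q \<omega> = (\<Sum>i\<in>I. poly (He q) (X i \<omega>))" for q \<omega>
  have NN: "N p \<omega> * N q \<omega> = (\<Sum>i\<in>I. \<Sum>j\<in>I. poly (He p) (X i \<omega>) * poly (He q) (X j \<omega>))" for p q \<omega>
    unfolding N_def by (rule sum_product)
  have iN: "integrable M (\<lambda>\<omega>. N p \<omega> * N q \<omega>)" for p q
    unfolding NN by (intro Bochner_Integration.integrable_sum integrable_poly_mult2)
  have eN: "expectation (\<lambda>\<omega>. N p \<omega> * N q \<omega>) = (\<Sum>i\<in>I. \<Sum>j\<in>I. if p = q then fact p * cov i j ^ p else 0)" for p q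
    unfolding NN by (simp add: integrable_poly_mult2 expectation_hermite_pair)
  have "(\<Sum>i\<in>I. poly (he_comb m c) (X i \<omega>)) = (\<Sum>q\<le>m. c q * N q \<omega>)" for \<omega>
    unfolding poly_he_comb N_def sum_distrib_left by (rule sum.swap)
  then have "expectation (\<lambda>\<omega>. (\<Sum>i\<in>I. poly (he_comb m c) (X i \<omega>))\<^sup>2)
      = (\<Sum>p\<le>m. \<Sum>q\<le>m. (c p * c q) * expectation (\<lambda>\<omega>. N p \<omega> * N q \<omega>))"
    by (simp add: power2_eq_square sum_product iN mult_ac)
  also have "\<dots> = (\<Sum>p\<le>m. (c p)\<^sup>2 * expectation (\<lambda>\<omega>. N p \<omega> * N p \<omega>))"
  proof (rule sum.cong[OF refl])
    fix p assume "p \<in> {..m}"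
    have "(\<Sum>q\<le>m. (c p * c q) * expectation (\<lambda>\<omega>. N p \<omega> * N q \<omega>))
        = (\<Sum>q\<le>m. if q = p then (c p)\<^sup>2 * expectation (\<lambda>\<omega>. N p \<omega> * N p \<omega>) else 0)"
      by (intro sum.cong refl) (auto simp: eN power2_eq_square)
    then show "(\<Sum>q\<le>m. (c p * c q) * expectation (\<lambda>\<omega>. N p \<omega> * N q \<omega>)) = (c p)\<^sup>2 * expectation (\<lambda>\<omega>. N p \<omega> * N p \<omega>)"
      using \<open>p \<in> {..m}\<close> by simp
  qed
  also have "\<dots> \<ge> (c 2)\<^sup>2 * expectation (\<lambda>\<omega>. N 2 \<omega> * N 2 \<omega>)"
    by (rule member_le_sum[where f="\<lambda>p. (c p)\<^sup>2 * expectation (\<lambda>\<omega>. N p \<omega> * N p \<omega>)"]) (use assms(2) in auto)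
  moreover have "expectation (\<lambda>\<omega>. N 2 \<omega> * N 2 \<omega>) \<ge> 2 * real (card I)"
  proof -
    have "(\<Sum>i\<in>I. (2::real)) \<le> (\<Sum>i\<in>I. \<Sum>j\<in>I. fact 2 * cov i j ^ 2)"
    proof (rule sum_mono)
      fix i assume "i \<in> I"
      have "fact 2 * cov i i ^ 2 \<le> (\<Sum>j\<in>I. fact 2 * cov i j ^ 2)"
        by (rule member_le_sum) (use assms(1) \<open>i \<in> I\<close> in auto)
      then show "2 \<le> (\<Sum>j\<in>I. fact 2 * cov i j ^ 2)" by (simp add: cov_self)
    qed
    then show ?thesis by (simp add: eN mult.commute)
  qed
  then have "(c 2)\<^sup>2 * (2 * real (card I)) \<le> (c 2)\<^sup>2 * expectation (\<lambda>\<omega>. N 2 \<omega> * N 2 \<omega>)"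
    by (intro mult_left_mono) auto
  ultimately show ?thesis by (simp add: mult_ac)
qed

end

section \<open>Covariance sums of a stationary sequence\<close>

lemma sum_shift_le:
  fixes F :: "int \<Rightarrow> real"
  assumes F: "\<And>k. 0 \<le> F k" and i: "i \<in> {1..n}"
  shows "(\<Sum>j\<in>{1..n}. F (int i - int j)) \<le> (\<Sum>k\<in>{- int n..int n}. F k)"
proof -
  have "(\<Sum>j\<in>{1..n}. F (int i - int j)) = sum F ((\<lambda>j. int i - int j) ` {1..n})"
    by (subst sum.reindex) (auto simp: inj_on_def)
  also have "\<dots> \<le> (\<Sum>k\<in>{- int n..int n}. F k)"
    using i by (intro sum_mono2 F) auto
  finally show ?thesis .
qed

text \<open>The law is invariant under the shift by \<open>m\<close>; this is tested with the
  product of the coordinates \<open>0\<close> and \<open>k\<close>.\<close>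

lemma (in gaussian_process) cov_stationary:
  assumes st: "stationary_sequence M X"
    and \<rho>: "\<And>k. \<rho> k = expectation (\<lambda>\<omega>. X 0 \<omega> * X (nat \<bar>k\<bar>) \<omega>)"
  shows "cov i j = \<rho> (int i - int j)"
proof -
  have shift: "cov m (m + k) = cov 0 k" for m k
  proof -
    define g where "g x = x 0 * x k" for x :: "nat \<Rightarrow> real"
    have g: "g \<in> borel_measurable RN"
      unfolding g_def[abs_def] by (intro borel_measurable_times measurable_RN_component)
    have 1: "(\<lambda>\<omega> n. X (n + m) \<omega>) \<in> measurable M RN" "(\<lambda>\<omega> n. X n \<omega>) \<in> measurable M RN"
      by (rule measurable_RN_I, simp)+
    have "cov m (m + k) = expectation (\<lambda>\<omega>. g (\<lambda>n. X (n + m) \<omega>))"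
      by (simp add: cov_def g_def add.commute)
    also have "\<dots> = integral\<^sup>L (distr M RN (\<lambda>\<omega> n. X (n + m) \<omega>)) g"
      by (rule integral_distr[OF 1(1) g, symmetric])
    also have "distr M RN (\<lambda>\<omega> n. X (n + m) \<omega>) = distr M RN (\<lambda>\<omega> n. X n \<omega>)"
      using st unfolding stationary_sequence_def by blast
    also have "integral\<^sup>L (distr M RN (\<lambda>\<omega> n. X n \<omega>)) g = expectation (\<lambda>\<omega>. g (\<lambda>n. X n \<omega>))"
      by (rule integral_distr[OF 1(2) g])
    also have "\<dots> = cov 0 k" by (simp add: cov_def g_def)
    finally show ?thesis .
  qed
  have \<rho>': "\<rho> k = cov 0 (nat \<bar>k\<bar>)" for k by (simp add: \<rho> cov_def)
  show ?thesis
  proof (cases "i \<le> j")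
    case True
    then have "cov i j = cov 0 (j - i)" using shift[of i "j - i"] by simp
    moreover have "nat \<bar>int i - int j\<bar> = j - i" using True by simp
    ultimately show ?thesis by (simp only: \<rho>')
  next
    case False
    then have "cov i j = cov 0 (i - j)" using shift[of j "i - j"] by (simp add: cov_commute[of i j])
    moreover have "nat \<bar>int i - int j\<bar> = i - j" using False by simp
    ultimately show ?thesis by (simp only: \<rho>')
  qed
qed

text \<open>The third estimate is the decisive one. Splitting each edge of the triangle
  \<open>i, j, k\<close> into two factors \<open>sqrt |cov|\<close> turns its weight into a product
  over the three paths of length two. The inequality of the means cubes these, so each edge carries
  the power 3/2, and each of the three path sums is at most \<open>s^2\<close>. The last estimate
  holds since \<open>\<rho> 0 = 1\<close>.\<close>

lemma (in gaussian_process) stationary_sum_bounds: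
  assumes cov: "\<And>i j. cov i j = \<rho> (int i - int j)"
    and sq: "(\<lambda>j::int. \<bar>\<rho> j\<bar>\<^sup>2) summable_on UNIV"
    and i: "i \<in> {1..n}"
  shows "(\<Sum>k\<in>{1..n}. \<bar>cov i k\<bar>) \<le> (\<Sum>k\<in>{- int n..int n}. \<bar>\<rho> k\<bar>)"
    and "a \<in> {1..n} \<Longrightarrow> (\<Sum>l\<in>{1..n}. \<bar>cov i l\<bar> * \<bar>cov l a\<bar>) \<le> infsum (\<lambda>j. \<bar>\<rho> j\<bar>\<^sup>2) UNIV"
    and "(\<Sum>j\<in>{1..n}. \<Sum>k\<in>{1..n}. \<bar>cov i j\<bar> * \<bar>cov i k\<bar> * \<bar>cov j k\<bar>)
      \<le> (\<Sum>k\<in>{- int n..int n}. \<bar>\<rho> k\<bar> powr (3 / 2))\<^sup>2"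
    and "1 \<le> (\<Sum>k\<in>{- int n..int n}. \<bar>\<rho> k\<bar> powr (3 / 2))\<^sup>2"
proof -
  show "(\<Sum>k\<in>{1..n}. \<bar>cov i k\<bar>) \<le> (\<Sum>k\<in>{- int n..int n}. \<bar>\<rho> k\<bar>)"
    unfolding cov by (rule sum_shift_le) (use i in auto)
  show "(\<Sum>l\<in>{1..n}. \<bar>cov i l\<bar> * \<bar>cov l a\<bar>) \<le> infsum (\<lambda>j. \<bar>\<rho> j\<bar>\<^sup>2) UNIV" if a: "a \<in> {1..n}"
  proof -
    have row: "(\<Sum>l\<in>{1..n}. \<bar>cov b l\<bar>\<^sup>2) \<le> infsum (\<lambda>j. \<bar>\<rho> j\<bar>\<^sup>2) UNIV" if "b \<in> {1..n}" for b
    proof -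
      have "(\<Sum>l\<in>{1..n}. \<bar>cov b l\<bar>\<^sup>2) \<le> (\<Sum>k\<in>{- int n..int n}. \<bar>\<rho> k\<bar>\<^sup>2)"
        unfolding cov by (rule sum_shift_le[where F="\<lambda>k. \<bar>\<rho> k\<bar>\<^sup>2"]) (use that in auto)
      also have "\<dots> \<le> infsum (\<lambda>j. \<bar>\<rho> j\<bar>\<^sup>2) UNIV" by (rule finite_sum_le_infsum[OF sq]) auto
      finally show ?thesis .
    qed
    have "(\<Sum>l\<in>{1..n}. \<bar>cov i l\<bar> * \<bar>cov l a\<bar>) \<le> (\<Sum>l\<in>{1..n}. (\<bar>cov i l\<bar>\<^sup>2 + \<bar>cov a l\<bar>\<^sup>2) / 2)"
    proof (rule sum_mono)
      fix l
      show "\<bar>cov i l\<bar> * \<bar>cov l a\<bar> \<le> (\<bar>cov i l\<bar>\<^sup>2 + \<bar>cov a l\<bar>\<^sup>2) / 2"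
        using sum_squares_bound[of "\<bar>cov i l\<bar>" "\<bar>cov l a\<bar>"] by (simp add: cov_commute[of l a])
    qed
    also have "\<dots> = ((\<Sum>l\<in>{1..n}. \<bar>cov i l\<bar>\<^sup>2) + (\<Sum>l\<in>{1..n}. \<bar>cov a l\<bar>\<^sup>2)) / 2"
      by (simp only: sum_divide_distrib[symmetric] sum.distrib)
    also have "\<dots> \<le> infsum (\<lambda>j. \<bar>\<rho> j\<bar>\<^sup>2) UNIV" using add_mono[OF row[OF i] row[OF a]] by simp
    finally show ?thesis .
  qed
  define s where "s = (\<Sum>k\<in>{- int n..int n}. \<bar>\<rho> k\<bar> powr (3 / 2))"
  define g where "g i j = sqrt \<bar>cov i j\<bar>" for i j
  have g0: "0 \<le> g i j" for i j by (simp add: g_def)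
  have g_comm: "g i j = g j i" for i j by (simp add: g_def cov_commute[of i j])
  have gg: "\<bar>cov i j\<bar> = g i j * g i j" for i j by (simp add: g_def)
  have row: "(\<Sum>j\<in>{1..n}. g b j ^ 3) \<le> s" if "b \<in> {1..n}" for b
  proof -
    have "(\<Sum>j\<in>{1..n}. g b j ^ 3) = (\<Sum>j\<in>{1..n}. \<bar>\<rho> (int b - int j)\<bar> powr (3 / 2))"
      by (intro sum.cong) (simp_all add: g_def cov powr_three_halves)
    also have "\<dots> \<le> s"
      unfolding s_def by (rule sum_shift_le[where F="\<lambda>k. \<bar>\<rho> k\<bar> powr (3 / 2)"]) (use that in auto)
    finally show ?thesis .
  qed
  have s0: "0 \<le> s" unfolding s_def by (intro sum_nonneg) simp
  have path: "(\<Sum>j\<in>{1..n}. \<Sum>k\<in>{1..n}. g i j ^ 3 * g j k ^ 3) \<le> s\<^sup>2"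
  proof -
    have "(\<Sum>j\<in>{1..n}. \<Sum>k\<in>{1..n}. g i j ^ 3 * g j k ^ 3) = (\<Sum>j\<in>{1..n}. g i j ^ 3 * (\<Sum>k\<in>{1..n}. g j k ^ 3))"
      by (simp add: sum_distrib_left)
    also have "\<dots> \<le> (\<Sum>j\<in>{1..n}. g i j ^ 3 * s)" by (intro sum_mono mult_left_mono row) (simp_all add: g0)
    also have "\<dots> = (\<Sum>j\<in>{1..n}. g i j ^ 3) * s" by (simp add: sum_distrib_right)
    also have "\<dots> \<le> s * s" by (intro mult_right_mono row i s0)
    finally show ?thesis by (simp add: power2_eq_square)
  qed
  have "(\<Sum>j\<in>{1..n}. \<Sum>k\<in>{1..n}. \<bar>cov i j\<bar> * \<bar>cov i k\<bar> * \<bar>cov j k\<bar>)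
      \<le> (\<Sum>j\<in>{1..n}. \<Sum>k\<in>{1..n}. (g i j ^ 3 * g i k ^ 3 + g i j ^ 3 * g j k ^ 3 + g i k ^ 3 * g k j ^ 3) / 3)"
  proof (intro sum_mono)
    fix j k
    have "\<bar>cov i j\<bar> * \<bar>cov i k\<bar> * \<bar>cov j k\<bar> = (g i j * g i k) * (g i j * g j k) * (g i k * g j k)"
      by (simp add: gg mult_ac)
    also have "\<dots> \<le> ((g i j * g i k) ^ 3 + (g i j * g j k) ^ 3 + (g i k * g j k) ^ 3) / 3"
      by (intro abs_mult3_le mult_nonneg_nonneg g0)
    finally show "\<bar>cov i j\<bar> * \<bar>cov i k\<bar> * \<bar>cov j k\<bar>
        \<le> (g i j ^ 3 * g i k ^ 3 + g i j ^ 3 * g j k ^ 3 + g i k ^ 3 * g k j ^ 3) / 3"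
      by (simp add: power_mult_distrib g_comm[of k j])
  qed
  also have "\<dots> = ((\<Sum>j\<in>{1..n}. \<Sum>k\<in>{1..n}. g i j ^ 3 * g i k ^ 3) + (\<Sum>j\<in>{1..n}. \<Sum>k\<in>{1..n}. g i j ^ 3 * g j k ^ 3)
      + (\<Sum>j\<in>{1..n}. \<Sum>k\<in>{1..n}. g i k ^ 3 * g k j ^ 3)) / 3"
    by (simp only: sum_divide_distrib[symmetric] sum.distrib)
  also have "(\<Sum>j\<in>{1..n}. \<Sum>k\<in>{1..n}. g i k ^ 3 * g k j ^ 3) = (\<Sum>j\<in>{1..n}. \<Sum>k\<in>{1..n}. g i j ^ 3 * g j k ^ 3)"
    by (rule sum.swap)
  also have "(\<Sum>j\<in>{1..n}. \<Sum>k\<in>{1..n}. g i j ^ 3 * g i k ^ 3) = (\<Sum>j\<in>{1..n}. g i j ^ 3)\<^sup>2"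
    by (simp add: power2_eq_square sum_product)
  also have "\<dots> \<le> s\<^sup>2" by (intro power_mono row i sum_nonneg) (simp add: g0)
  finally show "(\<Sum>j\<in>{1..n}. \<Sum>k\<in>{1..n}. \<bar>cov i j\<bar> * \<bar>cov i k\<bar> * \<bar>cov j k\<bar>)
      \<le> (\<Sum>k\<in>{- int n..int n}. \<bar>\<rho> k\<bar> powr (3 / 2))\<^sup>2"
    using path unfolding s_def[symmetric] by simp
  have "\<rho> 0 = 1" using cov[of 0 0] cov_self[of 0] by simp
  then have "1 \<le> s"
    unfolding s_def using member_le_sum[of 0 "{- int n..int n}" "\<lambda>k. \<bar>\<rho> k\<bar> powr (3 / 2)"] by simp
  then show "1 \<le> (\<Sum>k\<in>{- int n..int n}. \<bar>\<rho> k\<bar> powr (3 / 2))\<^sup>2"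
    unfolding s_def[symmetric] by (simp add: one_le_power)
qed

section \<open>Uniform constants and removal of the truncation\<close>

lemma (in gaussian_process) wasserstein_bound:
  fixes \<rho> :: "int \<Rightarrow> real" and g Ag :: "real \<Rightarrow> real"
  assumes cov: "\<And>i j. cov i j = \<rho> (int i - int j)"
    and rank: "has_hermite_rank g 2" and A: "is_A g Ag" and sob: "Ag \<in> sobolev_gauss 2 6"
    and sq: "(\<lambda>j::int. \<bar>\<rho> j\<bar>\<^sup>2) summable_on UNIV"
  obtains C where "\<And>n f. 1 \<le> n \<Longrightarrow> 1-lipschitz_on UNIV f \<Longrightarrow>
    \<bar>expectation (\<lambda>\<omega>. f (Y_seq M g X n \<omega>)) - (LINT y|lborel. std_normal_density y * f y)\<bar>
      \<le> C * real n powr (-1/2) * (\<Sum>k\<in>{- int n..int n}. \<bar>\<rho> k\<bar>) powr (1/2)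
        + C * real n powr (-1/2) * (\<Sum>k\<in>{- int n..int n}. \<bar>\<rho> k\<bar> powr (3/2))\<^sup>2"
proof -
  obtain c0 where c0: "has_hermite_expansion g c0" "\<And>q. q < 2 \<Longrightarrow> c0 q = 0" "c0 2 \<noteq> 0"
    using rank unfolding has_hermite_rank_def by blast
  obtain c where c: "has_hermite_expansion g c" "has_hermite_expansion Ag (\<lambda>q. \<bar>c q\<bar>)"
    using A unfolding is_A_def by blast
  have "c q = c0 q" for q
    using hermite_expansion_coeff[OF c(1), of q] hermite_expansion_coeff[OF c0(1), of q] by simp
  then have c01: "c 0 = 0" "c 1 = 0" "c 2 \<noteq> 0" using c0 by auto
  obtain D where D: "D 0 = Ag" "\<And>j. j < 2 \<Longrightarrow> has_weak_deriv (D j) (D (Suc j))" "\<And>j. j \<le> 2 \<Longrightarrow> D j \<in> Lp_gauss 6"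
    using sob unfolding sobolev_gauss_def by blast
  note DL = D(3)[THEN Lp_gauss_6_imp(1)]
  have coeff0: "(LINT x|\<gamma>. D 0 x * poly (He q) x) = fact q * \<bar>c q\<bar>" for q
    using hermite_expansion_coeff[OF c(2)] D(1) by simp
  \<comment> \<open>Differentiation preserves the nonnegativity of the coefficients of
    \<open>A(g)\<close>, which the comparison of partial sums with their limit requires.\<close>
  have coeff1: "(LINT x|\<gamma>. D 1 x * poly (He q) x) = fact q * (real (Suc q) * \<bar>c (Suc q)\<bar>)" for q
    using weak_deriv_hermite_coeff[OF D(2)[of 0], of q] DL[of 0] DL[of 1] coeff0[of "Suc q"]
    by (simp add: mult_ac del: He.simps)
  have coeff2: "(LINT x|\<gamma>. D 2 x * poly (He q) x) = fact q * (real (Suc q) * real (Suc (Suc q)) * \<bar>c (Suc (Suc q))\<bar>)" for q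
    using weak_deriv_hermite_coeff[OF D(2)[of 1], of q] DL[of 1] DL[of 2] coeff1[of "Suc q"]
    by (simp add: mult_ac numeral_2_eq_2 del: He.simps)
  define G1 where "G1 = (LINT x|\<gamma>. (D 1 x) ^ 4)"
  define G2 where "G2 = (LINT x|\<gamma>. (D 2 x) ^ 4)"
  \<comment> \<open>The polynomial bound wants coefficients that vanish beyond \<open>m\<close>;
    \<open>he_comb m\<close> does not see the difference, but the shifted coefficients of the
    derivatives do.\<close>
  define ct where "ct m q = (if q \<le> m then c q else 0)" for m q :: nat
  have G1_le: "expectation (\<lambda>\<omega>. poly (he_comb m (\<lambda>q. \<bar>real (Suc q) * ct m (Suc q)\<bar>)) (X 0 \<omega>) ^ 4) \<le> G1" for m
  proof -
    have "expectation (\<lambda>\<omega>. poly (he_comb m (\<lambda>q. \<bar>real (Suc q) * ct m (Suc q)\<bar>)) (X 0 \<omega>) ^ 4)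
        \<le> expectation (\<lambda>\<omega>. poly (he_comb m (\<lambda>q. real (Suc q) * \<bar>c (Suc q)\<bar>)) (X 0 \<omega>) ^ 4)"
      by (rule expectation_he_comb_power4_le) (simp add: ct_def abs_mult)
    also have "\<dots> \<le> G1"
      unfolding G1_def by (rule partial_sum_power4_le[OF D(3) coeff1]) simp_all
    finally show ?thesis .
  qed
  have G2_le: "expectation (\<lambda>\<omega>. poly (he_comb m (\<lambda>q. \<bar>real (Suc q) * real (Suc (Suc q)) * ct m (Suc (Suc q))\<bar>)) (X 0 \<omega>) ^ 4) \<le> G2" for m
  proof -
    have "expectation (\<lambda>\<omega>. poly (he_comb m (\<lambda>q. \<bar>real (Suc q) * real (Suc (Suc q)) * ct m (Suc (Suc q))\<bar>)) (X 0 \<omega>) ^ 4)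
        \<le> expectation (\<lambda>\<omega>. poly (he_comb m (\<lambda>q. real (Suc q) * real (Suc (Suc q)) * \<bar>c (Suc (Suc q))\<bar>)) (X 0 \<omega>) ^ 4)"
      by (rule expectation_he_comb_power4_le) (simp add: ct_def abs_mult)
    also have "\<dots> \<le> G2"
      unfolding G2_def by (rule partial_sum_power4_le[OF D(3) coeff2]) simp_all
    finally show ?thesis .
  qed
  have G0: "0 \<le> G1" "0 \<le> G2" by (simp_all add: G1_def G2_def)
  define K where "K = infsum (\<lambda>j. \<bar>\<rho> j\<bar>\<^sup>2) UNIV"
  have K0: "0 \<le> K" unfolding K_def by (rule infsum_nonneg) simp
  define v where "v = 2 * (c 2)\<^sup>2"
  have v: "0 < v" using c01 by (simp add: v_def)
  \<comment> \<open>Here \<open>16 = 8 * sqrt 4\<close>, and \<open>v * n\<close> is the lower bound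
    for the second moment of the unnormalized sum. Neither \<open>C1\<close> nor \<open>C2\<close>
    depends on \<open>n\<close> or on the truncation.\<close>
  define C1 where "C1 = 16 * K * sqrt G2 / v"
  define C2 where "C2 = 12 * (1 + G2 + 3 * (1 + 6 * K\<^sup>2) * G1) / sqrt v ^ 3"
  have C0: "0 \<le> C1" "0 \<le> C2" using G0 K0 v by (simp_all add: C1_def C2_def)
  have gL: "g \<in> Lp_gauss 2" using c(1) by (simp add: has_hermite_expansion_def)
  note [measurable] = Lp_gauss_2D(1)[OF gL]
  define P where "P m = he_comb m c" for m
  have P_ct: "P m = he_comb m (ct m)" for m
    unfolding P_def he_comb_def ct_def by (intro sum.cong) auto
  define a where "a m = (LINT x|\<gamma>. (g x - poly (P m) x)\<^sup>2)" for m
  have a0: "a \<longlonglongrightarrow> 0"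
    using c(1) by (simp add: has_hermite_expansion_def a_def[abs_def] P_def poly_he_comb hermite_eq_poly)
  have main: "\<bar>expectation (\<lambda>\<omega>. f (Y_seq M g X n \<omega>)) - (LINT y|lborel. std_normal_density y * f y)\<bar>
      \<le> (C1 + C2) * real n powr (-1/2) * (\<Sum>k\<in>{- int n..int n}. \<bar>\<rho> k\<bar>) powr (1/2)
        + (C1 + C2) * real n powr (-1/2) * (\<Sum>k\<in>{- int n..int n}. \<bar>\<rho> k\<bar> powr (3/2))\<^sup>2"
    if n: "1 \<le> n" and f: "1-lipschitz_on UNIV f" for n f
  proof -
    define I where "I = {1..n}"
    have I: "finite I" "card I = n" by (simp_all add: I_def)
    define T where "T = (\<Sum>k\<in>{- int n..int n}. \<bar>\<rho> k\<bar>)"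
    define S where "S = (\<Sum>k\<in>{- int n..int n}. \<bar>\<rho> k\<bar> powr (3/2))\<^sup>2"
    have T0: "0 \<le> T" by (simp add: T_def sum_nonneg)
    have S1: "1 \<le> S" unfolding S_def by (rule stationary_sum_bounds(4)[OF cov sq, of n]) (use n in simp)
    define Z where "Z m \<omega> = (\<Sum>i\<in>I. poly (P m) (X i \<omega>))" for m \<omega>
    define Z' where "Z' \<omega> = (\<Sum>i\<in>I. g (X i \<omega>))" for \<omega>
    have [measurable]: "Z m \<in> borel_measurable M" "Z' \<in> borel_measurable M" for m
      unfolding Z_def[abs_def] Z'_def[abs_def] by measurable
    have iZ: "integrable M (\<lambda>\<omega>. (Z m \<omega>)\<^sup>2)" for m
      using integrable_growth[of "\<lambda>x. (\<Sum>i\<in>I. poly (P m) (x i))\<^sup>2"] unfolding Z_def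
      by (simp add: poly_growth_intros)
    have ig: "integrable M (\<lambda>\<omega>. (g (X i \<omega>))\<^sup>2)" for i
      using expectation_X(2)[of "\<lambda>x. (g x)\<^sup>2" i] Lp_gauss_2D(2)[OF gL] by simp
    have igX: "integrable M (\<lambda>\<omega>. g (X i \<omega>))" for i
      by (rule integrable_of_square) (simp_all add: ig)
    have ig2: "integrable M (\<lambda>\<omega>. (g (X i \<omega>) - poly (P m) (X i \<omega>))\<^sup>2)" for i m
    proof -
      have "integrable \<gamma> (\<lambda>x. (g x)\<^sup>2 - 2 * (g x * poly (P m) x) + poly (P m) x * poly (P m) x)"
        using Lp_gauss_2D(2)[OF gL] integrable_gauss_mult_poly[OF gL] integrable_gauss_poly_mult[of "P m" "P m"] by simp
      moreover have "(g x - poly (P m) x)\<^sup>2 = (g x)\<^sup>2 - 2 * (g x * poly (P m) x) + poly (P m) x * poly (P m) x" for x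
        by (simp add: power2_eq_square algebra_simps)
      ultimately have "integrable \<gamma> (\<lambda>x. (g x - poly (P m) x)\<^sup>2)" by (simp only:)
      then show ?thesis using expectation_X(2)[of "\<lambda>x. (g x - poly (P m) x)\<^sup>2" i] by simp
    qed
    have iZ': "integrable M (\<lambda>\<omega>. (Z' \<omega>)\<^sup>2)"
    proof (rule Bochner_Integration.integrable_bound)
      show "integrable M (\<lambda>\<omega>. (\<Sum>i\<in>I. (g (X i \<omega>))\<^sup>2) * real (card I))" using ig by simp
      show "AE \<omega> in M. norm ((Z' \<omega>)\<^sup>2) \<le> norm ((\<Sum>i\<in>I. (g (X i \<omega>))\<^sup>2) * real (card I))"
      proof (rule AE_I2)
        fix \<omega>
        have "(Z' \<omega>)\<^sup>2 \<le> (\<Sum>i\<in>I. (g (X i \<omega>))\<^sup>2) * real (card I)"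
          unfolding Z'_def by (rule sum_squared_le_sum_of_squares)
        then show "norm ((Z' \<omega>)\<^sup>2) \<le> norm ((\<Sum>i\<in>I. (g (X i \<omega>))\<^sup>2) * real (card I))" by simp
      qed
    qed simp
    \<comment> \<open>\<open>n\<close> is fixed at this point, so a crude bound with the factor
      \<open>n^2\<close> suffices.\<close>
    have lim: "(\<lambda>m. expectation (\<lambda>\<omega>. (Z m \<omega> - Z' \<omega>)\<^sup>2)) \<longlonglongrightarrow> 0"
    proof (rule Lim_null_comparison[OF always_eventually])
      show "(\<lambda>m. real n * a m * real n) \<longlonglongrightarrow> 0"
        using tendsto_mult[OF tendsto_mult[OF tendsto_const a0] tendsto_const, of "real n" "real n"] by simp
      show "\<forall>m. norm (expectation (\<lambda>\<omega>. (Z m \<omega> - Z' \<omega>)\<^sup>2)) \<le> real n * a m * real n"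
      proof (rule allI)
        fix m
        have i2: "integrable M (\<lambda>\<omega>. (\<Sum>i\<in>I. (g (X i \<omega>) - poly (P m) (X i \<omega>))\<^sup>2) * real (card I))"
          using ig2 by simp
        have le: "(Z m \<omega> - Z' \<omega>)\<^sup>2 \<le> (\<Sum>i\<in>I. (g (X i \<omega>) - poly (P m) (X i \<omega>))\<^sup>2) * real (card I)" for \<omega>
          using sum_squared_le_sum_of_squares[of "\<lambda>i. g (X i \<omega>) - poly (P m) (X i \<omega>)" I]
          unfolding Z_def Z'_def sum_subtractf by (simp add: power2_commute)
        have "expectation (\<lambda>\<omega>. (Z m \<omega> - Z' \<omega>)\<^sup>2)
            \<le> expectation (\<lambda>\<omega>. (\<Sum>i\<in>I. (g (X i \<omega>) - poly (P m) (X i \<omega>))\<^sup>2) * real (card I))"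
        proof (rule integral_mono[OF _ i2 le])
          show "integrable M (\<lambda>\<omega>. (Z m \<omega> - Z' \<omega>)\<^sup>2)"
            by (rule Bochner_Integration.integrable_bound[OF i2]) (use le in \<open>auto intro!: AE_I2 order_trans[OF _ abs_ge_self]\<close>)
        qed
        also have "\<dots> = (\<Sum>i\<in>I. expectation (\<lambda>\<omega>. (g (X i \<omega>) - poly (P m) (X i \<omega>))\<^sup>2)) * real (card I)"
          using ig2 by simp
        also have "\<dots> = real n * a m * real n"
          using expectation_X(1)[of "\<lambda>x. (g x - poly (P m) x)\<^sup>2"] by (simp add: a_def I)
        finally show "norm (expectation (\<lambda>\<omega>. (Z m \<omega> - Z' \<omega>)\<^sup>2)) \<le> real n * a m * real n" by simp
      qed
    qed
    define t where "t m = expectation (\<lambda>\<omega>. (Z m \<omega>)\<^sup>2)" for m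
    define t' where "t' = expectation (\<lambda>\<omega>. (Z' \<omega>)\<^sup>2)"
    have t_lim: "t \<longlonglongrightarrow> t'"
      unfolding t_def[abs_def] t'_def by (rule second_moment_tendsto) (simp_all add: iZ iZ' lim)
    have t_ge: "v * real n \<le> t m" if "2 \<le> m" for m
      using second_moment_lower_bound[OF I(1) that, of c] by (simp add: t_def Z_def P_def v_def I mult_ac)
    have t'_ge: "v * real n \<le> t'"
      by (rule LIMSEQ_le_const[OF t_lim]) (use t_ge in blast)
    have vn: "0 < v * real n" using v n by simp
    have tau: "(\<lambda>m. sqrt (t m)) \<longlonglongrightarrow> sqrt t'" "sqrt t' > 0"
      using tendsto_real_sqrt[OF t_lim] t'_ge vn by simp_all
    \<comment> \<open>From \<open>m = 2\<close> on the truncation contains \<open>c 2\<close>, which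
      makes the normalization \<open>t m\<close> positive.\<close>
    have bound: "\<bar>expectation (\<lambda>\<omega>. h (Z m \<omega> / sqrt (t m))) - (LINT y|lborel. std_normal_density y * h y)\<bar>
        \<le> C1 * (sqrt T / sqrt n) + C2 * (S / sqrt n)"
      if m: "2 \<le> m" and h: "\<And>x. (h has_real_derivative h' x) (at x)" "continuous_on UNIV h'" "\<And>x. \<bar>h' x\<bar> \<le> 1" for m h h'
    proof -
      have tm: "0 < t m" "v * real n \<le> t m" using t_ge[OF m] vn by linarith+
      have "\<bar>expectation (\<lambda>\<omega>. h ((\<Sum>i\<in>I. poly (he_comb m (ct m)) (X i \<omega>)) / sqrt (t m))) - (LINT y|lborel. std_normal_density y * h y)\<bar>
        \<le> 8 * sqrt (4 * K\<^sup>2 * T * real (card I) * G2) / (sqrt (t m))\<^sup>2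
          + 12 * real (card I) * (S * (1 + G2 + 3 * (1 + 6 * K\<^sup>2) * G1)) / sqrt (t m) ^ 3"
      proof (rule polynomial_stein_bound[OF I(1) _ _ _ _ _ G1_le G2_le _ _ S1 _ h])
        show "ct m 0 = 0" "ct m 1 = 0" using c01 by (simp_all add: ct_def)
        show "ct m q = 0" if "m < q" for q using that by (simp add: ct_def)
        show "0 < sqrt (t m)" using tm by simp
        show "(sqrt (t m))\<^sup>2 = expectation (\<lambda>\<omega>. (\<Sum>i\<in>I. poly (he_comb m (ct m)) (X i \<omega>))\<^sup>2)"
          using tm by (simp add: t_def Z_def P_ct)
        show "(\<Sum>l\<in>I. \<bar>cov i l\<bar> * \<bar>cov l a\<bar>) \<le> K" if "i \<in> I" "a \<in> I" for i a
          using stationary_sum_bounds(2)[OF cov sq, of i n a] that by (simp add: I_def K_def)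
        show "(\<Sum>j\<in>I. \<Sum>k\<in>I. \<bar>cov i j\<bar> * \<bar>cov i k\<bar> * \<bar>cov j k\<bar>) \<le> S" if "i \<in> I" for i
          using stationary_sum_bounds(3)[OF cov sq, of i n] that by (simp add: I_def S_def)
        show "(\<Sum>k\<in>I. \<bar>cov i k\<bar>) \<le> T" if "i \<in> I" for i
          using stationary_sum_bounds(1)[OF cov sq, of i n] that by (simp add: I_def T_def)
      qed
      also have "8 * sqrt (4 * K\<^sup>2 * T * real (card I) * G2) / (sqrt (t m))\<^sup>2 \<le> C1 * (sqrt T / sqrt n)"
      proof -
        have "sqrt (4 * K\<^sup>2 * T * real (card I) * G2) = 2 * K * sqrt T * sqrt n * sqrt G2"
          using K0 by (simp add: real_sqrt_mult I)
        then have "8 * sqrt (4 * K\<^sup>2 * T * real (card I) * G2) / (sqrt (t m))\<^sup>2 = 16 * K * sqrt T * sqrt n * sqrt G2 / t m"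
          using tm by simp
        \<comment> \<open>A factor \<open>sqrt n\<close> against \<open>t m \<ge> v * n\<close>
          leaves \<open>n^(- 1/2)\<close>; in the second term it is \<open>n\<close> against the
          power 3/2 of \<open>t m\<close>.\<close>
        also have "\<dots> \<le> 16 * K * sqrt T * sqrt n * sqrt G2 / (v * real n)"
          using tm vn K0 T0 G0 by (intro divide_left_mono) auto
        also have "\<dots> = C1 * (sqrt T * (sqrt n / real n))" using v by (simp add: C1_def)
        also have "sqrt n / real n = 1 / sqrt n" using n by (simp add: field_simps)
        finally show ?thesis by simp
      qed
      also have "12 * real (card I) * (S * (1 + G2 + 3 * (1 + 6 * K\<^sup>2) * G1)) / sqrt (t m) ^ 3 \<le> C2 * (S / sqrt n)"
      proof -
        have 1: "sqrt (v * real n) ^ 3 \<le> sqrt (t m) ^ 3" using tm vn by (intro power_mono) auto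
        have 2: "0 < sqrt (v * real n) ^ 3" using vn by simp
        have "12 * real (card I) * (S * (1 + G2 + 3 * (1 + 6 * K\<^sup>2) * G1)) / sqrt (t m) ^ 3
          \<le> 12 * real (card I) * (S * (1 + G2 + 3 * (1 + 6 * K\<^sup>2) * G1)) / sqrt (v * real n) ^ 3"
          using 1 S1 G0 mult_pos_pos[OF less_le_trans[OF 2 1] 2] by (intro divide_left_mono) auto
        also have "\<dots> = C2 * (S * (real n / sqrt n ^ 3))"
          by (simp add: C2_def I real_sqrt_mult power_mult_distrib)
        also have "real n / sqrt n ^ 3 = 1 / sqrt n" using n by (simp add: power3_eq_cube)
        finally show ?thesis by simp
      qed
      finally show ?thesis by (simp add: Z_def P_ct)
    qed
    have fin: "\<bar>expectation (\<lambda>\<omega>. f (Z' \<omega> / sqrt t')) - (LINT y|lborel. std_normal_density y * f y)\<bar>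
        \<le> C1 * (sqrt T / sqrt n) + C2 * (S / sqrt n)"
    proof (rule lipschitz_bound_limit[OF _ iZ _ iZ' lim tau _ f])
      fix h h' :: "real \<Rightarrow> real"
      assume h: "\<And>x. (h has_real_derivative h' x) (at x)" "continuous_on UNIV h'" "\<And>x. \<bar>h' x\<bar> \<le> 1"
      show "\<forall>\<^sub>F m in sequentially. \<bar>expectation (\<lambda>\<omega>. h (Z m \<omega> / sqrt (t m))) - (LINT y|lborel. std_normal_density y * h y)\<bar>
          \<le> C1 * (sqrt T / sqrt n) + C2 * (S / sqrt n)"
        using eventually_ge_at_top[of 2] by eventually_elim (rule bound[OF _ h])
    qed simp_all
    \<comment> \<open>Because of \<open>c 0 = 0\<close> the sum is centered, so \<open>t'\<close> is
      its variance and \<open>Y_seq\<close> equals \<open>Z' / sqrt t'\<close>; the factors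
      \<open>1 / sqrt n\<close> cancel.\<close>
    have EZ': "expectation Z' = 0"
    proof -
      have "expectation (\<lambda>\<omega>. g (X i \<omega>)) = 0" for i
        using expectation_X(1)[of g i] hermite_expansion_coeff[OF c(1), of 0] c01 by simp
      then show ?thesis unfolding Z'_def[abs_def] using igX by simp
    qed
    have F: "F_seq g X n \<omega> = Z' \<omega> / sqrt n" for \<omega> by (simp add: F_seq_def Z'_def I_def)
    have "variance (F_seq g X n) = expectation (\<lambda>\<omega>. (Z' \<omega> / sqrt n)\<^sup>2)"
      unfolding F using EZ' by simp
    also have "\<dots> = t' / real n" by (simp add: power_divide t'_def)
    finally have "Y_seq M g X n \<omega> = Z' \<omega> / sqrt t'" for \<omega>
      using n by (simp add: Y_seq_def F real_sqrt_divide)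
    then have "\<bar>expectation (\<lambda>\<omega>. f (Y_seq M g X n \<omega>)) - (LINT y|lborel. std_normal_density y * f y)\<bar>
        \<le> C1 * (sqrt T / sqrt n) + C2 * (S / sqrt n)" using fin by simp
    \<comment> \<open>The single constant of the statement has to serve both terms;
      \<open>C1 + C2\<close> does, as everything is nonnegative.\<close>
    also have "\<dots> \<le> (C1 + C2) * (sqrt T / sqrt n) + (C1 + C2) * (S / sqrt n)"
      using C0 T0 S1 by (intro add_mono mult_right_mono) auto
    also have "\<dots> = (C1 + C2) * real n powr (-1/2) * T powr (1/2) + (C1 + C2) * real n powr (-1/2) * S"
    proof -
      have "real n powr (-1/2) = 1 / sqrt n"
        using n powr_minus_divide[of "real n" "1/2"] by (simp add: powr_half_sqrt)
      moreover have "T powr (1/2) = sqrt T" using T0 by (simp add: powr_half_sqrt)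
      ultimately show ?thesis by simp
    qed
    finally show ?thesis by (simp only: T_def S_def)
  qed
  then show thesis by (rule that)
qed

theorem theorem1p2:
  fixes M :: "'a measure" and X :: "nat \<Rightarrow> 'a \<Rightarrow> real"
    and N :: "'b measure" and Z :: "'b \<Rightarrow> real"
    and \<rho> :: "int \<Rightarrow> real" and g Ag :: "real \<Rightarrow> real"
  assumes "prob_space M"
    and "gaussian_sequence M X"
    and "stationary_sequence M X"
    and "\<And>n. prob_space.expectation M (X n) = 0"
    and "\<And>n. prob_space.variance M (X n) = 1"
    and "\<And>k. \<rho> k = prob_space.expectation M (\<lambda>\<omega>. X 0 \<omega> * X (nat \<bar>k\<bar>) \<omega>)"
    and "has_hermite_rank g 2"
    and "is_A g Ag"
    and "Ag \<in> sobolev_gauss 2 6"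
    and "(\<lambda>j::int. \<bar>\<rho> j\<bar>\<^sup>2) summable_on UNIV"
    and "prob_space N"
    and "distributed N lborel Z (\<lambda>x. ennreal (std_normal_density x))"
  shows "\<exists>C::real. \<forall>n\<ge>1.
    wasserstein_dist M (Y_seq M g X n) N Z \<le>
      ereal (C * real n powr (-1/2) * (\<Sum>k\<in>{- int n..int n}. \<bar>\<rho> k\<bar>) powr (1/2)
           + C * real n powr (-1/2) * (\<Sum>k\<in>{- int n..int n}. \<bar>\<rho> k\<bar> powr (3/2))\<^sup>2)"
proof -
  interpret prob_space M by fact
  interpret gaussian_process M X by unfold_locales (use assms in auto)
  have cov: "cov i j = \<rho> (int i - int j)" for i j by (rule cov_stationary[OF assms(3,6)])
  \<comment> \<open>\<open>C\<close> is fixed before \<open>n\<close> and \<open>f\<close>, so it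
    serves all \<open>n\<close> and passes to the supremum over Lipschitz functions.\<close>
  obtain C where C: "\<And>n f. 1 \<le> n \<Longrightarrow> 1-lipschitz_on UNIV f \<Longrightarrow>
    \<bar>expectation (\<lambda>\<omega>. f (Y_seq M g X n \<omega>)) - (LINT y|lborel. std_normal_density y * f y)\<bar>
      \<le> C * real n powr (-1/2) * (\<Sum>k\<in>{- int n..int n}. \<bar>\<rho> k\<bar>) powr (1/2)
        + C * real n powr (-1/2) * (\<Sum>k\<in>{- int n..int n}. \<bar>\<rho> k\<bar> powr (3/2))\<^sup>2"
    by (rule wasserstein_bound[OF cov assms(7-10)]; rule that)
  show ?thesis
  proof (intro exI[of _ C] allI impI)
    fix n :: nat assume n: "1 \<le> n"
    show "wasserstein_dist M (Y_seq M g X n) N Z \<le>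
      ereal (C * real n powr (-1/2) * (\<Sum>k\<in>{- int n..int n}. \<bar>\<rho> k\<bar>) powr (1/2)
           + C * real n powr (-1/2) * (\<Sum>k\<in>{- int n..int n}. \<bar>\<rho> k\<bar> powr (3/2))\<^sup>2)"
      unfolding wasserstein_dist_def
    proof (rule SUP_least)
      fix f :: "real \<Rightarrow> real" assume "f \<in> {f. 1-lipschitz_on UNIV f}"
      then have f: "1-lipschitz_on UNIV f" by simp
      have "f \<in> borel_measurable borel"
        using lipschitz_on_continuous_on[OF f] by (intro borel_measurable_continuous_onI)
      \<comment> \<open>\<open>Z\<close> enters only through its law, which replaces the expectation
        on \<open>N\<close> by the normal integral of the bound.\<close>
      then have "(LINT \<omega>|N. f (Z \<omega>)) = (LINT y|lborel. std_normal_density y * f y)"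
        using distributed_integral[OF assms(12), of f] by simp
      then show "ereal \<bar>expectation (\<lambda>\<omega>. f (Y_seq M g X n \<omega>)) - (LINT \<omega>|N. f (Z \<omega>))\<bar> \<le>
        ereal (C * real n powr (-1/2) * (\<Sum>k\<in>{- int n..int n}. \<bar>\<rho> k\<bar>) powr (1/2)
           + C * real n powr (-1/2) * (\<Sum>k\<in>{- int n..int n}. \<bar>\<rho> k\<bar> powr (3/2))\<^sup>2)"
        using C[OF n f] by simp
    qed
  qed
qed

end
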